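(* Let $G$ be a valued abelian group with valuation $v:G\to\Gamma$ and infinite value set $\Gamma$. Then $G$ is minimal (as a valued group) if and only if all of the following hold: 1. $\Gamma$ has order type $\omega^*$; 2. $v$ has finite fibres; 3. for some prime $p$, one of the following holds: (i) $G$ is elementary abelian of exponent $p$, and either (a) there is $n_0<\omega$ such that the set of $\gamma\in\Gamma$ satisfying $R_{p^{n_0}}(\gamma)\wedge\neg R_{p^{n_0+1}}(\gamma)$ is co-finite in $\Gamma$, or (b) for every $n<\omega$ the set of $\gamma\in\Gamma$ satisfying $R_{p^{n}}(\gamma)\wedge\neg R_{p^{n+1}}(\gamma)$ is finite; (ii) $G$ is a finite product of Prüfer $p$-groups, $f_p$ is eventually an $\mathcal L_v$-isomorphism acting by right shift, and there is $n_0<\omega$ such that $R_{p^{n_0}}(\gamma)\wedge\neg R_{p^{n_0+1}}(\gamma)$ holds for all but finitely many $\gamma\in\Gamma$.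
   Context: A valued abelian group is an abelian group $G$ together with a surjective map $v:G\to\Gamma$, where $\Gamma$ is a linearly ordered set with maximum $\infty$, such that (1) $v(x)=\infty$ iff $x=0$, and (2) $v(x-y)\ge\min\{v(x),v(y)\}$. It is viewed as a structure with group sort $G$ and value sort $\Gamma$ in the language $\mathcal L_{vg}=\{+,0,v,\le,\infty\}$. It is minimal if $G$ is infinite and every subset of $G$ definable with parameters in this structure is finite or co-finite in $G$. $\omega^*$ denotes the reverse order of $\omega$. For $\gamma\in\Gamma\setminus\{\infty\}$ put $\bar B(\gamma)=\{x\in G:v(x)\ge\gamma\}$ and $B^o(\gamma)=\{x\in G:v(x)>\gamma\}$; these are subgroups of $G$. For $m\ge1$, $R_m$ is the unary relation on $\Gamma$ given by $R_m(\gamma)\Leftrightarrow|\bar B(\gamma)/B^o(\gamma)|>m$. For $n\ge 1$, the function $f_n:\Gamma\to\Gamma$ is given by $f_n(v(x))=v(nx)$ wherever this is well-defined, and takes the value $\infty$ at those $\gamma$ where it is not well-defined. $\mathcal L_v=\{\le,R_n,f_n:n\ge1\}$ is the resulting language on $\Gamma$. "$f_p$ is eventually an $\mathcal L_v$-isomorphism acting by right shift" means: outside a finite set (i.e. on an initial segment of $\Gamma$ with finite complement) $f_p$ is well-defined, is given by $\gamma\mapsto$ the $\ell$-th successor of $\gamma$ in $\Gamma$ for some fixed $\ell$, and is an isomorphism onto its image for the $\mathcal L_v$-structure (in particular $R_m(\gamma)\Leftrightarrow R_m(f_p(\gamma))$ for all $m$). *)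

theory Defs
  imports
    Complex_Main
    "HOL-Computational_Algebra.Primes"
    "HOL-Algebra.Product_Groups"
begin

hide_const (open) Order.top

section \<open>Valued abelian groups\<close>

text \<open>The value set is the whole type \<open>'c\<close>; its maximum \<^const>\<open>top\<close> plays the role of \<open>\<infinity>\<close>.\<close>

locale valued_abelian_group =
  fixes v :: "'g::ab_group_add \<Rightarrow> 'c::{linorder, order_top}"
  assumes v_surj: "surj v"
    and v_eq_top_iff: "v x = top \<longleftrightarrow> x = 0"
    and v_diff: "v (x - y) \<ge> min (v x) (v y)"

definition nmult :: "nat \<Rightarrow> 'g \<Rightarrow> 'g::ab_group_add" where
  "nmult n x = (\<Sum>i<n. x)"

section \<open>First-order logic over the two-sorted structure\<close>

datatype gterm = GVar nat | GZero | GAdd gterm gterm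

datatype vterm = VVar nat | VInf | VVal gterm

datatype form =
    GEq gterm gterm
  | VEq vterm vterm
  | VLe vterm vterm
  | Neg form
  | Conj form form
  | GEx nat form
  | VEx nat form

text \<open>The environments \<open>e\<close> and \<open>w\<close> assign elements to the group variables and to the
  value variables; the two sorts have separate name spaces.\<close>

primrec gval :: "(nat \<Rightarrow> 'g) \<Rightarrow> gterm \<Rightarrow> 'g::ab_group_add" where
  "gval e (GVar i) = e i"
| "gval e GZero = 0"
| "gval e (GAdd s t) = gval e s + gval e t"

primrec vval ::
  "('g::ab_group_add \<Rightarrow> 'c::{linorder, order_top}) \<Rightarrow> (nat \<Rightarrow> 'g) \<Rightarrow> (nat \<Rightarrow> 'c) \<Rightarrow> vterm \<Rightarrow> 'c"
where
  "vval v e w (VVar i) = w i"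
| "vval v e w VInf = top"
| "vval v e w (VVal t) = v (gval e t)"

primrec sat ::
  "('g::ab_group_add \<Rightarrow> 'c::{linorder, order_top}) \<Rightarrow> (nat \<Rightarrow> 'g) \<Rightarrow> (nat \<Rightarrow> 'c) \<Rightarrow> form \<Rightarrow> bool"
where
  "sat v e w (GEq s t) \<longleftrightarrow> gval e s = gval e t"
| "sat v e w (VEq s t) \<longleftrightarrow> vval v e w s = vval v e w t"
| "sat v e w (VLe s t) \<longleftrightarrow> vval v e w s \<le> vval v e w t"
| "sat v e w (Neg \<phi>) \<longleftrightarrow> \<not> sat v e w \<phi>"
| "sat v e w (Conj \<phi> \<psi>) \<longleftrightarrow> sat v e w \<phi> \<and> sat v e w \<psi>"
| "sat v e w (GEx i \<phi>) \<longleftrightarrow> (\<exists>x. sat v (e(i := x)) w \<phi>)"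
| "sat v e w (VEx i \<phi>) \<longleftrightarrow> (\<exists>\<gamma>. sat v e (w(i := \<gamma>)) \<phi>)"

text \<open>Group variable 0 is the distinguished free variable; the values of the other variables
  under \<open>e\<close> and \<open>w\<close> are the parameters, from either sort. Only finitely many of them occur
  in \<open>\<phi>\<close>.\<close>

definition definable_set ::
  "('g::ab_group_add \<Rightarrow> 'c::{linorder, order_top}) \<Rightarrow> 'g set \<Rightarrow> bool" where
  "definable_set v S \<longleftrightarrow> (\<exists>\<phi> e w. S = {x. sat v (e(0 := x)) w \<phi>})"

definition minimal_valued_group ::
  "('g::ab_group_add \<Rightarrow> 'c::{linorder, order_top}) \<Rightarrow> bool" where
  "minimal_valued_group v \<longleftrightarrow>
     infinite (UNIV :: 'g set) \<and> (\<forall>S. definable_set v S \<longrightarrow> finite S \<or> finite (- S))"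

section \<open>The structure on the value set\<close>

definition Bcl :: "('g \<Rightarrow> 'c::linorder) \<Rightarrow> 'c \<Rightarrow> 'g set" where
  "Bcl v \<gamma> = {x. v x \<ge> \<gamma>}"

definition Bop :: "('g \<Rightarrow> 'c::linorder) \<Rightarrow> 'c \<Rightarrow> 'g set" where
  "Bop v \<gamma> = {x. v x > \<gamma>}"

definition ball_quotient ::
  "('g::ab_group_add \<Rightarrow> 'c::{linorder, order_top}) \<Rightarrow> 'c \<Rightarrow> 'g set set" where
  "ball_quotient v \<gamma> = (\<lambda>x. (+) x ` Bop v \<gamma>) ` Bcl v \<gamma>"

text \<open>At \<^const>\<open>top\<close>, where the balls are not considered, the relation is false by convention.
  An infinite quotient has more than \<open>m\<close> elements, although its \<^const>\<open>card\<close> is \<open>0\<close>.\<close>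

definition Rrel ::
  "('g::ab_group_add \<Rightarrow> 'c::{linorder, order_top}) \<Rightarrow> nat \<Rightarrow> 'c \<Rightarrow> bool" where
  "Rrel v m \<gamma> \<longleftrightarrow>
     \<gamma> \<noteq> top \<and> (infinite (ball_quotient v \<gamma>) \<or> card (ball_quotient v \<gamma>) > m)"

definition f_well_defined ::
  "('g::ab_group_add \<Rightarrow> 'c::{linorder, order_top}) \<Rightarrow> nat \<Rightarrow> 'c \<Rightarrow> bool" where
  "f_well_defined v n \<gamma> \<longleftrightarrow>
     (\<forall>x y. v x = \<gamma> \<longrightarrow> v y = \<gamma> \<longrightarrow> v (nmult n x) = v (nmult n y))"

definition ffun ::
  "('g::ab_group_add \<Rightarrow> 'c::{linorder, order_top}) \<Rightarrow> nat \<Rightarrow> 'c \<Rightarrow> 'c" where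
  "ffun v n \<gamma> =
     (if f_well_defined v n \<gamma> then (THE \<delta>. \<forall>x. v x = \<gamma> \<longrightarrow> v (nmult n x) = \<delta>) else top)"

text \<open>Isomorphism between the structures induced on two subsets \<open>A\<close> and \<open>B\<close> of the value set.
  These need not be closed under the functions, which are therefore induced as partial
  functions, i.e. through the restrictions of their graphs.\<close>

definition Lv_isomorphism ::
  "('g::ab_group_add \<Rightarrow> 'c::{linorder, order_top}) \<Rightarrow> 'c set \<Rightarrow> 'c set \<Rightarrow> ('c \<Rightarrow> 'c) \<Rightarrow> bool" where
  "Lv_isomorphism v A B h \<longleftrightarrow>
     bij_betw h A B \<and>
     (\<forall>\<gamma>\<in>A. \<forall>\<delta>\<in>A. \<gamma> \<le> \<delta> \<longleftrightarrow> h \<gamma> \<le> h \<delta>) \<and>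
     (\<forall>m\<ge>1. \<forall>\<gamma>\<in>A. Rrel v m \<gamma> \<longleftrightarrow> Rrel v m (h \<gamma>)) \<and>
     (\<forall>n\<ge>1. \<forall>\<gamma>\<in>A. \<forall>\<delta>\<in>A. ffun v n \<gamma> = \<delta> \<longleftrightarrow> ffun v n (h \<gamma>) = h \<delta>)"

definition is_successor :: "'c::linorder \<Rightarrow> 'c \<Rightarrow> bool" where
  "is_successor \<gamma> \<delta> \<longleftrightarrow> \<gamma> < \<delta> \<and> \<not> (\<exists>\<epsilon>. \<gamma> < \<epsilon> \<and> \<epsilon> < \<delta>)"

definition eventually_right_shift ::
  "('g::ab_group_add \<Rightarrow> 'c::{linorder, order_top}) \<Rightarrow> nat \<Rightarrow> bool" where
  "eventually_right_shift v p \<longleftrightarrow>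
     (\<exists>I. (\<forall>\<gamma>\<in>I. \<forall>\<delta>\<le>\<gamma>. \<delta> \<in> I) \<and> finite (- I) \<and>
        (\<forall>\<gamma>\<in>I. f_well_defined v p \<gamma>) \<and>
        (\<exists>l. \<forall>\<gamma>\<in>I. (is_successor ^^ l) \<gamma> (ffun v p \<gamma>)) \<and>
        Lv_isomorphism v I (ffun v p ` I) (ffun v p))"

definition order_type_omega_star :: "'c::linorder itself \<Rightarrow> bool" where
  "order_type_omega_star _ \<longleftrightarrow> (\<exists>h :: nat \<Rightarrow> 'c. bij h \<and> (\<forall>i j. i \<le> j \<longleftrightarrow> h j \<le> h i))"

section \<open>The groups involved\<close>

definition elementary_abelian :: "'g::ab_group_add itself \<Rightarrow> nat \<Rightarrow> bool" where
  "elementary_abelian _ p \<longleftrightarrow> (\<forall>x::'g. nmult p x = 0)"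

definition additive_group :: "'g::ab_group_add itself \<Rightarrow> 'g monoid" where
  "additive_group _ = \<lparr>carrier = UNIV, monoid.mult = (+), one = 0\<rparr>"

text \<open>The complex roots of unity of \<open>p\<close>-power order.\<close>

definition prufer_group :: "nat \<Rightarrow> complex monoid" where
  "prufer_group p = \<lparr>carrier = {z. \<exists>k. z ^ (p ^ k) = 1}, monoid.mult = (*), one = 1\<rparr>"

definition finite_prufer_product :: "'g::ab_group_add itself \<Rightarrow> nat \<Rightarrow> bool" where
  "finite_prufer_product G p \<longleftrightarrow>
     (\<exists>k::nat. additive_group G \<cong> product_group {..<k} (\<lambda>_. prufer_group p))"

end

theory Submission
  imports Defs "HOL-Library.Function_Algebras" "HOL-Library.Product_Plus" "HOL-Library.Countable_Set"
begin

text \<open>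
Sufficiency: number the values downwards by \<open>rk\<close>, so that \<open>rk x = 0\<close> only for \<open>x = 0\<close> and the balls
\<open>{x. rk x \<le> n}\<close> are finite subgroups. A definable set that is neither finite nor co-finite would
separate two elements of infinite rank in an ultrapower, which is \<open>\<aleph>\<^sub>1\<close>-saturated. A back-and-forth between
countable partial isomorphisms over the standard part shows that this is impossible: a new element
is added by way of its best approximation in the domain, or as a pseudo-limit if there is none. For this,
it suffices that the size of the layers is eventually constant or tends to infinity, and that a
multiplication by \<open>n\<close> shifts infinite ranks by a fixed amount or that the group has prime exponent. The
ultrapower is not formed: its elements are represented by sequences, up to equality on a set of the
ultrafilter.

Necessity: a proper definable subgroup is finite. Applied to balls this gives the order type and the finite
fibres; applied to \<open>pG\<close> and \<open>G[p]\<close> it gives that \<open>G\<close> has exponent \<open>p\<close> or is divisible with finite \<open>G[p]\<close>.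
In the divisible case \<open>{x. v (p x) = v x}\<close> cannot be co-finite when \<open>G[p] \<noteq> 0\<close>, because a chain of
\<open>p\<close>-divisions would stay in one fibre; but it contains the torsion prime to \<open>p\<close>, so only one prime
occurs. Finally, for each \<open>l\<close>, the set where \<open>p\<close> lowers the rank by at least \<open>l\<close> is finite or co-finite, and
counting excludes co-finiteness for large \<open>l\<close>, so \<open>p\<close> is eventually a shift.
\<close>

section \<open>Multiples\<close>

text \<open>The obstacle in the back-and-forth is that a new element \<open>xx\<close> brings its
  multiples with it, whereas approximation only controls the ranks of \<open>xx + z\<close> with
  \<open>z\<close> in the domain \<open>R\<close>. Hence the game carries a condition
  \<open>admissible\<close> on domains. In exponent \<open>p\<close> it is trivial: a nonzero
  multiple of \<open>xx\<close> is turned back into \<open>xx\<close> by a multiplier prime to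
  \<open>p\<close>, which preserves ranks. Otherwise it is divisibility: all rational multiples of
  \<open>xx\<close> are added at once, and a new element w satisfies n w = a u for positive integers
  n, a and some u in \<open>xx + R\<close> (up to sign), so that its rank is that of u up to a fixed
  offset. Such offsets are why compatibility speaks of all finite shifts. The game starts from the
  identity on the standard part, which sees of an element of infinite rank only that its rank
  exceeds every integer; so any two such elements may be matched.\<close>

lemma nmult_0 [simp]: "nmult 0 x = 0"
  by (simp add: nmult_def)

lemma nmult_Suc: "nmult (Suc n) x = nmult n x + x"
  by (simp add: nmult_def)

lemma nmult_1 [simp]: "nmult 1 x = x" "nmult (Suc 0) x = x"
  by (simp_all add: nmult_def)

lemma nmult_add: "nmult (m + n) x = nmult m x + nmult n x"
  by (induction n) (simp_all add: nmult_Suc add.assoc)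

lemma nmult_plus: "nmult n (x + y) = nmult n x + nmult n y"
  by (simp add: nmult_def sum.distrib)

lemma nmult_minus: "nmult n (x - y) = nmult n x - nmult n y"
  by (simp add: nmult_def sum_subtractf)

lemma nmult_zero [simp]: "nmult n 0 = 0"
  by (simp add: nmult_def)

lemma nmult_mult: "nmult (m * n) x = nmult m (nmult n x)"
  by (induction m) (simp_all add: nmult_Suc nmult_add)

lemma nmult_commute: "nmult m (nmult n x) = nmult n (nmult m x)"
  by (metis nmult_mult mult.commute)

lemma nmult_sum: "nmult n (sum f A) = (\<Sum>a\<in>A. nmult n (f a))"
  by (simp add: nmult_def sum.swap[of _ A])

lemma nmult_apply [simp]: "nmult n f i = nmult n (f i)"
  by (induction n) (simp_all add: nmult_Suc)

lemma nmult_fst_snd [simp]: "fst (nmult n z) = nmult n (fst z)" "snd (nmult n z) = nmult n (snd z)"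
  by (induction n; simp add: nmult_Suc)+

definition imult :: "int \<Rightarrow> 'g \<Rightarrow> 'g::ab_group_add" where
  "imult k x = nmult (nat k) x - nmult (nat (- k)) x"

lemma imult_diff: "imult (int m - int n) x = nmult m x - nmult n x"
proof (cases "n \<le> m")
  case True
  then obtain k where "m = n + k" using le_Suc_ex by blast
  then show ?thesis by (simp add: imult_def nmult_add)
next
  case False
  then obtain k where "n = m + k" using le_Suc_ex nat_le_linear by blast
  then show ?thesis by (simp add: imult_def nmult_add)
qed

lemma imult_of_nat [simp]: "imult (int n) x = nmult n x"
  using imult_diff[of n 0 x] by simp

lemma imult_0 [simp]: "imult 0 x = 0" and imult_1 [simp]: "imult 1 x = x"
  using imult_of_nat[of 0 x] imult_of_nat[of 1 x] by simp_all

lemma imult_add: "imult (k + l) x = imult k x + imult l x"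
proof -
  obtain a b where k: "k = int a - int b" by (rule int_diff_cases)
  obtain c d where l: "l = int c - int d" by (rule int_diff_cases)
  have "k + l = int (a + c) - int (b + d)" by (simp add: k l)
  then show ?thesis unfolding k l by (simp only: imult_diff nmult_add) simp
qed

lemma imult_uminus: "imult (- k) x = - imult k x"
  using imult_add[of k "- k" x] by (simp add: eq_neg_iff_add_eq_0 add.commute)

lemma imult_minus: "imult (k - l) x = imult k x - imult l x"
  using imult_add[of k "- l" x] by (simp add: imult_uminus)

lemma imult_nmult: "imult (k * int n) x = imult k (nmult n x)"
proof -
  obtain a b where k: "k = int a - int b" by (rule int_diff_cases)
  have "k * int n = int (a * n) - int (b * n)" by (simp add: k algebra_simps)
  then show ?thesis unfolding k by (simp only: imult_diff nmult_mult)
qed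

lemma imult_zero [simp]: "imult k 0 = 0"
  by (simp add: imult_def)

lemma additive_map:
  fixes f :: "'a::ab_group_add \<Rightarrow> 'b::ab_group_add"
  assumes "\<And>x y. f (x + y) = f x + f y"
  shows "f 0 = 0" "f (- x) = - f x" "f (x - y) = f x - f y" "f (nmult n x) = nmult n (f x)"
    "f (sum g A) = (\<Sum>a\<in>A. f (g a))"
proof -
  show 0: "f 0 = 0" using assms[of 0 0] by simp
  show 1: "f (- x) = - f x" for x using assms[of x "- x"] 0 by (simp add: eq_neg_iff_add_eq_0 add.commute)
  show "f (x - y) = f x - f y" using assms[of x "- y"] 1 by simp
  show "f (nmult n x) = nmult n (f x)" by (induction n) (simp_all add: 0 assms nmult_Suc)
  show "f (sum g A) = (\<Sum>a\<in>A. f (g a))"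
    by (induction A rule: infinite_finite_induct) (simp_all add: 0 assms)
qed

lemma nmult_field: "nmult n (r::'a::field) = of_nat n * r"
  by (simp add: nmult_def)

text \<open>The divisors must lie in \<open>D\<close> itself, because the notion is applied not only
  to whole groups but also to the sets of pairs \<open>R\<close> in the game.\<close>

definition divisible :: "'g::ab_group_add set \<Rightarrow> bool" where
  "divisible D \<longleftrightarrow> (\<forall>n>0. \<forall>x\<in>D. \<exists>y\<in>D. nmult n y = x)"

lemma divisible_fun:
  assumes "divisible (UNIV :: 'g::ab_group_add set)"
  shows "divisible (UNIV :: ('a \<Rightarrow> 'g) set)"
  unfolding divisible_def
proof (intro allI impI ballI)
  fix n :: nat and x :: "'a \<Rightarrow> 'g" assume "n > 0"
  then have "\<forall>i. \<exists>y. nmult n y = x i" using assms by (auto simp: divisible_def)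
  then obtain y where "\<And>i. nmult n (y i) = x i" by metis
  then have "nmult n y = x" by auto
  then show "\<exists>y\<in>UNIV. nmult n y = x" by blast
qed

lemma divisible_prod:
  assumes "divisible (UNIV :: 'a::ab_group_add set)" "divisible (UNIV :: 'b::ab_group_add set)"
  shows "divisible (UNIV :: ('a \<times> 'b) set)"
  unfolding divisible_def
proof (intro allI impI ballI)
  fix n :: nat and x :: "'a \<times> 'b" assume n: "n > 0"
  obtain y z where "nmult n y = fst x" "nmult n z = snd x"
    using assms n unfolding divisible_def by blast
  then have "nmult n (y, z) = x" by (simp add: prod_eq_iff)
  then show "\<exists>y\<in>UNIV. nmult n y = x" by blast
qed

text \<open>Divide \<open>x\<close> successively by 1, 2, 3, ...: \<open>y n\<close> plays the part
  of x / n!. Every rational is a / n! for some n and is sent to \<open>imult a (y n)\<close>.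
  Passing to a larger factorial multiplies the numerator by exactly the quotient that relates the
  corresponding members of \<open>y\<close>, so the choice of n does not matter.\<close>

lemma divisible_hom_rat:
  fixes x :: "'g::ab_group_add"
  assumes "divisible (UNIV :: 'g set)"
  obtains \<theta> :: "rat \<Rightarrow> 'g" where "\<And>r s. \<theta> (r + s) = \<theta> r + \<theta> s" "\<theta> 1 = x"
proof -
  have "\<exists>y :: nat \<Rightarrow> 'g. \<forall>n. (n = 0 \<longrightarrow> y n = x) \<and> nmult (Suc n) (y (Suc n)) = y n"
  proof (rule dependent_nat_choice)
    show "\<exists>z. (Suc n = 0 \<longrightarrow> z = x) \<and> nmult (Suc n) z = y" for y :: 'g and n
      using assms by (auto simp: divisible_def)
    show "\<exists>z. 0 = (0::nat) \<longrightarrow> z = x" by blast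
  qed
  then obtain y :: "nat \<Rightarrow> 'g" where y0: "y 0 = x" and yS: "\<And>n. nmult (Suc n) (y (Suc n)) = y n"
    by auto
  have yfact: "nmult (fact (m + k) div fact m) (y (m + k)) = y m" for m k
  proof (induction k)
    case (Suc k)
    have "fact (m + Suc k) div fact m = (fact (m + k) div fact m) * Suc (m + k)"
      by (simp add: fact_dvd div_mult_swap mult.commute)
    then show ?case using Suc yS[of "m + k"] by (simp only: nmult_mult) simp
  qed simp
  have key1: "imult a (y m) = imult b (y (m + k))"
    if "r * fact m = of_int a" "r * fact (m + k) = of_int b" for r :: rat and a b m k
  proof -
    have fd: "(fact (m + k) :: nat) = fact m * (fact (m + k) div fact m)"
      by (simp add: fact_dvd)
    have "of_int b = r * (of_nat (fact (m + k)) :: rat)" using that by simp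
    also have "\<dots> = of_int a * of_nat (fact (m + k) div fact m)"
      by (subst fd) (simp only: of_nat_mult of_nat_fact that(1)[symmetric] mult.assoc)
    finally have "b = a * int (fact (m + k) div fact m)"
      by (metis of_int_eq_iff of_int_mult of_int_of_nat_eq)
    then show ?thesis by (simp add: imult_nmult yfact)
  qed
  have key: "imult a (y m) = imult b (y n)"
    if "r * fact m = of_int a" "r * fact n = of_int b" for r :: rat and a b m n
    using key1[of r m a "n - m" b] key1[of r n b "m - n" a] that by (cases "m \<le> n") auto
  have ex: "\<exists>n a. r * fact n = of_int a" for r :: rat
  proof -
    obtain p q where r: "r = of_int p / of_int q" "q > 0" by (metis quotient_of_div quotient_of_denom_pos surj_pair)
    have "nat q dvd fact (nat q)" using r by (intro dvd_fact) auto
    then obtain c where "fact (nat q) = nat q * c" by blast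
    then have "(fact (nat q) :: rat) = of_int q * of_nat c" using r
      by (metis of_nat_fact of_nat_mult of_int_of_nat_eq int_nat_eq less_le)
    then have "r * fact (nat q) = of_int (p * int c)" using r by simp
    then show ?thesis by blast
  qed
  define \<theta> where "\<theta> r = (THE z. \<exists>n a. r * fact n = of_int a \<and> z = imult a (y n))" for r :: rat
  have \<theta>: "\<theta> r = imult a (y n)" if "r * fact n = of_int a" for r a n
    unfolding \<theta>_def
  proof (rule the_equality)
    show "\<exists>m b. r * fact m = of_int b \<and> imult a (y n) = imult b (y m)" using that by blast
    show "z = imult a (y n)" if "\<exists>n a. r * fact n = of_int a \<and> z = imult a (y n)" for z
      using that key \<open>r * fact n = of_int a\<close> by blast
  qed
  have up: "\<exists>a. r * fact m = of_int a" if "r * fact n = of_int b" "n \<le> m" for r :: rat and n m b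
  proof -
    have "(fact n :: int) dvd fact m" using that by (simp add: fact_dvd)
    then obtain c where "(fact m :: int) = fact n * c" by blast
    then have "(fact m :: rat) = fact n * of_int c" by (metis of_int_fact of_int_mult)
    then have "r * fact m = of_int (b * c)" using that by simp
    then show ?thesis by blast
  qed
  show thesis
  proof
    fix r s :: rat
    obtain n a m b where "r * fact n = of_int a" "s * fact m = of_int b" using ex[of r] ex[of s] by blast
    then obtain c d where *: "r * fact (n + m) = of_int c" "s * fact (n + m) = of_int d"
      using up[of r n a "n + m"] up[of s m b "n + m"] by auto
    show "\<theta> (r + s) = \<theta> r + \<theta> s"
      using \<theta>[OF *(1)] \<theta>[OF *(2)] \<theta>[of "r + s" "n + m" "c + d"] * by (simp add: imult_add algebra_simps)
  next
    have "\<theta> 1 = imult 1 (y 0)" by (rule \<theta>) simp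
    then show "\<theta> 1 = x" by (simp add: y0)
  qed
qed

section \<open>Ultrafilters and saturation\<close>

text \<open>The condition \<open>U \<le> sequentially\<close> puts every co-finite set into the
  ultrafilter and so makes it non-principal.\<close>

definition ultra :: "nat filter \<Rightarrow> bool" where
  "ultra U \<longleftrightarrow> U \<noteq> bot \<and> U \<le> sequentially \<and> (\<forall>P. eventually P U \<or> eventually (\<lambda>i. \<not> P i) U)"

text \<open>Zorn's lemma for families of sets whose finite intersections are infinite, not merely
  non-empty: this keeps finite sets out, so that a maximal family is a non-principal
  ultrafilter.\<close>

lemma ultra_exists: "\<exists>U. ultra U"
proof -
  define \<A> :: "nat set set set" where "\<A> = {F. \<forall>B. finite B \<longrightarrow> B \<subseteq> F \<longrightarrow> infinite (\<Inter>B)}"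
  have "\<Union>C \<in> \<A>" if C: "C \<in> chains \<A>" for C
    unfolding \<A>_def
  proof (intro CollectI allI impI)
    fix B assume B: "finite B" "B \<subseteq> \<Union>C"
    show "infinite (\<Inter>B)"
    proof (cases "B = {}")
      case True
      then show ?thesis by simp
    next
      case False
      then have "C \<noteq> {}" using B by auto
      moreover have "subset.chain \<A> C" using C by (simp add: chains_alt_def)
      ultimately obtain F where "F \<in> C" "B \<subseteq> F" using finite_subset_Union_chain[OF B] by blast
      then show ?thesis using B C by (auto simp: chains_def \<A>_def)
    qed
  qed
  then obtain M where M: "M \<in> \<A>" and max: "\<And>X. X \<in> \<A> \<Longrightarrow> M \<subseteq> X \<Longrightarrow> X = M"
    using Zorn_Lemma[of \<A>] by blast
  have inf: "infinite (\<Inter>B)" if "finite B" "B \<subseteq> M" for B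
    using M that by (auto simp: \<A>_def)
  have ext: "\<exists>B. finite B \<and> B \<subseteq> M \<and> finite (S \<inter> \<Inter>B)" if "S \<notin> M" for S
  proof -
    have "insert S M \<notin> \<A>" using max[of "insert S M"] that by blast
    then obtain B where B: "finite B" "B \<subseteq> insert S M" "finite (\<Inter>B)" by (auto simp: \<A>_def)
    have "S \<inter> \<Inter>(B - {S}) \<subseteq> \<Inter>B" by auto
    then show ?thesis using B by (intro exI[of _ "B - {S}"]) (auto intro: finite_subset)
  qed
  have dich: "S \<in> M \<or> - S \<in> M" for S
  proof (rule ccontr)
    assume "\<not> ?thesis"
    then obtain B B' where B: "finite B" "B \<subseteq> M" "finite (S \<inter> \<Inter>B)"
      "finite B'" "B' \<subseteq> M" "finite (- S \<inter> \<Inter>B')" using ext[of S] ext[of "- S"] by blast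
    have "\<Inter>(B \<union> B') \<subseteq> (S \<inter> \<Inter>B) \<union> (- S \<inter> \<Inter>B')" by auto
    then show False using inf[of "B \<union> B'"] B by (meson finite_UnI finite_subset le_sup_iff)
  qed
  have fin: "finite S \<Longrightarrow> S \<notin> M" for S using inf[of "{S}"] by auto
  have up: "T \<in> M" if "S \<in> M" "S \<subseteq> T" for S T
  proof (rule ccontr)
    assume "T \<notin> M"
    then have "- T \<in> M" using dich by blast
    moreover have "S \<inter> - T = {}" using that by blast
    ultimately show False using inf[of "{S, - T}"] that by simp
  qed
  have conj: "S \<inter> T \<in> M" if "S \<in> M" "T \<in> M" for S T
  proof (rule ccontr)
    assume "S \<inter> T \<notin> M"
    then have "- (S \<inter> T) \<in> M" using dich by blast
    then have "infinite (\<Inter>{S, T, - (S \<inter> T)})" using that by (intro inf) auto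
    moreover have "\<Inter>{S, T, - (S \<inter> T)} = {}" by auto
    ultimately show False by simp
  qed
  define U where "U = Abs_filter (\<lambda>P. {i. P i} \<in> M)"
  have ev: "eventually P U \<longleftrightarrow> {i. P i} \<in> M" for P
    unfolding U_def
  proof (rule eventually_Abs_filter, rule is_filter.intro)
    show "{i. True} \<in> M" using dich[of UNIV] fin[of "{}"] by auto
    show "{i. P i \<and> Q i} \<in> M" if "{i. P i} \<in> M" "{i. Q i} \<in> M" for P Q
      using conj[OF that] by (simp add: Collect_conj_eq)
    show "{i. Q i} \<in> M" if "\<forall>i. P i \<longrightarrow> Q i" "{i. P i} \<in> M" for P Q
      by (rule up[OF that(2)]) (use that(1) in auto)
  qed
  have "U \<noteq> bot" using fin[of "{}"] by (auto simp: trivial_limit_def ev)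
  moreover have "U \<le> sequentially"
  proof (rule filter_leI)
    fix P assume "eventually P sequentially"
    then have "finite (- {i. P i})"
      by (simp add: cofinite_eq_sequentially[symmetric] eventually_cofinite Collect_neg_eq)
    then show "eventually P U" using fin dich by (auto simp: ev)
  qed
  moreover have "eventually P U \<or> eventually (\<lambda>i. \<not> P i) U" for P
    using dich[of "{i. P i}"] by (simp add: ev Collect_neg_eq)
  ultimately show ?thesis unfolding ultra_def by blast
qed

lemma ultra_not: "ultra U \<Longrightarrow> eventually (\<lambda>i. \<not> P i) U \<longleftrightarrow> \<not> eventually P U"
  using eventually_conj[of P U "\<lambda>i. \<not> P i"] by (auto simp: ultra_def trivial_limit_def)

lemma ultra_disj: "ultra U \<Longrightarrow> eventually (\<lambda>i. P i \<or> Q i) U \<longleftrightarrow> eventually P U \<or> eventually Q U"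
  using ultra_not[of U P] ultra_not[of U Q] ultra_not[of U "\<lambda>i. P i \<or> Q i"]
  by (simp add: eventually_conj_iff) blast

lemma ultra_ge: "ultra U \<Longrightarrow> eventually (\<lambda>i. n \<le> i) U"
  using eventually_ge_at_top[of n] filter_leD unfolding ultra_def by blast

lemma ultra_finite_const:
  assumes "ultra U" "finite F" "eventually (\<lambda>i. f i \<in> F) U"
  shows "\<exists>a\<in>F. eventually (\<lambda>i. f i = a) U"
  using assms(2,3)
proof (induction F)
  case empty
  then show ?case using assms(1) by (simp add: ultra_def trivial_limit_def)
next
  case (insert a F)
  then show ?case using ultra_disj[OF assms(1), of "\<lambda>i. f i = a"] by auto
qed

text \<open>A diagonal argument: at index \<open>i\<close>, satisfy as many of the first
  \<open>i\<close> conditions at once as possible. Any finite number of them is jointly satisfiable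
  on a set of the ultrafilter, so each single one holds almost everywhere.\<close>

lemma ultra_saturation:
  assumes U: "ultra U" and K: "countable K"
    and fs: "\<And>F. finite F \<Longrightarrow> F \<subseteq> K \<Longrightarrow> \<exists>X. \<forall>k\<in>F. eventually (\<lambda>i. P k i (X i)) U"
  shows "\<exists>X. \<forall>k\<in>K. eventually (\<lambda>i. P k i (X i)) U"
proof (cases "K = {}")
  case False
  define e where "e = from_nat_into K"
  have e: "range e = K" unfolding e_def using False K by (rule range_from_nat_into)
  define good where "good n i \<longleftrightarrow> (\<exists>x. \<forall>m<n. P (e m) i x)" for n i
  have evg: "eventually (good n) U" for n
  proof -
    obtain X where "\<forall>k\<in>e ` {..<n}. eventually (\<lambda>i. P k i (X i)) U"
      using fs[of "e ` {..<n}"] e by auto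
    then have "eventually (\<lambda>i. \<forall>m\<in>{..<n}. P (e m) i (X i)) U"
      by (simp add: eventually_ball_finite_distrib)
    then show ?thesis by eventually_elim (auto simp: good_def)
  qed
  \<comment> \<open>The bound by \<open>i\<close> makes the maximum exist; as co-finite sets belong
    to \<open>U\<close>, \<open>N i\<close> still exceeds every constant almost everywhere.\<close>
  define N where "N i = Max {n. n \<le> i \<and> good n i}" for i
  have fin: "finite {n. n \<le> i \<and> good n i}" for i by simp
  have ne: "0 \<in> {n. n \<le> i \<and> good n i}" for i by (simp add: good_def)
  have "N i \<in> {n. n \<le> i \<and> good n i}" for i
    unfolding N_def using Max_in[OF fin] ne by blast
  then have "\<exists>x. \<forall>m<N i. P (e m) i x" for i by (auto simp: good_def)
  then obtain X where X: "\<And>i m. m < N i \<Longrightarrow> P (e m) i (X i)" by metis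
  have "eventually (\<lambda>i. P (e m) i (X i)) U" for m
    using evg[of "Suc m"] ultra_ge[OF U, of "Suc m"]
  proof eventually_elim
    case (elim i)
    then have "Suc m \<le> N i" unfolding N_def by (intro Max_ge fin) simp
    then show ?case by (intro X) simp
  qed
  then show ?thesis using e by blast
qed simp

section \<open>Compatible sequences of ranks\<close>

type_synonym seqpair = "(nat \<Rightarrow> int) \<times> (nat \<Rightarrow> int)"
type_synonym 'g elempair = "(nat \<Rightarrow> 'g) \<times> (nat \<Rightarrow> 'g)"

text \<open>The shifts by \<open>k\<close> make compatible pairs agree on all finite gaps, hence on successors.\<close>

definition compat :: "nat filter \<Rightarrow> seqpair set \<Rightarrow> bool" where
  "compat U Q \<longleftrightarrow> (\<forall>(c, c')\<in>Q. \<forall>(d, d')\<in>Q. \<forall>k.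
     eventually (\<lambda>i. c i \<le> d i + k) U \<longleftrightarrow> eventually (\<lambda>i. c' i \<le> d' i + k) U)"

definition represented :: "nat filter \<Rightarrow> seqpair set \<Rightarrow> seqpair \<Rightarrow> bool" where
  "represented U Q = (\<lambda>(e, e'). \<exists>(c, c')\<in>Q. \<exists>k.
     eventually (\<lambda>i. e i = c i + k) U \<and> eventually (\<lambda>i. e' i = c' i + k) U)"

lemma compatD:
  assumes "compat U Q" "(c, c') \<in> Q" "(d, d') \<in> Q"
  shows "eventually (\<lambda>i. c i \<le> d i + k) U \<longleftrightarrow> eventually (\<lambda>i. c' i \<le> d' i + k) U"
  using assms unfolding compat_def by fast

lemma compat_le:
  assumes "compat U Q" "(c, c') \<in> Q" "(d, d') \<in> Q"
  shows "eventually (\<lambda>i. c i \<le> d i) U \<longleftrightarrow> eventually (\<lambda>i. c' i \<le> d' i) U"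
  using compatD[OF assms, of 0] by simp

lemma compat_less:
  assumes "compat U Q" "(c, c') \<in> Q" "(d, d') \<in> Q"
  shows "eventually (\<lambda>i. c i < d i) U \<longleftrightarrow> eventually (\<lambda>i. c' i < d' i) U"
proof -
  have "x < y \<longleftrightarrow> x \<le> y + - 1" for x y :: int by auto
  then show ?thesis using compatD[OF assms, of "- 1"] by presburger
qed

text \<open>Shifting both components of a pair by the same integer only changes the offset in a
  comparison, and compatibility covers all offsets. So new pairs are harmless once they are traced
  back to old ones.\<close>

lemma compat_represented:
  assumes Q: "compat U Q" and rep: "\<And>z. z \<in> Q' \<Longrightarrow> represented U Q z"
  shows "compat U Q'"
  unfolding compat_def
proof safe
  fix e e' f f' m
  assume "(e, e') \<in> Q'" "(f, f') \<in> Q'"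
  then have "represented U Q (e, e')" "represented U Q (f, f')" using rep by blast+
  then obtain c c' k d d' j where c: "(c, c') \<in> Q" "eventually (\<lambda>i. e i = c i + k) U" "eventually (\<lambda>i. e' i = c' i + k) U"
    and d: "(d, d') \<in> Q" "eventually (\<lambda>i. f i = d i + j) U" "eventually (\<lambda>i. f' i = d' i + j) U"
    unfolding represented_def by auto
  have 1: "eventually (\<lambda>i. e i \<le> f i + m) U \<longleftrightarrow> eventually (\<lambda>i. c i \<le> d i + (j + m - k)) U"
    using c(2) d(2) by (intro eventually_subst, eventually_elim) auto
  have 2: "eventually (\<lambda>i. e' i \<le> f' i + m) U \<longleftrightarrow> eventually (\<lambda>i. c' i \<le> d' i + (j + m - k)) U"
    using c(3) d(3) by (intro eventually_subst, eventually_elim) auto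
  have 3: "eventually (\<lambda>i. e i \<le> f i + m) U \<longleftrightarrow> eventually (\<lambda>i. e' i \<le> f' i + m) U"
    unfolding 1 2 by (rule compatD[OF Q c(1) d(1)])
  show "eventually (\<lambda>i. e i \<le> f i + m) U" if "eventually (\<lambda>i. e' i \<le> f' i + m) U"
    using that 3 by blast
  show "eventually (\<lambda>i. e' i \<le> f' i + m) U" if "eventually (\<lambda>i. e i \<le> f i + m) U"
    using that 3 by blast
qed

lemma represented_member: "z \<in> Q \<Longrightarrow> represented U Q z"
  unfolding represented_def by (cases z) (force intro: exI[of _ 0])

lemma compat_swap: "compat U (prod.swap ` Q) \<longleftrightarrow> compat U Q"
  unfolding compat_def by fastforce

text \<open>The required \<open>c'\<close> realises a cut: it must lie relative to every
  \<open>d' + k\<close> as \<open>c\<close> lies relative to \<open>d + k\<close>. Finitely many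
  such conditions on an integer are solvable as soon as each lower bound is strictly below each
  upper bound, which compatibility of the old pairs provides; saturation does the rest.\<close>

lemma compat_insert:
  assumes U: "ultra U" and Q: "compat U Q" "countable Q"
  obtains c' where "compat U (insert (c, c') Q)"
proof -
  define T :: "seqpair \<Rightarrow> int \<Rightarrow> bool" where "T = (\<lambda>(d, d') k. eventually (\<lambda>i. c i \<le> d i + k) U)"
  define P :: "seqpair \<times> int \<Rightarrow> nat \<Rightarrow> int \<Rightarrow> bool" where "P = (\<lambda>((d, d'), k) i x. if T (d, d') k then x \<le> d' i + k else d' i + k < (x :: int))"
  have "\<exists>X. \<forall>z\<in>Q \<times> (UNIV :: int set). eventually (\<lambda>i. P z i (X i)) U"
  proof (rule ultra_saturation[OF U])
    show "countable (Q \<times> (UNIV :: int set))" using Q by auto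
    fix F assume F: "finite F" "F \<subseteq> Q \<times> (UNIV :: int set)"
    define F1 where "F1 = {z \<in> F. T (fst z) (snd z)}"
    define F2 where "F2 = F - F1"
    have fin: "finite F1" "finite F2" using F by (auto simp: F1_def F2_def)
    define up where "up z i = snd (fst z) i + snd z" for z :: "seqpair \<times> int" and i
    have cross: "eventually (\<lambda>i. up z i < up w i) U" if "z \<in> F2" "w \<in> F1" for z w
    proof -
      obtain d d' k e e' j where zw: "z = ((d, d'), k)" "w = ((e, e'), j)" by (metis surj_pair)
      have *: "(d, d') \<in> Q" "(e, e') \<in> Q" using that zw F by (auto simp: F1_def F2_def)
      have "eventually (\<lambda>i. c i \<le> e i + j) U" "\<not> eventually (\<lambda>i. c i \<le> d i + k) U"
        using that zw by (auto simp: F1_def F2_def T_def)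
      then have "eventually (\<lambda>i. c i \<le> e i + j) U" "eventually (\<lambda>i. \<not> c i \<le> d i + k) U"
        using ultra_not[OF U] by auto
      \<comment> \<open>From d + k < c \<le> e + j follows the strict inequality d + k < e + j; the
        \<open>- 1\<close> keeps it strict under the transfer.\<close>
      then have "eventually (\<lambda>i. d i \<le> e i + (j - k - 1)) U" by eventually_elim simp
      then have "eventually (\<lambda>i. d' i \<le> e' i + (j - k - 1)) U" using compatD[OF Q(1) *] by blast
      then show ?thesis by eventually_elim (simp add: up_def zw)
    qed
    have ev: "eventually (\<lambda>i. \<forall>z\<in>F2. \<forall>w\<in>F1. up z i < up w i) U"
      using fin cross by (simp add: eventually_ball_finite_distrib)
    \<comment> \<open>The least integer above all lower bounds or, if there are none, the smallest
      upper bound.\<close>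
    define X where "X i = (if F2 = {} then (if F1 = {} then 0 else Min ((\<lambda>w. up w i) ` F1))
        else Max ((\<lambda>w. up w i) ` F2) + 1)" for i
    have "eventually (\<lambda>i. P z i (X i)) U" if z: "z \<in> F" for z
      using ev
    proof eventually_elim
      case (elim i)
      obtain d d' k where zz: "z = ((d, d'), k)" by (metis surj_pair)
      show ?case
      proof (cases "z \<in> F1")
        case True
        have "X i \<le> up z i"
        proof (cases "F2 = {}")
          case True
          then show ?thesis using \<open>z \<in> F1\<close> fin(1) by (auto simp: X_def intro!: Min_le)
        next
          case False
          then have "Max ((\<lambda>w. up w i) ` F2) \<in> (\<lambda>w. up w i) ` F2" using fin(2) by (intro Max_in) auto
          then have "Max ((\<lambda>w. up w i) ` F2) < up z i" using elim \<open>z \<in> F1\<close> by auto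
          then show ?thesis using False by (simp add: X_def)
        qed
        then show ?thesis using True by (auto simp: P_def zz F1_def up_def)
      next
        case False
        then have "z \<in> F2" using z by (simp add: F2_def)
        then have "up z i \<le> Max ((\<lambda>w. up w i) ` F2)" using fin(2) by (intro Max_ge) auto
        then have "up z i < X i" using \<open>z \<in> F2\<close> by (auto simp: X_def)
        then show ?thesis using False z by (auto simp: P_def zz F1_def up_def)
      qed
    qed
    then show "\<exists>X. \<forall>z\<in>F. eventually (\<lambda>i. P z i (X i)) U" by blast
  qed
  then obtain c' where c': "\<And>z. z \<in> Q \<times> (UNIV :: int set) \<Longrightarrow> eventually (\<lambda>i. P z i (c' i)) U" by blast
  have A: "eventually (\<lambda>i. c i \<le> d i + k) U \<longleftrightarrow> eventually (\<lambda>i. c' i \<le> d' i + k) U"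
    if "(d, d') \<in> Q" for d d' k
  proof (cases "T (d, d') k")
    case True
    then show ?thesis using c'[of "((d, d'), k)"] that by (auto simp: P_def T_def)
  next
    case False
    then have "eventually (\<lambda>i. \<not> c' i \<le> d' i + k) U"
      using c'[of "((d, d'), k)"] that by (simp add: P_def not_le)
    then show ?thesis using False ultra_not[OF U] by (auto simp: T_def)
  qed
  \<comment> \<open>Only comparisons with \<open>c\<close> on the left were prescribed. Over the
    integers those with \<open>c\<close> on the right are their negations with offset - k -
    1.\<close>
  have neg: "eventually (\<lambda>i. d i \<le> e i + k) U \<longleftrightarrow> \<not> eventually (\<lambda>i. e i \<le> d i + (- k - 1)) U"
    for d e :: "nat \<Rightarrow> int" and k
  proof -
    have "(\<lambda>i. d i \<le> e i + k) = (\<lambda>i. \<not> e i \<le> d i + (- k - 1))" by auto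
    then show ?thesis by (simp only: ultra_not[OF U])
  qed
  have B: "eventually (\<lambda>i. d i \<le> c i + k) U \<longleftrightarrow> eventually (\<lambda>i. d' i \<le> c' i + k) U"
    if "(d, d') \<in> Q" for d d' k
    using A[OF that, of "- k - 1"] neg[of d c k] neg[of d' c' k] by blast
  have C: "eventually (\<lambda>i. d i \<le> e i + k) U \<longleftrightarrow> eventually (\<lambda>i. d' i \<le> e' i + k) U"
    if "(d, d') \<in> Q" "(e, e') \<in> Q" for d d' e e' k
    by (rule compatD[OF Q(1) that])
  have "compat U (insert (c, c') Q)"
    unfolding compat_def
  proof (intro ballI, clarify)
    fix d d' e e' k
    assume *: "(d, d') \<in> insert (c, c') Q" "(e, e') \<in> insert (c, c') Q"
    show "eventually (\<lambda>i. d i \<le> e i + k) U \<longleftrightarrow> eventually (\<lambda>i. d' i \<le> e' i + k) U"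
      using * A B C by auto
  qed
  then show thesis by (rule that)
qed

section \<open>Ranked groups\<close>

definition val :: "('g \<Rightarrow> int) \<Rightarrow> 'g elempair \<Rightarrow> seqpair" where
  "val rk z = (rk \<circ> fst z, rk \<circ> snd z)"

definition additive_set :: "'g::ab_group_add set \<Rightarrow> bool" where
  "additive_set R \<longleftrightarrow> 0 \<in> R \<and> (\<forall>z\<in>R. \<forall>w\<in>R. z - w \<in> R)"

lemma additive_setD:
  assumes "additive_set R"
  shows "0 \<in> R" "z \<in> R \<Longrightarrow> w \<in> R \<Longrightarrow> z - w \<in> R" "z \<in> R \<Longrightarrow> - z \<in> R" "z \<in> R \<Longrightarrow> w \<in> R \<Longrightarrow> z + w \<in> R"
    "z \<in> R \<Longrightarrow> nmult n z \<in> R"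
proof -
  show 0: "0 \<in> R" and m: "\<And>z w. z \<in> R \<Longrightarrow> w \<in> R \<Longrightarrow> z - w \<in> R" using assms by (auto simp: additive_set_def)
  show u: "- z \<in> R" if "z \<in> R" for z using m[OF 0 that] by simp
  show p: "z + w \<in> R" if "z \<in> R" "w \<in> R" for z w using m[OF that(1) u[OF that(2)]] by simp
  show "nmult n z \<in> R" if "z \<in> R" by (induction n) (auto simp: 0 nmult_Suc p that)
qed

text \<open>The identity on the standard part of the ultrapower. Its presence in every position
  keeps the group parameters of a formula fixed.\<close>

definition constants :: "'g elempair set" where
  "constants = range (\<lambda>g. (\<lambda>_. g, \<lambda>_. g))"

text \<open>For n > 0, a separated set represents distinct cosets of {rk < n} in {rk \<le> n}. So
  \<open>wide rk m n\<close> says that this quotient has at least \<open>m\<close> elements, without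
  forming it.\<close>

definition separated :: "('g::ab_group_add \<Rightarrow> int) \<Rightarrow> int \<Rightarrow> 'g set \<Rightarrow> bool" where
  "separated rk n S \<longleftrightarrow> (\<forall>x\<in>S. rk x \<le> n) \<and> (\<forall>x\<in>S. \<forall>y\<in>S. x \<noteq> y \<longrightarrow> n \<le> rk (x - y))"

definition wide :: "('g::ab_group_add \<Rightarrow> int) \<Rightarrow> nat \<Rightarrow> int \<Rightarrow> bool" where
  "wide rk m n \<longleftrightarrow> (\<exists>S. finite S \<and> card S = m \<and> separated rk n S)"

text \<open>Ranks are integers rather than naturals so that offsets of either sign can be added
  freely. They run against the order of the values, hence the ultrametric inequality with
  \<open>max\<close>.\<close>

locale ranked_group =
  fixes rk :: "'g::ab_group_add \<Rightarrow> int"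
  assumes rk_nonneg: "0 \<le> rk x"
    and rk_eq_0_iff: "rk x = 0 \<longleftrightarrow> x = 0"
    and rk_diff: "rk (x - y) \<le> max (rk x) (rk y)"
    and finite_rk: "finite {x. rk x \<le> n}"
begin

lemma rk_0 [simp]: "rk 0 = 0"
  by (simp add: rk_eq_0_iff)

lemma rk_minus [simp]: "rk (- x) = rk x"
  using rk_diff[of 0 x] rk_diff[of 0 "- x"] rk_nonneg[of x] rk_nonneg[of "- x"] by auto

lemma rk_minus_commute: "rk (x - y) = rk (y - x)"
  by (metis minus_diff_eq rk_minus)

lemma rk_add: "rk (x + y) \<le> max (rk x) (rk y)"
  using rk_diff[of x "- y"] by simp

lemma rk_add_eq: "rk x < rk y \<Longrightarrow> rk (x + y) = rk y"
  using rk_add[of x y] rk_diff[of "x + y" x] by auto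

lemma rk_nmult: "rk (nmult n x) \<le> rk x"
proof (induction n)
  case 0
  then show ?case using rk_nonneg by simp
next
  case (Suc n)
  then show ?case using rk_add[of "nmult n x" x] by (simp add: nmult_Suc)
qed

lemma countable_group: "countable (UNIV :: 'g set)"
proof -
  have "(UNIV :: 'g set) = (\<Union>n::int. {x. rk x \<le> n})" by auto
  moreover have "countable (\<Union>n::int. {x. rk x \<le> n})"
    by (intro countable_UN) (auto intro: countable_finite finite_rk)
  ultimately show ?thesis by simp
qed

end

text \<open>\<open>R\<close> is the graph of a partial isomorphism although this is not required explicitly: compatibility
  with the pair of zero sequences makes one component of a pair vanish (almost everywhere) when the
  other does.\<close>

definition position :: "nat filter \<Rightarrow> ('g::ab_group_add \<Rightarrow> int) \<Rightarrow>
    'g elempair set \<Rightarrow> seqpair set \<Rightarrow> bool" where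
  "position U rk R W \<longleftrightarrow> additive_set R \<and> countable R \<and> countable W \<and> constants \<subseteq> R \<and>
     compat U (W \<union> val rk ` R)"

text \<open>Besides the old pairs, only the ranks of \<open>xx + z\<close> are listed. Those of the
  other multiples of \<open>xx\<close> are traced back to these by
  \<open>represented\<close>.\<close>

abbreviation candidates :: "('g::ab_group_add \<Rightarrow> int) \<Rightarrow> 'g elempair set \<Rightarrow> seqpair set \<Rightarrow> 'g elempair \<Rightarrow> seqpair set" where
  "candidates rk R W xx \<equiv> W \<union> val rk ` R \<union> (\<lambda>z. val rk (xx + z)) ` R"

lemma val_swap: "val rk (prod.swap z) = prod.swap (val rk z)"
  by (simp add: val_def)

lemma position_swap:
  assumes "position U rk R W"
  shows "position U rk (prod.swap ` R) (prod.swap ` W)"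
proof -
  have "val rk ` prod.swap ` R = prod.swap ` val rk ` R"
    by (simp add: image_image val_swap)
  then have "compat U (prod.swap ` W \<union> val rk ` prod.swap ` R)"
    using assms compat_swap[of U "W \<union> val rk ` R"] by (simp add: position_def image_Un)
  moreover have "additive_set (prod.swap ` R)"
    unfolding additive_set_def
  proof (intro conjI ballI)
    have R: "additive_set R" using assms by (simp add: position_def)
    have "prod.swap 0 \<in> prod.swap ` R" using additive_setD(1)[OF R] by (rule imageI)
    then show "0 \<in> prod.swap ` R" by (simp add: zero_prod_def)
    fix z w assume "z \<in> prod.swap ` R" "w \<in> prod.swap ` R"
    then obtain a b where ab: "z = prod.swap a" "w = prod.swap b" "a \<in> R" "b \<in> R" by blast
    have "prod.swap (a - b) \<in> prod.swap ` R" using additive_setD(2)[OF R ab(3,4)] by (rule imageI)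
    then show "z - w \<in> prod.swap ` R" by (simp add: ab prod.swap_def)
  qed
  moreover have "constants \<subseteq> prod.swap ` R"
  proof
    fix z :: "(nat \<Rightarrow> 'a) \<times> (nat \<Rightarrow> 'a)" assume z: "z \<in> constants"
    then have "z \<in> R" "prod.swap z = z" using assms by (auto simp: position_def constants_def)
    then show "z \<in> prod.swap ` R" by (metis imageI)
  qed
  ultimately show ?thesis using assms by (simp add: position_def)
qed

section \<open>One-point extensions of partial isomorphisms\<close>

locale ranked_ultra = ranked_group rk for rk :: "'g::ab_group_add \<Rightarrow> int" +
  fixes U :: "nat filter"
  assumes U: "ultra U"
    and wide_eventually: "\<exists>N. (\<forall>n\<ge>N. wide rk m n) \<or> (\<forall>n\<ge>N. \<not> wide rk m n)"
begin

definition inf_seq :: "(nat \<Rightarrow> int) \<Rightarrow> bool" where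
  "inf_seq c \<longleftrightarrow> (\<forall>N. eventually (\<lambda>i. N < c i) U)"

text \<open>A rank is infinite when it exceeds the zero sequence by every integer offset, and
  compatibility preserves exactly such comparisons.\<close>

lemma inf_seq_transfer:
  assumes Q: "compat U Q" "(c, c') \<in> Q" "val rk 0 \<in> Q" and c: "inf_seq c"
  shows "inf_seq c'"
  unfolding inf_seq_def
proof
  fix N
  have 0: "(\<lambda>_. 0, \<lambda>_. 0) \<in> Q" using Q(3) by (simp add: val_def comp_def zero_prod_def)
  have "eventually (\<lambda>i. 0 \<le> c i + (- N - 1)) U"
    using c[unfolded inf_seq_def, rule_format, of N] by eventually_elim simp
  then have "eventually (\<lambda>i. 0 \<le> c' i + (- N - 1)) U"
    using compatD[OF Q(1) 0 Q(2), of "- N - 1"] by simp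
  then show "eventually (\<lambda>i. N < c' i) U" by eventually_elim simp
qed

text \<open>Balls are finite, so a sequence of bounded rank is constant on a set of the ultrafilter:
  the elements of finite rank in the ultrapower are the standard ones.\<close>

lemma not_constant_inf_seq:
  assumes "\<And>g. \<not> eventually (\<lambda>i. y i = g) U"
  shows "inf_seq (rk \<circ> y)"
  unfolding inf_seq_def
proof
  fix N
  show "eventually (\<lambda>i. N < (rk \<circ> y) i) U"
  proof (rule ccontr)
    assume "\<not> ?thesis"
    then have "eventually (\<lambda>i. \<not> N < (rk \<circ> y) i) U" using ultra_not[OF U] by blast
    then have "eventually (\<lambda>i. y i \<in> {x. rk x \<le> N}) U" by eventually_elim simp
    then show False using ultra_finite_const[OF U finite_rk] assms by blast
  qed
qed

text \<open>The images of finitely many elements in a layer of infinite rank fill as much of the layer as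
  the elements themselves do, because the width of the layers is eventually constant.\<close>

lemma avoid_finite:
  assumes pos: "position U rk R W" and F: "finite F" "F \<subseteq> R" "0 \<in> F"
    and c: "compat U (insert (c, c') (W \<union> val rk ` R))" "inf_seq c"
    and y: "eventually (\<lambda>i. rk (y i) = c i) U"
    and best: "\<And>z. z \<in> F \<Longrightarrow> eventually (\<lambda>i. c i \<le> rk (y i - fst z i)) U"
  shows "\<exists>y'. \<forall>z\<in>F. eventually (\<lambda>i. rk (y' i) \<le> c' i \<and> c' i \<le> rk (y' i - snd z i)) U"
proof -
  define Q where "Q = insert (c, c') (W \<union> val rk ` R)"
  have R: "additive_set R" using pos by (simp add: position_def)
  have Qc: "compat U Q" "(c, c') \<in> Q" and QR: "\<And>z. z \<in> R \<Longrightarrow> (rk \<circ> fst z, rk \<circ> snd z) \<in> Q"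
    using c by (auto simp: Q_def val_def)
  have less: "eventually (\<lambda>i. rk (fst z i) < c i) U \<longleftrightarrow> eventually (\<lambda>i. rk (snd z i) < c' i) U"
    and gt: "eventually (\<lambda>i. c i < rk (fst z i)) U \<longleftrightarrow> eventually (\<lambda>i. c' i < rk (snd z i)) U"
    if "z \<in> R" for z
    using compat_less[OF Qc(1) QR[OF that] Qc(2)] compat_less[OF Qc QR[OF that]] by simp_all
  \<comment> \<open>The remaining elements of \<open>F\<close> cause no trouble: their images have
    rank beyond \<open>c'\<close>, so their distance to any element of rank \<open>c'\<close> is
    beyond \<open>c'\<close> as well.\<close>
  define F1 where "F1 = {z \<in> F. eventually (\<lambda>i. rk (fst z i) \<le> c i) U}"
  have F1: "finite F1" "F1 \<subseteq> F" using F by (auto simp: F1_def)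
  define apart where "apart G \<longleftrightarrow> (\<forall>z\<in>G. \<forall>w\<in>G. z \<noteq> w \<longrightarrow> eventually (\<lambda>i. c i \<le> rk (fst z i - fst w i)) U)"
    for G :: "'g elempair set"
  \<comment> \<open>A maximal such \<open>G\<close> represents the cosets of {rk < c} that
    \<open>F1\<close> meets.\<close>
  have "finite {G. G \<subseteq> F1 \<and> apart G}" using F1 by auto
  moreover have "{} \<in> {G. G \<subseteq> F1 \<and> apart G}" by (simp add: apart_def)
  ultimately obtain G where "G \<in> {G. G \<subseteq> F1 \<and> apart G}" "\<forall>H\<in>{G. G \<subseteq> F1 \<and> apart G}. G \<subseteq> H \<longrightarrow> G = H"
    by (meson finite_has_maximal2)
  then have G: "G \<subseteq> F1" "apart G" and Gmax: "\<And>H. H \<subseteq> F1 \<Longrightarrow> apart H \<Longrightarrow> G \<subseteq> H \<Longrightarrow> H = G"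
    by blast+
  have finG: "finite G" using G F1 finite_subset by blast
  have near: "\<exists>w\<in>G. z = w \<or> eventually (\<lambda>i. rk (fst z i - fst w i) < c i) U" if z: "z \<in> F1" for z
  proof (rule ccontr)
    assume no: "\<not> ?thesis"
    have "z \<notin> G" using no by blast
    have *: "eventually (\<lambda>i. c i \<le> rk (fst z i - fst w i)) U" if "w \<in> G" for w
    proof -
      have "\<not> eventually (\<lambda>i. rk (fst z i - fst w i) < c i) U" using no that by blast
      then show ?thesis using ultra_not[OF U, of "\<lambda>i. rk (fst z i - fst w i) < c i"] by (simp add: not_less)
    qed
    have "apart (insert z G)" unfolding apart_def
    proof (intro ballI impI)
      fix a b assume ab: "a \<in> insert z G" "b \<in> insert z G" "a \<noteq> b"
      consider "a = z" "b \<in> G" | "b = z" "a \<in> G" | "a \<in> G" "b \<in> G" using ab by blast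
      then show "eventually (\<lambda>i. c i \<le> rk (fst a i - fst b i)) U"
      proof cases
        case 1 then show ?thesis using * by simp
      next
        case 2 then show ?thesis using *[of a] by (simp add: rk_minus_commute)
      next
        case 3 then show ?thesis using G(2) ab(3) by (simp add: apart_def)
      qed
    qed
    then show False using Gmax[of "insert z G"] G(1) z \<open>z \<notin> G\<close> by blast
  qed
  \<comment> \<open>\<open>y\<close> adds one coset to those of \<open>G\<close>. Conversely, a
    layer of this width on the other side has a coset that the image of \<open>G\<close>
    misses.\<close>
  define m where "m = Suc (card G)"
  have wide_c: "eventually (\<lambda>i. wide rk m (c i)) U"
  proof -
    have "eventually (\<lambda>i. \<forall>z\<in>G. \<forall>w\<in>G. z \<noteq> w \<longrightarrow> c i \<le> rk (fst z i - fst w i)) U"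
      using finG G(2) by (auto simp: eventually_ball_finite_distrib apart_def)
    moreover have "eventually (\<lambda>i. \<forall>z\<in>G. c i \<le> rk (y i - fst z i)) U"
      using finG G(1) F1 best by (auto simp: eventually_ball_finite_distrib)
    moreover have "eventually (\<lambda>i. \<forall>z\<in>G. rk (fst z i) \<le> c i) U"
      using finG G(1) by (auto simp: eventually_ball_finite_distrib F1_def)
    moreover have "eventually (\<lambda>i. 0 < c i) U" using c(2) by (simp add: inf_seq_def)
    ultimately show ?thesis using y
    proof eventually_elim
      case (elim i)
      have inj: "inj_on (\<lambda>z. fst z i) G"
      proof (rule inj_onI, rule ccontr)
        fix z w assume zw: "z \<in> G" "w \<in> G" "fst z i = fst w i" "z \<noteq> w"
        then have "c i \<le> rk (fst z i - fst w i)" using elim(1) by blast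
        then show False using elim(4) zw(3) by simp
      qed
      have notin: "y i \<notin> (\<lambda>z. fst z i) ` G"
      proof
        assume "y i \<in> (\<lambda>z. fst z i) ` G"
        then obtain z where z: "z \<in> G" "y i = fst z i" by blast
        then have "c i \<le> rk (y i - fst z i)" using elim(2) by blast
        then show False using elim(4) z(2) by simp
      qed
      have "card (insert (y i) ((\<lambda>z. fst z i) ` G)) = m"
        using finG inj notin by (simp add: card_image m_def)
      moreover have "separated rk (c i) (insert (y i) ((\<lambda>z. fst z i) ` G))"
        unfolding separated_def
      proof (intro conjI ballI impI)
        show "rk a \<le> c i" if "a \<in> insert (y i) ((\<lambda>z. fst z i) ` G)" for a
          using that elim(3,5) by auto
        fix a b assume "a \<in> insert (y i) ((\<lambda>z. fst z i) ` G)" "b \<in> insert (y i) ((\<lambda>z. fst z i) ` G)" "a \<noteq> b"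
        then show "c i \<le> rk (a - b)"
        proof (elim insertE imageE, goal_cases)
          case (2 z) then show ?case using elim(2) by simp
        next
          case (3 z) then show ?case using elim(2) rk_minus_commute[of a b] by simp
        next
          case (4 z w)
          then have "z \<noteq> w" by blast
          then show ?case using elim(1) 4 by simp
        qed simp
      qed
      moreover have "finite (insert (y i) ((\<lambda>z. fst z i) ` G))" using finG by simp
      ultimately show ?case unfolding wide_def by (intro exI conjI)
    qed
  qed
  obtain N where N: "(\<forall>n\<ge>N. wide rk m n) \<or> (\<forall>n\<ge>N. \<not> wide rk m n)" using wide_eventually by blast
  \<comment> \<open>Width \<open>m\<close> at a single rank beyond \<open>N\<close> settles the
    alternative in favour of width \<open>m\<close> at all large ranks, in particular at those of
    \<open>c'\<close>.\<close>
  have wideN: "wide rk m n" if "n \<ge> N" for n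
  proof -
    have "eventually (\<lambda>i. N < c i) U" using c(2) by (simp add: inf_seq_def)
    then have "eventually (\<lambda>i. N \<le> c i \<and> wide rk m (c i)) U" using wide_c by eventually_elim simp
    then have "\<exists>i. N \<le> c i \<and> wide rk m (c i)"
      using U eventually_happens unfolding ultra_def by blast
    then show ?thesis using N that by blast
  qed
  have "val rk 0 \<in> Q" using additive_setD(1)[OF R] by (auto simp: Q_def)
  then have "inf_seq c'" using inf_seq_transfer[OF Qc] c(2) by blast
  then have "eventually (\<lambda>i. N < c' i) U" by (simp add: inf_seq_def)
  then have wide_c': "eventually (\<lambda>i. wide rk m (c' i)) U" by eventually_elim (simp add: wideN)
  have "\<exists>u. wide rk m (c' i) \<longrightarrow> rk u \<le> c' i \<and> (\<forall>z\<in>G. c' i \<le> rk (u - snd z i))" for i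
  proof (cases "wide rk m (c' i)")
    case True
    then obtain S where S: "finite S" "card S = m" "separated rk (c' i) S" by (auto simp: wide_def)
    \<comment> \<open>Pigeonhole: \<open>S\<close> has one element more than \<open>G\<close>, and
      two elements of \<open>S\<close> at distance less than \<open>c'\<close> from the same element
      of \<open>G\<close> would be at distance less than \<open>c'\<close> from each other.\<close>
    have "\<exists>u\<in>S. \<forall>z\<in>G. c' i \<le> rk (u - snd z i)"
    proof (rule ccontr)
      assume "\<not> ?thesis"
      then obtain f where f: "\<And>u. u \<in> S \<Longrightarrow> f u \<in> G \<and> rk (u - snd (f u) i) < c' i"
        by (metis not_le)
      have "inj_on f S"
      proof (rule inj_onI, rule ccontr)
        fix u t assume ut: "u \<in> S" "t \<in> S" "f u = f t" "u \<noteq> t"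
        have "c' i \<le> rk (u - t)" using S(3) ut by (simp add: separated_def)
        moreover have "u - t = (u - snd (f u) i) - (t - snd (f u) i)" by simp
        ultimately have "c' i \<le> max (rk (u - snd (f u) i)) (rk (t - snd (f u) i))"
          by (metis rk_diff order_trans)
        then show False using f[OF ut(1)] f[OF ut(2)] ut(3) by auto
      qed
      then have "card S \<le> card G" using f finG by (intro card_inj_on_le[of f]) auto
      then show False using S(2) by (simp add: m_def)
    qed
    then show ?thesis using S(3) by (auto simp: separated_def)
  qed simp
  then obtain y' where y': "\<And>i. wide rk m (c' i) \<Longrightarrow> rk (y' i) \<le> c' i \<and> (\<forall>z\<in>G. c' i \<le> rk (y' i - snd z i))"
    by metis
  have ev1: "eventually (\<lambda>i. rk (y' i) \<le> c' i \<and> (\<forall>z\<in>G. c' i \<le> rk (y' i - snd z i))) U"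
    using wide_c' by eventually_elim (rule y')
  have near': "eventually (\<lambda>i. c' i \<le> rk (y' i - snd z i)) U" if z: "z \<in> F1" for z
  proof -
    obtain w where w: "w \<in> G" "z = w \<or> eventually (\<lambda>i. rk (fst z i - fst w i) < c i) U"
      using near[OF z] by blast
    show ?thesis
    proof (cases "z = w")
      case True
      show ?thesis using ev1 by eventually_elim (use True w(1) in blast)
    next
      case False
      have "z - w \<in> R" using z w(1) G(1) F1 F R by (meson additive_setD(2) subsetD)
      then have "eventually (\<lambda>i. rk (snd (z - w) i) < c' i) U"
        using less[of "z - w"] w(2) False by simp
      then show ?thesis using ev1
      proof eventually_elim
        case (elim i)
        have "c' i \<le> rk (y' i - snd w i)" using elim w(1) by blast
        moreover have "y' i - snd w i = (y' i - snd z i) + snd (z - w) i" by simp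
        ultimately have "c' i \<le> max (rk (y' i - snd z i)) (rk (snd (z - w) i))" by (metis rk_add order_trans)
        then show ?case using elim(1) by auto
      qed
    qed
  qed
  \<comment> \<open>The distance to 0 is the rank itself, so that avoiding 0 turns the bound
    \<open>c'\<close> on the rank of \<open>y'\<close> into an equality.\<close>
  have "0 \<in> F1" using F(3) c(2) by (auto simp: F1_def inf_seq_def intro: eventually_mono[of "\<lambda>i. 0 < c i"])
  then have "eventually (\<lambda>i. c' i \<le> rk (y' i)) U" using near'[of 0] by simp
  then have y'c: "eventually (\<lambda>i. rk (y' i) = c' i) U"
    using ev1 by eventually_elim auto
  have "eventually (\<lambda>i. rk (y' i) \<le> c' i \<and> c' i \<le> rk (y' i - snd z i)) U" if z: "z \<in> F" for z
  proof (cases "z \<in> F1")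
    case True
    show ?thesis using near'[OF True] ev1 by eventually_elim simp
  next
    case False
    then have "eventually (\<lambda>i. \<not> rk (fst z i) \<le> c i) U"
      using z ultra_not[OF U, of "\<lambda>i. rk (fst z i) \<le> c i"] by (simp add: F1_def)
    then have "eventually (\<lambda>i. c i < rk (fst z i)) U" by (simp add: not_le)
    then have "eventually (\<lambda>i. c' i < rk (snd z i)) U" using gt z F by blast
    then show ?thesis using y'c
    proof eventually_elim
      case (elim i)
      then show ?case using rk_add_eq[of "y' i" "- snd z i"] by simp
    qed
  qed
  then show ?thesis by blast
qed

text \<open>Subtract the best approximation: for \<open>y = x - fst z0\<close> and w in
  \<open>R\<close>, the rank of y + w is the larger of the ranks of y and w. So all ranks in
  question are old ones or the rank \<open>c\<close> of \<open>y\<close>, and it suffices to find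
  \<open>y'\<close> of the matching rank \<open>c'\<close> that no element of the range
  approximates.\<close>

lemma extend_best:
  assumes pos: "position U rk R W"
    and new: "\<And>z. z \<in> R \<Longrightarrow> \<not> eventually (\<lambda>i. x i = fst z i) U"
    and z0: "z0 \<in> R" "\<And>z. z \<in> R \<Longrightarrow> eventually (\<lambda>i. rk (x i - fst z0 i) \<le> rk (x i - fst z i)) U"
  shows "\<exists>x'. compat U (candidates rk R W (x, x'))"
proof -
  note R = additive_setD[OF conjunct1[OF pos[unfolded position_def]]]
  have cst: "((\<lambda>_. g), (\<lambda>_. g)) \<in> R" for g
    using pos by (auto simp: position_def constants_def)
  define y where "y = x - fst z0"
  define c where "c = rk \<circ> y"
  \<comment> \<open>If \<open>y\<close> were constant on a set of the ultrafilter, \<open>x\<close>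
    would already agree with an element of the domain, as the constants belong to it.\<close>
  have inf: "inf_seq c" unfolding c_def
  proof (rule not_constant_inf_seq)
    fix g
    have "\<not> eventually (\<lambda>i. x i = fst (z0 + ((\<lambda>_. g), (\<lambda>_. g))) i) U"
      using new R(4)[OF z0(1) cst] by blast
    then show "\<not> eventually (\<lambda>i. y i = g) U" by (simp add: y_def algebra_simps)
  qed
  have best: "eventually (\<lambda>i. c i \<le> rk (y i + fst z i)) U" if "z \<in> R" for z
    using z0(2)[OF R(2)[OF z0(1) that]] by (simp add: c_def y_def algebra_simps)
  have "compat U (W \<union> val rk ` R)" "countable (W \<union> val rk ` R)"
    using pos by (auto simp: position_def)
  then obtain c' where c': "compat U (insert (c, c') (W \<union> val rk ` R))"
    using compat_insert[OF U] by blast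
  have "\<exists>y'. \<forall>z\<in>R. eventually (\<lambda>i. rk (y' i) \<le> c' i \<and> c' i \<le> rk (y' i - snd z i)) U"
  proof (rule ultra_saturation[OF U])
    show "countable R" using pos by (simp add: position_def)
    fix F assume F: "finite F" "F \<subseteq> R"
    have "\<exists>y'. \<forall>z\<in>insert 0 F. eventually (\<lambda>i. rk (y' i) \<le> c' i \<and> c' i \<le> rk (y' i - snd z i)) U"
    proof (rule avoid_finite[OF pos _ _ _ c' inf])
      show "finite (insert 0 F)" "insert 0 F \<subseteq> R" "0 \<in> insert 0 F" using F R(1) by auto
      show "eventually (\<lambda>i. rk (y i) = c i) U" by (simp add: c_def)
      show "eventually (\<lambda>i. c i \<le> rk (y i - fst z i)) U" if "z \<in> insert 0 F" for z
        using best[OF R(3)[of z]] that F R(1) by auto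
    qed
    then show "\<exists>y'. \<forall>z\<in>F. eventually (\<lambda>i. rk (y' i) \<le> c' i \<and> c' i \<le> rk (y' i - snd z i)) U"
      by blast
  qed
  then obtain y' where y': "\<And>z. z \<in> R \<Longrightarrow>
      eventually (\<lambda>i. rk (y' i) \<le> c' i \<and> c' i \<le> rk (y' i - snd z i)) U" by blast
  have y'0: "eventually (\<lambda>i. rk (y' i) = c' i) U" using y'[OF R(1)] by eventually_elim simp
  have y'p: "eventually (\<lambda>i. c' i \<le> rk (y' i + snd z i)) U" if "z \<in> R" for z
    using y'[OF R(3)[OF that]] by eventually_elim simp
  define Q where "Q = insert (c, c') (W \<union> val rk ` R)"
  have rep: "represented U Q (val rk ((x, y' + snd z0) + z))" if z: "z \<in> R" for z
  proof -
    define w where "w = z0 + z"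
    have w: "w \<in> R" using R(4)[OF z0(1) z] by (simp add: w_def)
    have e: "val rk ((x, y' + snd z0) + z) = (\<lambda>i. rk (y i + fst w i), \<lambda>i. rk (y' i + snd w i))"
      by (auto simp: val_def w_def y_def fun_eq_iff algebra_simps)
    have wQ: "(rk \<circ> fst w, rk \<circ> snd w) \<in> Q" and cQ: "(c, c') \<in> Q"
      using w by (auto simp: Q_def val_def)
    show ?thesis
    proof (cases "eventually (\<lambda>i. (rk \<circ> fst w) i \<le> c i) U")
      case True
      have 1: "eventually (\<lambda>i. rk (y i + fst w i) = c i + 0) U"
        using True best[OF w]
      proof eventually_elim
        case (elim i)
        then show ?case using rk_add[of "y i" "fst w i"] by (simp add: c_def)
      qed
      have "eventually (\<lambda>i. (rk \<circ> snd w) i \<le> c' i) U"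
        using True compat_le[OF c'[folded Q_def] wQ cQ] by blast
      then have 2: "eventually (\<lambda>i. rk (y' i + snd w i) = c' i + 0) U"
        using y'p[OF w] y'0
      proof eventually_elim
        case (elim i)
        then show ?case using rk_add[of "y' i" "snd w i"] by simp
      qed
      show ?thesis unfolding e represented_def using cQ 1 2 by blast
    next
      case False
      then have gt: "eventually (\<lambda>i. c i < (rk \<circ> fst w) i) U"
        using ultra_not[OF U, of "\<lambda>i. (rk \<circ> fst w) i \<le> c i"] by (simp add: not_le)
      then have 1: "eventually (\<lambda>i. rk (y i + fst w i) = (rk \<circ> fst w) i + 0) U"
        by eventually_elim (simp add: c_def rk_add_eq)
      have "eventually (\<lambda>i. c' i < (rk \<circ> snd w) i) U"
        using gt compat_less[OF c'[folded Q_def] cQ wQ] by blast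
      then have 2: "eventually (\<lambda>i. rk (y' i + snd w i) = (rk \<circ> snd w) i + 0) U"
        using y'0 by eventually_elim (simp add: rk_add_eq)
      show ?thesis unfolding e represented_def using wQ 1 2 by blast
    qed
  qed
  have "compat U (candidates rk R W (x, y' + snd z0))"
  proof (rule compat_represented[OF c'[folded Q_def]])
    fix q assume "q \<in> candidates rk R W (x, y' + snd z0)"
    then show "represented U Q q"
      using rep by (auto simp: Q_def intro: represented_member)
  qed
  then show ?thesis by blast
qed

text \<open>If \<beta> z approximates x better than z, then x - z has the same rank as \<beta> z -
  z, which lies in the domain. So \<open>x'\<close> has to satisfy the conditions obtained by
  applying the partial isomorphism. Finitely many of them are met by the image of one domain element
  b that approximates x better than all the z and \<beta> z involved.\<close>

lemma extend_no_best:
  assumes pos: "position U rk R W"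
    and nb: "\<And>z. z \<in> R \<Longrightarrow> \<exists>w\<in>R. eventually (\<lambda>i. rk (x i - fst w i) < rk (x i - fst z i)) U"
  shows "\<exists>x'. compat U (candidates rk R W (x, x'))"
proof -
  note R = additive_setD[OF conjunct1[OF pos[unfolded position_def]]]
  define Q where "Q = W \<union> val rk ` R"
  have Q: "compat U Q" and QR: "\<And>z. z \<in> R \<Longrightarrow> (rk \<circ> fst z, rk \<circ> snd z) \<in> Q"
    using pos by (auto simp: Q_def position_def val_def)
  from nb obtain \<beta> where \<beta>: "\<And>z. z \<in> R \<Longrightarrow> \<beta> z \<in> R"
    "\<And>z. z \<in> R \<Longrightarrow> eventually (\<lambda>i. rk (x i - fst (\<beta> z) i) < rk (x i - fst z i)) U" by metis
  have better: "\<exists>b\<in>R. \<forall>z\<in>F. eventually (\<lambda>i. rk (x i - fst b i) < rk (x i - fst z i)) U"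
    if "finite F" "F \<subseteq> R" for F
    using that
  proof (induction F)
    case empty
    then show ?case using R(1) by blast
  next
    case (insert z F)
    then obtain b where b: "b \<in> R" "\<And>z. z \<in> F \<Longrightarrow> eventually (\<lambda>i. rk (x i - fst b i) < rk (x i - fst z i)) U"
      by auto
    show ?case
    proof (cases "eventually (\<lambda>i. rk (x i - fst b i) < rk (x i - fst z i)) U")
      case True
      then show ?thesis using b by auto
    next
      case False
      then have le: "eventually (\<lambda>i. rk (x i - fst z i) \<le> rk (x i - fst b i)) U"
        using ultra_not[OF U, of "\<lambda>i. rk (x i - fst b i) < rk (x i - fst z i)"] by (simp add: not_less)
      have zR: "z \<in> R" using insert.prems by simp
      have "eventually (\<lambda>i. rk (x i - fst (\<beta> z) i) < rk (x i - fst w i)) U" if "w \<in> F" for w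
        using le b(2)[OF that] \<beta>(2)[OF zR] by eventually_elim simp
      then show ?thesis using \<beta>[OF zR] by auto
    qed
  qed
  have "\<exists>x'. \<forall>z\<in>R. eventually (\<lambda>i. rk (x' i - snd z i) = rk (snd (\<beta> z) i - snd z i)) U"
  proof (rule ultra_saturation[OF U])
    show "countable R" using pos by (simp add: position_def)
    fix F assume F: "finite F" "F \<subseteq> R"
    then have "finite (F \<union> \<beta> ` F)" "F \<union> \<beta> ` F \<subseteq> R" using \<beta>(1) by blast+
    from better[OF this] obtain b where b0: "b \<in> R"
      "\<forall>z\<in>F \<union> \<beta> ` F. eventually (\<lambda>i. rk (x i - fst b i) < rk (x i - fst z i)) U"
      by (elim bexE)
    note b = b0(1) bspec[OF b0(2)]
    have "eventually (\<lambda>i. rk (snd b i - snd z i) = rk (snd (\<beta> z) i - snd z i)) U" if z: "z \<in> F" for z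
    proof -
      have zR: "z \<in> R" using z F by blast
      have *: "b - \<beta> z \<in> R" "\<beta> z - z \<in> R" using b \<beta> zR R by auto
      have "eventually (\<lambda>i. rk (x i - fst b i) < rk (x i - fst (\<beta> z) i)) U" using b z by simp
      then have "eventually (\<lambda>i. (rk \<circ> fst (b - \<beta> z)) i < (rk \<circ> fst (\<beta> z - z)) i) U"
        using \<beta>(2)[OF zR]
      proof eventually_elim
        case (elim i)
        have "fst b i - fst (\<beta> z) i = (x i - fst (\<beta> z) i) - (x i - fst b i)" by simp
        then have 1: "rk (fst b i - fst (\<beta> z) i) \<le> rk (x i - fst (\<beta> z) i)"
          using elim(1) rk_diff[of "x i - fst (\<beta> z) i" "x i - fst b i"] by simp
        have "fst (\<beta> z) i - fst z i = - (x i - fst (\<beta> z) i) + (x i - fst z i)" by simp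
        then have "rk (fst (\<beta> z) i - fst z i) = rk (x i - fst z i)"
          using elim(2) rk_add_eq[of "- (x i - fst (\<beta> z) i)" "x i - fst z i"] rk_minus by metis
        then show ?case using 1 elim by simp
      qed
      then have "eventually (\<lambda>i. (rk \<circ> snd (b - \<beta> z)) i < (rk \<circ> snd (\<beta> z - z)) i) U"
        using compat_less[OF Q QR[OF *(1)] QR[OF *(2)]] by blast
      then show ?thesis
      proof eventually_elim
        case (elim i)
        then show ?case using rk_add_eq[of "snd b i - snd (\<beta> z) i" "snd (\<beta> z) i - snd z i"] by simp
      qed
    qed
    then show "\<exists>x'. \<forall>z\<in>F. eventually (\<lambda>i. rk (x' i - snd z i) = rk (snd (\<beta> z) i - snd z i)) U" by blast
  qed
  then obtain x' where x': "\<And>z. z \<in> R \<Longrightarrow>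
      eventually (\<lambda>i. rk (x' i - snd z i) = rk (snd (\<beta> z) i - snd z i)) U" by blast
  have rep: "represented U Q (val rk ((x, x') + z))" if z: "z \<in> R" for z
  proof -
    define w where "w = - z"
    have w: "w \<in> R" "z = - w" using R(3)[OF z] by (simp_all add: w_def)
    have *: "\<beta> w - w \<in> R" using \<beta> w R by auto
    have e: "val rk ((x, x') + z) = (\<lambda>i. rk (x i - fst w i), \<lambda>i. rk (x' i - snd w i))"
      by (auto simp: val_def w fun_eq_iff)
    have 1: "eventually (\<lambda>i. rk (x i - fst w i) = (rk \<circ> fst (\<beta> w - w)) i + 0) U"
      using \<beta>(2)[OF w(1)]
    proof eventually_elim
      case (elim i)
      have "fst (\<beta> w) i - fst w i = - (x i - fst (\<beta> w) i) + (x i - fst w i)" by simp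
      then show ?case
        using elim rk_add_eq[of "- (x i - fst (\<beta> w) i)" "x i - fst w i"] rk_minus_commute[of "x i" "fst (\<beta> w) i"] by simp
    qed
    have 2: "eventually (\<lambda>i. rk (x' i - snd w i) = (rk \<circ> snd (\<beta> w - w)) i + 0) U"
      using x'[OF w(1)] by simp
    show ?thesis unfolding e represented_def using QR[OF *] 1 2 by blast
  qed
  have "compat U (Q \<union> (\<lambda>z. val rk ((x, x') + z)) ` R)"
    by (rule compat_represented[OF Q]) (use rep in \<open>auto intro: represented_member\<close>)
  then show ?thesis unfolding Q_def by blast
qed

lemma extend:
  assumes pos: "position U rk R W"
    and new: "\<And>z. z \<in> R \<Longrightarrow> \<not> eventually (\<lambda>i. x i = fst z i) U"
  shows "\<exists>x'. compat U (candidates rk R W (x, x'))"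
proof (cases "\<exists>z0\<in>R. \<forall>z\<in>R. eventually (\<lambda>i. rk (x i - fst z0 i) \<le> rk (x i - fst z i)) U")
  case True
  then show ?thesis using extend_best[OF pos new] by blast
next
  case False
  have "\<exists>w\<in>R. eventually (\<lambda>i. rk (x i - fst w i) < rk (x i - fst z i)) U" if z: "z \<in> R" for z
  proof -
    obtain w where "w \<in> R" "\<not> eventually (\<lambda>i. rk (x i - fst z i) \<le> rk (x i - fst w i)) U"
      using False z by blast
    then show ?thesis
      using ultra_not[OF U, of "\<lambda>i. rk (x i - fst z i) \<le> rk (x i - fst w i)"] by (auto simp: not_le)
  qed
  then show ?thesis using extend_no_best[OF pos] by blast
qed

text \<open>\<open>T\<close> stands for the group generated by \<open>xx\<close> in the sense of the
  case at hand: the integer multiples in exponent \<open>p\<close>, the image of the rationals in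
  the divisible case. Supplying \<open>rep\<close> is the task of each case.\<close>

lemma extend_position:
  assumes pos: "position U rk R W"
    and c: "compat U (candidates rk R W xx)"
    and T: "additive_set T" "countable T" "xx \<in> T"
    and rep: "\<And>t z. t \<in> T \<Longrightarrow> z \<in> R \<Longrightarrow>
      t + z \<in> R \<or> represented U (candidates rk R W xx) (val rk (t + z))"
  shows "\<exists>R'. R' = {t + z | t z. t \<in> T \<and> z \<in> R} \<and> R \<subseteq> R' \<and> xx \<in> R' \<and> position U rk R' W"
proof -
  define R' where "R' = {t + z | t z. t \<in> T \<and> z \<in> R}"
  have aR: "additive_set R" using pos by (simp add: position_def)
  have mem: "t + z \<in> R'" if "t \<in> T" "z \<in> R" for t z using that unfolding R'_def by blast
  have sub: "R \<subseteq> R'" using mem[OF additive_setD(1)[OF T(1)]] by (metis add_0 subsetI)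
  have "xx \<in> R'" using mem[OF T(3) additive_setD(1)[OF aR]] by simp
  have "R' = (\<Union>t\<in>T. (+) t ` R)" unfolding R'_def by blast
  then have "countable R'" using T(2) pos by (auto simp: position_def)
  have "additive_set R'"
    unfolding additive_set_def
  proof (intro conjI ballI)
    show "0 \<in> R'" using sub additive_setD(1)[OF aR] by blast
    fix a b assume "a \<in> R'" "b \<in> R'"
    then obtain t z s w where "a = t + z" "b = s + w" "t \<in> T" "z \<in> R" "s \<in> T" "w \<in> R"
      unfolding R'_def by blast
    then have "a - b = (t - s) + (z - w)" "t - s \<in> T" "z - w \<in> R"
      using additive_setD(2)[OF T(1)] additive_setD(2)[OF aR] by (auto simp: algebra_simps)
    then show "a - b \<in> R'" unfolding R'_def by blast
  qed
  moreover have "compat U (W \<union> val rk ` R')"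
  proof (rule compat_represented[OF c])
    fix q assume "q \<in> W \<union> val rk ` R'"
    then consider "q \<in> W" | t z where "q = val rk (t + z)" "t \<in> T" "z \<in> R" unfolding R'_def by blast
    then show "represented U (candidates rk R W xx) q"
    proof cases
      case 1
      then show ?thesis by (simp add: represented_member)
    next
      case (2 t z)
      show ?thesis
      proof (cases "t + z \<in> R")
        case True
        then have "q \<in> candidates rk R W xx" using 2(1) by blast
        then show ?thesis by (rule represented_member)
      next
        case False
        then show ?thesis using rep[OF 2(2,3)] 2(1) by simp
      qed
    qed
  qed
  ultimately have "position U rk R' W"
    using pos sub \<open>countable R'\<close> by (auto simp: position_def)
  then show ?thesis using sub \<open>xx \<in> R'\<close> R'_def by blast
qed

end

section \<open>The back-and-forth game\<close>

locale game = ranked_ultra rk U for rk :: "'g::ab_group_add \<Rightarrow> int" and U +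
  fixes v :: "'g \<Rightarrow> 'c::{linorder, order_top}"
    and h :: "nat \<Rightarrow> 'c"
    and admissible :: "'g elempair set \<Rightarrow> bool"
  assumes bij_h: "bij h"
    and h_le_iff: "h j \<le> h i \<longleftrightarrow> i \<le> j"
    and rk_def: "rk x = int (inv_into UNIV h (v x))"
    and admissible_constants: "admissible constants"
    and admissible_swap: "admissible R \<Longrightarrow> admissible (prod.swap ` R)"
    and admissible_extend: "position U rk R W \<Longrightarrow> admissible R \<Longrightarrow>
      (\<And>z. z \<in> R \<Longrightarrow> \<not> eventually (\<lambda>i. X i = fst z i) U) \<Longrightarrow>
      compat U (candidates rk R W (X, X')) \<Longrightarrow>
      \<exists>R'. admissible R' \<and> R \<subseteq> R' \<and> (X, X') \<in> R' \<and> position U rk R' W"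
begin

definition idx :: "'c \<Rightarrow> int" where
  "idx \<gamma> = int (inv_into UNIV h \<gamma>)"

lemma h_inv [simp]: "h (inv_into UNIV h \<gamma>) = \<gamma>" and inv_h [simp]: "inv_into UNIV h (h n) = n"
  using bij_h by (simp_all add: bij_is_surj surj_f_inv_f bij_is_inj)

lemma idx_le_iff: "idx \<gamma> \<le> idx \<delta> \<longleftrightarrow> \<delta> \<le> \<gamma>"
  using h_le_iff[of "inv_into UNIV h \<delta>" "inv_into UNIV h \<gamma>"] by (simp add: idx_def)

lemma idx_v: "idx (v x) = rk x"
  by (simp add: idx_def rk_def)

lemma idx_top: "idx top = 0"
proof -
  have "inv_into UNIV h top \<le> 0" using h_le_iff[of 0 "inv_into UNIV h top"] by simp
  then show ?thesis by (simp add: idx_def)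
qed

lemma gval_pair:
  assumes "additive_set R" "\<And>k. (E k, E' k) \<in> R"
  shows "(\<lambda>i. gval (\<lambda>k. E k i) t, \<lambda>i. gval (\<lambda>k. E' k i) t) \<in> R"
proof (induction t)
  case (GVar k)
  then show ?case using assms(2)[of k] by simp
next
  case GZero
  then show ?case using additive_setD(1)[OF assms(1)] by (simp add: zero_prod_def zero_fun_def)
next
  case (GAdd s t)
  then show ?case using additive_setD(4)[OF assms(1) GAdd.IH] by (simp add: plus_fun_def)
qed

lemma vval_pair:
  assumes R: "additive_set R" "\<And>k. (E k, E' k) \<in> R" and "\<And>k. (idx \<circ> V k, idx \<circ> V' k) \<in> W"
  shows "(\<lambda>i. idx (vval v (\<lambda>k. E k i) (\<lambda>k. V k i) t), \<lambda>i. idx (vval v (\<lambda>k. E' k i) (\<lambda>k. V' k i) t))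
    \<in> W \<union> val rk ` R"
proof (cases t)
  case (VVar k)
  then show ?thesis using assms(3)[of k] by (simp add: comp_def)
next
  case VInf
  have "val rk 0 \<in> val rk ` R" using additive_setD(1)[OF R(1)] by simp
  then show ?thesis using VInf by (simp add: val_def comp_def idx_top)
next
  case (VVal s)
  have "val rk (\<lambda>i. gval (\<lambda>k. E k i) s, \<lambda>i. gval (\<lambda>k. E' k i) s) \<in> val rk ` R"
    using gval_pair[of R E E' s] R by blast
  then show ?thesis using VVal by (simp add: val_def comp_def idx_v)
qed

lemma position_value_extend:
  assumes pos: "position U rk R W"
  obtains c' :: "nat \<Rightarrow> 'c" where "position U rk R (insert (idx \<circ> c, idx \<circ> c') W)"
proof -
  have Q: "compat U (W \<union> val rk ` R)" "countable (W \<union> val rk ` R)" "additive_set R"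
    using pos by (auto simp: position_def)
  obtain d where d: "compat U (insert (idx \<circ> c, d) (W \<union> val rk ` R))"
    using compat_insert[OF U Q(1,2)] by blast
  have 0: "(\<lambda>_. 0, \<lambda>_. 0) \<in> W \<union> val rk ` R"
    using imageI[OF additive_setD(1)[OF Q(3)], of "val rk"] by (simp add: val_def comp_def)
  \<comment> \<open>Compatibility with the zero sequence makes \<open>d\<close> non-negative almost
    everywhere, so that it consists of indices of values there and \<open>nat\<close> does not alter
    it.\<close>
  define c' where "c' i = h (nat (d i))" for i
  have "eventually (\<lambda>i. 0 \<le> (idx \<circ> c) i) U" by (simp add: idx_def)
  then have "eventually (\<lambda>i. 0 \<le> d i) U" using compat_le[OF d] 0 by blast
  then have c'd: "eventually (\<lambda>i. (idx \<circ> c') i = d i + 0) U"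
    by eventually_elim (simp add: c'_def idx_def)
  have "represented U (insert (idx \<circ> c, d) (W \<union> val rk ` R)) (idx \<circ> c, idx \<circ> c')"
    unfolding represented_def split_def fst_conv snd_conv
    by (rule bexI[of _ "(idx \<circ> c, d)"], rule exI[of _ 0]) (use c'd in auto)
  then have "compat U (insert (idx \<circ> c, idx \<circ> c') W \<union> val rk ` R)"
    by (intro compat_represented[OF d]) (auto intro: represented_member)
  then have "position U rk R (insert (idx \<circ> c, idx \<circ> c') W)"
    using pos by (simp add: position_def)
  then show thesis by (rule that)
qed

text \<open>Truth on a set of the ultrafilter stands for truth in the ultrapower, with sequences as
  values of the variables. The step for an existential quantifier chooses witnesses index by index
  and answers the resulting sequence by a one-point extension.\<close>

lemma sat_transfer:
  assumes "position U rk R W" "admissible R" "\<And>k. (E k, E' k) \<in> R" "\<And>k. (idx \<circ> V k, idx \<circ> V' k) \<in> W"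
    and "eventually (\<lambda>i. sat v (\<lambda>k. E k i) (\<lambda>k. V k i) \<phi>) U"
  shows "eventually (\<lambda>i. sat v (\<lambda>k. E' k i) (\<lambda>k. V' k i) \<phi>) U"
  using assms
proof (induction \<phi> arbitrary: R W E E' V V')
  case (GEq s t)
  have R: "additive_set R" "compat U (W \<union> val rk ` R)" using GEq.prems by (auto simp: position_def)
  \<comment> \<open>Two terms are equal when their difference has rank at most 0, which is a
    comparison with the zero sequence.\<close>
  define z where "z = (\<lambda>i. gval (\<lambda>k. E k i) s, \<lambda>i. gval (\<lambda>k. E' k i) s) -
    (\<lambda>i. gval (\<lambda>k. E k i) t, \<lambda>i. gval (\<lambda>k. E' k i) t)"
  have "z \<in> R" unfolding z_def
    using gval_pair[OF R(1) GEq.prems(3)] by (intro additive_setD(2)[OF R(1)])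
  then have zQ: "(rk \<circ> fst z, rk \<circ> snd z) \<in> W \<union> val rk ` R" by (auto simp: val_def)
  have 0: "(\<lambda>_. 0, \<lambda>_. 0) \<in> W \<union> val rk ` R"
    using imageI[OF additive_setD(1)[OF R(1)], of "val rk"] by (simp add: val_def comp_def)
  have iff: "rk x \<le> 0 \<longleftrightarrow> x = 0" for x using rk_nonneg[of x] rk_eq_0_iff[of x] by auto
  show ?case
    using compat_le[OF R(2) zQ 0] GEq.prems(5) by (simp add: z_def iff)
next
  case (VEq s t)
  have R: "additive_set R" "compat U (W \<union> val rk ` R)" using VEq.prems by (auto simp: position_def)
  have p: "(\<lambda>i. idx (vval v (\<lambda>k. E k i) (\<lambda>k. V k i) t), \<lambda>i. idx (vval v (\<lambda>k. E' k i) (\<lambda>k. V' k i) t))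
    \<in> W \<union> val rk ` R" for t
    by (rule vval_pair[OF R(1)]) (fact VEq.prems)+
  have iff: "\<gamma> = \<delta> \<longleftrightarrow> idx \<gamma> \<le> idx \<delta> \<and> idx \<delta> \<le> idx \<gamma>" for \<gamma> \<delta> by (auto simp: idx_le_iff)
  show ?case
    using compat_le[OF R(2) p[of s] p[of t]] compat_le[OF R(2) p[of t] p[of s]] VEq.prems(5)
    by (simp add: iff[of "vval _ _ _ _"] eventually_conj_iff)
next
  case (VLe s t)
  have R: "additive_set R" "compat U (W \<union> val rk ` R)" using VLe.prems by (auto simp: position_def)
  have p: "(\<lambda>i. idx (vval v (\<lambda>k. E k i) (\<lambda>k. V k i) t), \<lambda>i. idx (vval v (\<lambda>k. E' k i) (\<lambda>k. V' k i) t))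
    \<in> W \<union> val rk ` R" for t
    by (rule vval_pair[OF R(1)]) (fact VLe.prems)+
  show ?case
    using compat_le[OF R(2) p[of t] p[of s]] VLe.prems(5) by (simp add: idx_le_iff)
next
  \<comment> \<open>Negation reverses the direction of transfer; swapping the two sides of the
    position makes up for it.\<close>
  case (Neg \<phi>)
  show ?case
  proof (rule ccontr)
    assume "\<not> ?case"
    then have "eventually (\<lambda>i. sat v (\<lambda>k. E' k i) (\<lambda>k. V' k i) \<phi>) U"
      using ultra_not[OF U] by simp
    then have "eventually (\<lambda>i. sat v (\<lambda>k. E k i) (\<lambda>k. V k i) \<phi>) U"
    proof (rule Neg.IH[OF position_swap[OF Neg.prems(1)] admissible_swap[OF Neg.prems(2)], rotated 2])
      show "(E' k, E k) \<in> prod.swap ` R" for k using imageI[OF Neg.prems(3)[of k], of prod.swap] by simp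
      show "(idx \<circ> V' k, idx \<circ> V k) \<in> prod.swap ` W" for k
        using Neg.prems(4)[of k] by (metis image_eqI swap_simp)
    qed
    then show False using Neg.prems(5) ultra_not[OF U] by simp
  qed
next
  case (Conj \<phi> \<psi>)
  have c: "eventually (\<lambda>i. sat v (\<lambda>k. E k i) (\<lambda>k. V k i) \<phi>) U" "eventually (\<lambda>i. sat v (\<lambda>k. E k i) (\<lambda>k. V k i) \<psi>) U"
    using Conj.prems(5) by (simp_all add: eventually_conj_iff)
  have "eventually (\<lambda>i. sat v (\<lambda>k. E' k i) (\<lambda>k. V' k i) \<phi>) U"
    by (rule Conj.IH(1)[OF Conj.prems(1,2) _ _ c(1)]) (fact Conj.prems)+
  moreover have "eventually (\<lambda>i. sat v (\<lambda>k. E' k i) (\<lambda>k. V' k i) \<psi>) U"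
    by (rule Conj.IH(2)[OF Conj.prems(1,2) _ _ c(2)]) (fact Conj.prems)+
  ultimately show ?case by (simp add: eventually_conj_iff)
next
  case (GEx j \<phi>)
  have "\<forall>i. \<exists>x. sat v (\<lambda>k. E k i) (\<lambda>k. V k i) (GEx j \<phi>) \<longrightarrow>
      sat v ((\<lambda>k. E k i)(j := x)) (\<lambda>k. V k i) \<phi>" by auto
  from choice[OF this] obtain X where X: "\<And>i. sat v (\<lambda>k. E k i) (\<lambda>k. V k i) (GEx j \<phi>) \<Longrightarrow>
      sat v ((\<lambda>k. E k i)(j := X i)) (\<lambda>k. V k i) \<phi>" by blast
  have ev: "eventually (\<lambda>i. sat v ((\<lambda>k. E k i)(j := X i)) (\<lambda>k. V k i) \<phi>) U"
    using GEx.prems(5) by eventually_elim (rule X)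
  have upd: "(\<lambda>k. E k i)(j := X i) = (\<lambda>k. (E(j := X)) k i)" for E :: "nat \<Rightarrow> nat \<Rightarrow> 'g" and X i
    by auto
  have "\<exists>x' :: nat \<Rightarrow> 'g. eventually (\<lambda>i. sat v (\<lambda>k. (E'(j := x')) k i) (\<lambda>k. V' k i) \<phi>) U"
  proof (cases "\<exists>z\<in>R. eventually (\<lambda>i. X i = fst z i) U")
    case True
    then obtain z where z: "z \<in> R" "eventually (\<lambda>i. X i = fst z i) U" by blast
    have "eventually (\<lambda>i. sat v (\<lambda>k. (E(j := fst z)) k i) (\<lambda>k. V k i) \<phi>) U"
      using ev z(2) by eventually_elim (simp only: upd[symmetric])
    then have "eventually (\<lambda>i. sat v (\<lambda>k. (E'(j := snd z)) k i) (\<lambda>k. V' k i) \<phi>) U"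
      by (rule GEx.IH[OF GEx.prems(1,2) _ GEx.prems(4), rotated]) (use z GEx.prems(3) in auto)
    then show ?thesis by blast
  next
    case False
    then have new: "\<And>z. z \<in> R \<Longrightarrow> \<not> eventually (\<lambda>i. X i = fst z i) U" by blast
    obtain x' where "compat U (candidates rk R W (X, x'))"
      using extend[OF GEx.prems(1) new] by blast
    then obtain R' where R': "admissible R'" "R \<subseteq> R'" "(X, x') \<in> R'" "position U rk R' W"
      using admissible_extend[OF GEx.prems(1,2) new] by blast
    have "eventually (\<lambda>i. sat v (\<lambda>k. (E(j := X)) k i) (\<lambda>k. V k i) \<phi>) U"
      using ev by (simp only: upd)
    then have "eventually (\<lambda>i. sat v (\<lambda>k. (E'(j := x')) k i) (\<lambda>k. V' k i) \<phi>) U"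
      by (rule GEx.IH[OF R'(4,1) _ GEx.prems(4), rotated]) (use R' GEx.prems(3) in auto)
    then show ?thesis by blast
  qed
  then obtain x' :: "nat \<Rightarrow> 'g"
    where "eventually (\<lambda>i. sat v (\<lambda>k. (E'(j := x')) k i) (\<lambda>k. V' k i) \<phi>) U" by blast
  then show ?case by eventually_elim (simp only: upd[symmetric] sat.simps, blast)
next
  case (VEx j \<phi>)
  have "\<forall>i. \<exists>x. sat v (\<lambda>k. E k i) (\<lambda>k. V k i) (VEx j \<phi>) \<longrightarrow>
      sat v (\<lambda>k. E k i) ((\<lambda>k. V k i)(j := x)) \<phi>" by auto
  from choice[OF this] obtain X where X: "\<And>i. sat v (\<lambda>k. E k i) (\<lambda>k. V k i) (VEx j \<phi>) \<Longrightarrow>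
      sat v (\<lambda>k. E k i) ((\<lambda>k. V k i)(j := X i)) \<phi>" by blast
  have upd: "(\<lambda>k. V k i)(j := X i) = (\<lambda>k. (V(j := X)) k i)" for V :: "nat \<Rightarrow> nat \<Rightarrow> 'c" and X i
    by auto
  have ev: "eventually (\<lambda>i. sat v (\<lambda>k. E k i) (\<lambda>k. (V(j := X)) k i) \<phi>) U"
    using VEx.prems(5) by eventually_elim (simp only: upd[symmetric], rule X)
  obtain x' where x': "position U rk R (insert (idx \<circ> X, idx \<circ> x') W)"
    using position_value_extend[OF VEx.prems(1)] by blast
  have "eventually (\<lambda>i. sat v (\<lambda>k. E' k i) (\<lambda>k. (V'(j := x')) k i) \<phi>) U"
    by (rule VEx.IH[OF x' VEx.prems(2,3) _ ev]) (use VEx.prems(4) in auto)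
  then show ?case by eventually_elim (simp only: upd[symmetric] sat.simps, blast)
qed

lemma infinite_sequence:
  assumes "infinite S"
  obtains X :: "nat \<Rightarrow> 'g" where "range X \<subseteq> S" "inf_seq (rk \<circ> X)" "\<forall>g. \<not> eventually (\<lambda>i. X i = g) U"
proof -
  obtain X :: "nat \<Rightarrow> 'g" where X: "inj X" "range X \<subseteq> S" using infinite_countable_subset[OF assms] by blast
  have no: "\<not> eventually (\<lambda>i. X i = g) U" for g
  proof
    assume g: "eventually (\<lambda>i. X i = g) U"
    obtain n where n: "\<And>i. X i = g \<Longrightarrow> i < n"
      by (metis X(1) injD lessI)
    have "eventually (\<lambda>i. False) U"
      using g ultra_ge[OF U, of n] by eventually_elim (use n in force)
    then show False using U by (simp add: ultra_def trivial_limit_def)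
  qed
  show thesis by (rule that[OF X(2) not_constant_inf_seq[OF no]]) (use no in blast)
qed

text \<open>Take \<open>X\<close> inside and \<open>Y\<close> outside the set, both of infinite
  rank. Adding a constant does not change an infinite rank, so matching \<open>X\<close> with
  \<open>Y\<close> over the identity on constants only requires that both ranks exceed all integers.
  Transfer then contradicts the choice of \<open>Y\<close>.\<close>

theorem definable_finite_or_cofinite:
  assumes "definable_set v S"
  shows "finite S \<or> finite (- S)"
proof (rule ccontr)
  assume "\<not> ?thesis"
  then have "infinite S" "infinite (- S)" by auto
  obtain \<phi> e w where S: "S = {x. sat v (e(0 := x)) w \<phi>}" using assms by (auto simp: definable_set_def)
  obtain X where X: "range X \<subseteq> S" "inf_seq (rk \<circ> X)" "\<forall>g. \<not> eventually (\<lambda>i. X i = g) U"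
    by (rule infinite_sequence[OF \<open>infinite S\<close>])
  obtain Y where Y: "range Y \<subseteq> - S" "inf_seq (rk \<circ> Y)"
    by (rule infinite_sequence[OF \<open>infinite (- S)\<close>])
  \<comment> \<open>All constant ranks, each paired with itself, so that the parameters of the value
    sort are kept fixed.\<close>
  define W where "W = range (\<lambda>n :: int. (\<lambda>_ :: nat. n, \<lambda>_ :: nat. n))"
  have valc: "val rk ` constants \<subseteq> W" by (auto simp: val_def constants_def W_def comp_def)
  have same: "q \<in> W \<Longrightarrow> \<exists>n. q = (\<lambda>_. n, \<lambda>_. n)" for q by (auto simp: W_def)
  have "additive_set (constants :: 'g elempair set)"
    unfolding additive_set_def
  proof (intro conjI ballI)
    have mem: "(\<lambda>_. g, \<lambda>_. g) \<in> constants" for g :: 'g by (auto simp: constants_def)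
    show "0 \<in> (constants :: 'g elempair set)"
      using mem[of 0] by (simp add: zero_prod_def zero_fun_def)
    fix z w :: "'g elempair" assume "z \<in> constants" "w \<in> constants"
    then obtain a b where "z = (\<lambda>_. a, \<lambda>_. a)" "w = (\<lambda>_. b, \<lambda>_. b)" by (auto simp: constants_def)
    then show "z - w \<in> constants" using mem[of "a - b"] by (simp add: fun_diff_def)
  qed
  moreover have "countable (constants :: 'g elempair set)"
    unfolding constants_def by (rule countable_image[OF countable_group])
  moreover have "compat U W" unfolding compat_def W_def by auto
  ultimately have pos: "position U rk constants W"
    using valc by (simp add: position_def Un_absorb2 W_def)
  have new: "\<not> eventually (\<lambda>i. X i = fst z i) U" if "z \<in> constants" for z
    using that X(3) by (auto simp: constants_def)
  define Q where "Q = insert (rk \<circ> X, rk \<circ> Y) W"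
  have XY: "eventually (\<lambda>i. n < (rk \<circ> X) i) U" "eventually (\<lambda>i. n < (rk \<circ> Y) i) U" for n
    using X(2) Y(2) by (simp_all add: inf_seq_def)
  have "compat U Q"
    unfolding compat_def
  proof (intro ballI, clarify)
    fix c c' d d' k
    have gt: "eventually (\<lambda>i. n \<le> rk (Z i) + k) U" "\<not> eventually (\<lambda>i. rk (Z i) \<le> n + k) U"
      if "inf_seq (rk \<circ> Z)" for n k and Z :: "nat \<Rightarrow> 'g"
    proof -
      have 1: "eventually (\<lambda>i. n - k < (rk \<circ> Z) i) U" "eventually (\<lambda>i. n + k < (rk \<circ> Z) i) U"
        using that by (simp_all add: inf_seq_def)
      show "eventually (\<lambda>i. n \<le> rk (Z i) + k) U" using 1(1) by eventually_elim simp
      have "eventually (\<lambda>i. \<not> rk (Z i) \<le> n + k) U" using 1(2) by eventually_elim simp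
      then show "\<not> eventually (\<lambda>i. rk (Z i) \<le> n + k) U" using ultra_not[OF U] by blast
    qed
    have mem: "q = (rk \<circ> X, rk \<circ> Y) \<or> (\<exists>n. q = (\<lambda>_. n, \<lambda>_. n))" if "q \<in> Q" for q
      using that same unfolding Q_def by blast
    assume *: "(c, c') \<in> Q" "(d, d') \<in> Q"
    show "eventually (\<lambda>i. c i \<le> d i + k) U \<longleftrightarrow> eventually (\<lambda>i. c' i \<le> d' i + k) U"
      using mem[OF *(1)] mem[OF *(2)]
    proof (elim disjE exE)
      fix n assume "(c, c') = (rk \<circ> X, rk \<circ> Y)" "(d, d') = (\<lambda>_. n, \<lambda>_. n)"
      then show ?thesis using gt(2)[OF X(2)] gt(2)[OF Y(2)] by simp
    next
      fix n assume "(c, c') = (\<lambda>_. n, \<lambda>_. n)" "(d, d') = (rk \<circ> X, rk \<circ> Y)"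
      then show ?thesis using gt(1)[OF X(2)] gt(1)[OF Y(2)] by simp
    qed auto
  qed
  moreover have "represented U Q q"
    if "q \<in> W \<union> val rk ` constants \<union> (\<lambda>z. val rk ((X, Y) + z)) ` constants" for q
  proof (cases "q \<in> W")
    case True
    then show ?thesis by (simp add: Q_def represented_member)
  next
    case False
    have "q \<in> W \<union> (\<lambda>z. val rk ((X, Y) + z)) ` constants"
      using that unfolding Un_absorb2[OF valc] .
    then have "q \<in> (\<lambda>z. val rk ((X, Y) + z)) ` constants"
      by (rule UnE) (use False in \<open>simp_all only: not_False_eq_True simp_thms\<close>)
    then obtain z where z: "q = val rk ((X, Y) + z)" "z \<in> constants" by (rule imageE)
    obtain g where "z = (\<lambda>_. g, \<lambda>_. g)" using z(2) by (auto simp: constants_def)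
    then have q: "q = (\<lambda>i. rk (X i + g), \<lambda>i. rk (Y i + g))"
      using z(1) by (simp add: val_def comp_def)
    have 1: "eventually (\<lambda>i. rk (X i + g) = (rk \<circ> X) i + 0) U"
      using XY(1)[of "rk g"] by eventually_elim (simp add: rk_add_eq add.commute[of _ g])
    have 2: "eventually (\<lambda>i. rk (Y i + g) = (rk \<circ> Y) i + 0) U"
      using XY(2)[of "rk g"] by eventually_elim (simp add: rk_add_eq add.commute[of _ g])
    show ?thesis unfolding q represented_def Q_def using 1 2 by blast
  qed
  ultimately have "compat U (W \<union> val rk ` constants \<union> (\<lambda>z. val rk ((X, Y) + z)) ` constants)"
    by (rule compat_represented)
  then obtain R where R: "admissible R" "constants \<subseteq> R" "(X, Y) \<in> R" "position U rk R W"
    using admissible_extend[OF pos admissible_constants new] by blast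
  define E where "E Z k = (if k = 0 then Z else (\<lambda>_. e k))" for Z :: "nat \<Rightarrow> 'g" and k :: nat
  have E: "(\<lambda>k. E Z k i) = e(0 := Z i)" for Z i by (auto simp: E_def)
  have "eventually (\<lambda>i. sat v (\<lambda>k. E Y k i) (\<lambda>k. (\<lambda>k _. w k) k i) \<phi>) U"
  proof (rule sat_transfer[OF R(4,1)])
    show "(E X k, E Y k) \<in> R" for k using R by (auto simp: E_def constants_def)
    show "(idx \<circ> (\<lambda>_. w k), idx \<circ> (\<lambda>_. w k)) \<in> W" for k by (auto simp: W_def comp_def)
    show "eventually (\<lambda>i. sat v (\<lambda>k. E X k i) (\<lambda>k. w k) \<phi>) U"
      using X(1) S by (auto simp: E image_subset_iff)
  qed
  moreover have "\<not> sat v (e(0 := Y i)) w \<phi>" for i using Y(1) S by auto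
  ultimately have "eventually (\<lambda>i. False) U" by (simp add: E)
  then show False using U by (simp add: ultra_def trivial_limit_def)
qed

end

section \<open>Primary groups\<close>

lemma additive_set_kernel: "additive_set {x. nmult n x = 0}"
  by (simp add: additive_set_def nmult_minus)

lemma coprime_multiple_inverse:
  assumes "nmult n x = 0" "coprime m n"
  obtains u where "nmult u (nmult m x) = x"
proof (cases "m = 0")
  case True
  then have "n = 1" using assms(2) by simp
  then show thesis using assms(1) that[of 0] by simp
next
  case False
  obtain u y where uy: "m * u = n * y + gcd m n" using bezout_nat[OF False] by blast
  have "nmult (u * m) x = nmult (y * n + 1) x" using uy assms(2) by (simp add: mult.commute)
  also have "\<dots> = x" using assms(1) by (simp only: nmult_add nmult_mult nmult_zero) simp
  finally show thesis using that by (simp add: nmult_mult)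
qed

definition primary :: "nat \<Rightarrow> 'g::ab_group_add set \<Rightarrow> bool" where
  "primary p H \<longleftrightarrow> (\<forall>x\<in>H. \<exists>k. nmult (p ^ k) x = 0)"

lemma coprime_multiple_mem:
  assumes "additive_set H" "nmult m x \<in> H" "nmult n x \<in> H" "coprime m n" "m \<noteq> 0"
  shows "x \<in> H"
proof -
  obtain u y where uy: "m * u = n * y + gcd m n" using bezout_nat[OF assms(5)] by blast
  then have "u * m = y * n + 1" using assms(4) by (simp add: mult.commute)
  then have "nmult u (nmult m x) = nmult y (nmult n x) + x"
    by (metis nmult_1(1) nmult_add nmult_mult)
  then have "x = nmult u (nmult m x) - nmult y (nmult n x)" by simp
  then show ?thesis using additive_setD[OF assms(1)] assms(2,3) by metis
qed

lemma card_image_times_kernel: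
  assumes H: "additive_set H" "finite H" and f: "\<And>x y. f (x - y) = (f x :: 'b::ab_group_add) - f y"
  shows "card H = card (f ` H) * card {x \<in> H. f x = 0}"
proof -
  let ?K = "{x \<in> H. f x = 0}"
  have fib: "card {x \<in> H. f x = b} = card ?K" if b: "b \<in> f ` H" for b
  proof -
    obtain a where a: "a \<in> H" "b = f a" using b by blast
    have "bij_betw (\<lambda>x. x - a) {x \<in> H. f x = b} ?K"
    proof (rule bij_betwI[of _ _ _ "\<lambda>x. x + a"])
      have "f (x + a) = f x + f a" for x using f[of "x + a" a] by simp
      then show "(\<lambda>x. x + a) \<in> ?K \<rightarrow> {x \<in> H. f x = b}"
        using a additive_setD[OF H(1)] by auto
      show "(\<lambda>x. x - a) \<in> {x \<in> H. f x = b} \<rightarrow> ?K" using a additive_setD[OF H(1)] f by auto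
    qed auto
    then show ?thesis by (rule bij_betw_same_card)
  qed
  have "H = (\<Union>b\<in>f ` H. {x \<in> H. f x = b})" by auto
  then have "card H = card (\<Union>b\<in>f ` H. {x \<in> H. f x = b})" by simp
  also have "\<dots> = (\<Sum>b\<in>f ` H. card {x \<in> H. f x = b})"
    using H(2) by (intro card_UN_disjoint) auto
  also have "\<dots> = card (f ` H) * card ?K" by (simp add: fib)
  finally show ?thesis .
qed

text \<open>A subgroup \<open>K\<close> other than \<open>H\<close> grows inside \<open>H\<close> by
  the factor \<open>p\<close>. For y outside \<open>K\<close> the sequence y, p y, p^2 y, ...
  reaches 0 and so enters \<open>K\<close>; the last member x before the first entry has p x in
  \<open>K\<close>, and 0, x, ..., (p - 1) x represent the cosets of \<open>K\<close> in the
  enlarged subgroup.\<close>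

lemma card_primary:
  fixes H :: "'g::ab_group_add set"
  assumes p: "prime p" and H: "additive_set H" "finite H" "primary p H"
  obtains k where "card H = p ^ k"
proof -
  have grow: "\<exists>L. L \<subseteq> H \<and> additive_set L \<and> card L = p * card K \<and> K \<subseteq> L"
    if K: "K \<subset> H" "additive_set K" for K
  proof -
    obtain y where y: "y \<in> H" "y \<notin> K" using K(1) by blast
    obtain j where j: "nmult (p ^ j) y = 0" using H(3) y(1) by (auto simp: primary_def)
    define i where "i = (LEAST i. nmult (p ^ i) y \<in> K)"
    have ex: "nmult (p ^ j) y \<in> K" using j additive_setD(1)[OF K(2)] by simp
    have i: "nmult (p ^ i) y \<in> K" unfolding i_def
      using LeastI[of "\<lambda>i. nmult (p ^ i) y \<in> K" j] ex by blast
    have "i \<noteq> 0" using i y(2) by (metis nmult_1(1) power_0)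
    then obtain i' where i': "i = Suc i'" using not0_implies_Suc by blast
    define x where "x = nmult (p ^ i') y"
    have x: "x \<in> H" "x \<notin> K" "nmult p x \<in> K"
    proof -
      show "x \<in> H" unfolding x_def using additive_setD(5)[OF H(1) y(1)] .
      have "i' < (LEAST i. nmult (p ^ i) y \<in> K)" using i' by (simp add: i_def[symmetric])
      then show "x \<notin> K" unfolding x_def by (rule not_less_Least)
      show "nmult p x \<in> K" using i by (simp add: x_def i' nmult_mult[symmetric])
    qed
    define f where "f = (\<lambda>(a :: nat, z). nmult a x + z)"
    define L where "L = f ` ({..<p} \<times> K)"
    note HD = additive_setD[OF H(1)] and KD = additive_setD[OF K(2)]
    have key: "a = b" if "nmult a x - nmult b x \<in> K" "a < p" "b < p" for a b
    proof (rule ccontr)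
      have *: False if "nmult c x \<in> K" "0 < c" "c < p" for c
      proof -
        have "coprime c p" using p that(2,3)
          by (metis coprime_commute nat_dvd_not_less prime_imp_coprime_nat)
        then show False using coprime_multiple_mem[OF K(2) that(1) x(3)] that(2) x(2) by simp
      qed
      assume "a \<noteq> b"
      then consider "b < a" | "a < b" by linarith
      then show False
      proof cases
        case 1
        then have "nmult (a - b) x = nmult a x - nmult b x" using nmult_add[of "a - b" b x] by simp
        then show False using *[of "a - b"] 1 that less_imp_diff_less[of a p b] by simp
      next
        case 2
        then have "nmult (b - a) x = - (nmult a x - nmult b x)" using nmult_add[of "b - a" a x] by simp
        then show False using *[of "b - a"] 2 that KD(3)[OF that(1)] less_imp_diff_less[of b p a] by simp
      qed
    qed
    have "inj_on f ({..<p} \<times> K)"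
    proof (rule inj_onI, clarify)
      fix a z b w assume *: "a < p" "b < p" "z \<in> K" "w \<in> K" "f (a, z) = f (b, w)"
      then have "nmult a x - nmult b x = w - z" by (simp add: f_def algebra_simps)
      then have "nmult a x - nmult b x \<in> K" using KD(2)[of w z] * by simp
      then have "a = b" using key * by blast
      then show "a = b \<and> z = w" using * by (simp add: f_def)
    qed
    then have cL: "card L = p * card K" by (simp add: L_def card_image card_cartesian_product)
    have "p > 0" using p prime_gt_0_nat by blast
    have Lmem: "nmult a x + z \<in> L" if "z \<in> K" for a z
    proof -
      have "a = a div p * p + a mod p" by simp
      then have "nmult a x = nmult (a div p) (nmult p x) + nmult (a mod p) x"
        by (metis nmult_add nmult_mult)
      then have "nmult a x + z = f (a mod p, nmult (a div p) (nmult p x) + z)"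
        by (simp add: f_def algebra_simps)
      moreover have "nmult (a div p) (nmult p x) + z \<in> K" using KD(4) KD(5)[OF x(3)] that by blast
      ultimately show ?thesis unfolding L_def using \<open>p > 0\<close> by (intro image_eqI) auto
    qed
    have "additive_set L"
      unfolding additive_set_def
    proof (intro conjI ballI)
      show "0 \<in> L" using Lmem[of 0 0] KD(1) by simp
      fix s t assume "s \<in> L" "t \<in> L"
      then obtain a z b w where *: "s = nmult a x + z" "t = nmult b x + w" "z \<in> K" "w \<in> K" "b < p"
        unfolding L_def f_def by auto
      \<comment> \<open>Coefficients are naturals, so - b is replaced by p - b, and the excess p x
        is absorbed by \<open>K\<close>.\<close>
      have "nmult (p - b) x = nmult p x - nmult b x" using nmult_add[of "p - b" b x] *(5) by simp
      then have "s - t = nmult (a + (p - b)) x + (z - w - nmult p x)"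
        by (simp add: * nmult_add algebra_simps)
      moreover have "z - w - nmult p x \<in> K" using * x(3) KD(2) by blast
      ultimately show "s - t \<in> L" using Lmem by metis
    qed
    moreover have "K \<subseteq> L" using Lmem[of _ 0] by auto
    moreover have "L \<subseteq> H" unfolding L_def f_def using x(1) HD(4,5) K(1) by auto
    ultimately show ?thesis using cL by blast
  qed
  have main: "\<exists>k. card H = p ^ k" if "K \<subseteq> H" "additive_set K" "card K = p ^ k" for K k
    using that
  proof (induction "card H - card K" arbitrary: K k rule: less_induct)
    case less
    show ?case
    proof (cases "K = H")
      case True
      then show ?thesis using less.prems by blast
    next
      case False
      then obtain L where L: "L \<subseteq> H" "additive_set L" "card L = p * card K" "K \<subseteq> L"
        using grow[of K] less.prems by blast
      have "card K < card H" using False less.prems(1) H(2) by (intro psubset_card_mono psubsetI)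
      moreover have "card K < card L" using L(3) less.prems(3) prime_gt_1_nat[OF p] by simp
      ultimately have "card H - card L < card H - card K" by linarith
      then show ?thesis using less.hyps[of L "Suc k"] L less.prems(3) by simp
    qed
  qed
  have "{0} \<subseteq> H" using additive_setD(1)[OF H(1)] by simp
  moreover have "additive_set {0 :: 'g}" by (simp add: additive_set_def)
  moreover have "card {0 :: 'g} = p ^ 0" by simp
  ultimately show thesis using main that by blast
qed

section \<open>Layers of a valued group\<close>

abbreviation (input) layer :: "('g::ab_group_add \<Rightarrow> 'c::{linorder, order_top}) \<Rightarrow> nat \<Rightarrow> nat \<Rightarrow> 'c \<Rightarrow> bool" where
  "layer v p n \<gamma> \<equiv> Rrel v (p ^ n) \<gamma> \<and> \<not> Rrel v (p ^ (n + 1)) \<gamma>"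

context valued_abelian_group
begin

lemma v_0: "v 0 = top"
  by (simp add: v_eq_top_iff)

lemma v_minus [simp]: "v (- x) = v x"
proof -
  have "v x \<le> v (- x)" for x using v_diff[of 0 x] by (simp add: v_0 min_absorb2)
  from this[of x] this[of "- x"] show ?thesis by simp
qed

lemma v_minus_commute: "v (x - y) = v (y - x)"
  by (metis minus_diff_eq v_minus)

lemma v_add: "v (x + y) \<ge> min (v x) (v y)"
  using v_diff[of x "- y"] by simp

lemma v_less_add: "\<gamma> < v x \<Longrightarrow> \<gamma> < v y \<Longrightarrow> \<gamma> < v (x + y)"
  using v_add[of x y] by (auto simp: min_def split: if_splits)

lemma v_less_diff: "\<gamma> < v x \<Longrightarrow> \<gamma> < v y \<Longrightarrow> \<gamma> < v (x - y)"
  using v_less_add[of \<gamma> x "- y"] by simp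

lemma additive_set_Bcl: "additive_set (Bcl v \<gamma>)"
  unfolding additive_set_def Bcl_def
proof (intro conjI ballI CollectI)
  show "\<gamma> \<le> v 0" by (simp add: v_0)
  fix x y assume "x \<in> {x. \<gamma> \<le> v x}" "y \<in> {x. \<gamma> \<le> v x}"
  then have "\<gamma> \<le> min (v x) (v y)" by simp
  then show "\<gamma> \<le> v (x - y)" using v_diff order_trans by blast
qed

lemma additive_set_Bop: "\<gamma> \<noteq> top \<Longrightarrow> additive_set (Bop v \<gamma>)"
  unfolding additive_set_def Bop_def using v_less_diff by (auto simp: v_0 top.not_eq_extremum)

lemma coset_eq_iff:
  assumes "\<gamma> \<noteq> top"
  shows "(+) x ` Bop v \<gamma> = (+) y ` Bop v \<gamma> \<longleftrightarrow> \<gamma> < v (x - y)"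
proof
  assume "(+) x ` Bop v \<gamma> = (+) y ` Bop v \<gamma>"
  moreover have "x + 0 \<in> (+) x ` Bop v \<gamma>"
    using additive_setD(1)[OF additive_set_Bop[OF assms]] by blast
  ultimately obtain b where "x = y + b" "b \<in> Bop v \<gamma>" by auto
  then show "\<gamma> < v (x - y)" by (simp add: Bop_def)
next
  have sub: "(+) x ` Bop v \<gamma> \<subseteq> (+) y ` Bop v \<gamma>" if "\<gamma> < v (x - y)" for x y
  proof
    fix z assume "z \<in> (+) x ` Bop v \<gamma>"
    then obtain b where b: "z = x + b" "\<gamma> < v b" by (auto simp: Bop_def)
    then have "z = y + ((x - y) + b)" "(x - y) + b \<in> Bop v \<gamma>"
      using v_less_add[OF that b(2)] by (simp_all add: Bop_def)
    then show "z \<in> (+) y ` Bop v \<gamma>" by blast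
  qed
  assume "\<gamma> < v (x - y)"
  then show "(+) x ` Bop v \<gamma> = (+) y ` Bop v \<gamma>" using sub[of x y] sub[of y x] v_minus_commute[of x y] by auto
qed

text \<open>Counting cosets by representatives removes the quotient and the convention on infinite
  cardinalities; in this form \<open>Rrel\<close> can be compared with \<open>wide\<close> and be
  expressed by a formula.\<close>

lemma Rrel_iff:
  "Rrel v m \<gamma> \<longleftrightarrow> \<gamma> \<noteq> top \<and> (\<exists>S. finite S \<and> card S = Suc m \<and> (\<forall>x\<in>S. \<gamma> \<le> v x) \<and>
     (\<forall>x\<in>S. \<forall>y\<in>S. x \<noteq> y \<longrightarrow> v (x - y) \<le> \<gamma>))"
proof (cases "\<gamma> = top")
  case False
  let ?c = "\<lambda>x. (+) x ` Bop v \<gamma>"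
  have ne: "?c x \<noteq> ?c y \<longleftrightarrow> v (x - y) \<le> \<gamma>" for x y
    using coset_eq_iff[OF False] by (simp add: not_less)
  have "(infinite (ball_quotient v \<gamma>) \<or> m < card (ball_quotient v \<gamma>)) \<longleftrightarrow>
    (\<exists>S. finite S \<and> card S = Suc m \<and> (\<forall>x\<in>S. \<gamma> \<le> v x) \<and> (\<forall>x\<in>S. \<forall>y\<in>S. x \<noteq> y \<longrightarrow> v (x - y) \<le> \<gamma>))"
    (is "?L \<longleftrightarrow> ?R")
  proof
    assume ?L
    then have "\<exists>T. finite T \<and> card T = Suc m \<and> T \<subseteq> ball_quotient v \<gamma>"
    proof
      assume "m < card (ball_quotient v \<gamma>)"
      then show ?thesis using obtain_subset_with_card_n[of "Suc m" "ball_quotient v \<gamma>"] by auto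
    qed (rule infinite_arbitrarily_large)
    then obtain T where T: "T \<subseteq> ball_quotient v \<gamma>" "finite T" "card T = Suc m" by blast
    then have "T \<subseteq> ?c ` Bcl v \<gamma>" by (simp add: ball_quotient_def)
    then have "\<exists>S\<subseteq>Bcl v \<gamma>. inj_on ?c S \<and> T = ?c ` S" by (simp only: subset_image_inj)
    then obtain S where S: "S \<subseteq> Bcl v \<gamma>" "inj_on ?c S" "T = ?c ` S" by (elim exE conjE)
    have "finite S" using T(2) unfolding S(3) by (rule finite_imageD[OF _ S(2)])
    moreover have "card S = Suc m" using T(3) card_image[OF S(2)] by (simp only: S(3))
    moreover have "v (x - y) \<le> \<gamma>" if "x \<in> S" "y \<in> S" "x \<noteq> y" for x y
      using ne[of x y] inj_onD[OF S(2) _ that(1,2)] that(3) by blast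
    moreover have "\<forall>x\<in>S. \<gamma> \<le> v x" using S(1) by (auto simp: Bcl_def)
    ultimately show ?R by blast
  next
    assume ?R
    then obtain S where S: "finite S" "card S = Suc m" "\<And>x. x \<in> S \<Longrightarrow> \<gamma> \<le> v x"
      "\<And>x y. x \<in> S \<Longrightarrow> y \<in> S \<Longrightarrow> x \<noteq> y \<Longrightarrow> v (x - y) \<le> \<gamma>" by blast
    have "inj_on ?c S" by (rule inj_onI, rule ccontr) (use S(4) ne in metis)
    then have "card (?c ` S) = Suc m" using S by (simp add: card_image)
    moreover have "?c ` S \<subseteq> ball_quotient v \<gamma>" using S(3) by (auto simp: ball_quotient_def Bcl_def)
    ultimately show ?L using card_mono[of "ball_quotient v \<gamma>" "?c ` S"] by (cases "finite (ball_quotient v \<gamma>)") auto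
  qed
  then show ?thesis using False by (simp add: Rrel_def)
qed (simp add: Rrel_def)

lemma Rrel_mono: "Rrel v m \<gamma> \<Longrightarrow> k \<le> m \<Longrightarrow> Rrel v k \<gamma>"
  by (auto simp: Rrel_def)

lemma Rrel_1: "\<gamma> \<noteq> top \<Longrightarrow> Rrel v 1 \<gamma>"
proof -
  assume \<gamma>: "\<gamma> \<noteq> top"
  obtain x where x: "v x = \<gamma>" using v_surj by (metis surjD)
  then have "x \<noteq> 0" using \<gamma> v_0 by auto
  then show ?thesis unfolding Rrel_iff
    using x \<gamma> by (intro conjI exI[of _ "{0, x}"]) (auto simp: v_0)
qed

lemma card_ball_quotient:
  assumes "\<gamma> \<noteq> top" "finite (Bcl v \<gamma>)"
  shows "card (Bcl v \<gamma>) = card (ball_quotient v \<gamma>) * card (Bop v \<gamma>)"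
proof -
  have sub: "Bop v \<gamma> \<subseteq> Bcl v \<gamma>" by (auto simp: Bop_def Bcl_def)
  have U: "\<Union> (ball_quotient v \<gamma>) = Bcl v \<gamma>"
  proof
    show "\<Union> (ball_quotient v \<gamma>) \<subseteq> Bcl v \<gamma>"
      unfolding ball_quotient_def using additive_setD(4)[OF additive_set_Bcl] sub by auto
    show "Bcl v \<gamma> \<subseteq> \<Union> (ball_quotient v \<gamma>)"
    proof
      fix x assume x: "x \<in> Bcl v \<gamma>"
      have "x + 0 \<in> (+) x ` Bop v \<gamma>" using additive_setD(1)[OF additive_set_Bop[OF assms(1)]] by blast
      then show "x \<in> \<Union> (ball_quotient v \<gamma>)" using x by (auto simp: ball_quotient_def)
    qed
  qed
  have "card (Bop v \<gamma>) * card (ball_quotient v \<gamma>) = card (\<Union> (ball_quotient v \<gamma>))"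
  proof (rule card_partition)
    show "finite (ball_quotient v \<gamma>)" using assms(2) by (simp add: ball_quotient_def)
    show "finite (\<Union> (ball_quotient v \<gamma>))" using U assms(2) by simp
    show "card c = card (Bop v \<gamma>)" if "c \<in> ball_quotient v \<gamma>" for c
      using that by (auto simp: ball_quotient_def card_image)
    fix c d assume "c \<in> ball_quotient v \<gamma>" "d \<in> ball_quotient v \<gamma>" and ne: "c \<noteq> d"
    then obtain x y where c: "c = (+) x ` Bop v \<gamma>" "d = (+) y ` Bop v \<gamma>" by (auto simp: ball_quotient_def)
    show "c \<inter> d = {}"
    proof (rule ccontr)
      assume "c \<inter> d \<noteq> {}"
      then obtain a b where "x + a = y + b" "\<gamma> < v a" "\<gamma> < v b" by (auto simp: c Bop_def)
      then have "\<gamma> < v (b - a)" "x - y = b - a" using v_less_diff by (auto simp: algebra_simps)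
      then show False using coset_eq_iff[OF assms(1), of x y] ne c by simp
    qed
  qed
  then show ?thesis by (simp add: U mult.commute)
qed

end

section \<open>Valued groups with finite fibres over a value set of order type omega*\<close>

locale omega_valued = valued_abelian_group v
  for v :: "'g::ab_group_add \<Rightarrow> 'c::{linorder, order_top}" +
  fixes h :: "nat \<Rightarrow> 'c"
  assumes bij_h: "bij h"
    and h_le_iff: "h j \<le> h i \<longleftrightarrow> i \<le> j"
    and finite_fibre: "finite {x. v x = \<gamma>}"
begin

definition rk :: "'g \<Rightarrow> int" where
  "rk x = int (inv_into UNIV h (v x))"

lemma h_inv [simp]: "h (inv_into UNIV h \<gamma>) = \<gamma>" and inv_h [simp]: "inv_into UNIV h (h n) = n"
  using bij_h by (simp_all add: bij_is_surj surj_f_inv_f bij_is_inj)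

lemma h_less_iff: "h j < h i \<longleftrightarrow> i < j"
  using h_le_iff[of i j] by (simp add: not_le[symmetric])

lemma h_eq_iff: "h j = h i \<longleftrightarrow> j = i"
  using bij_h by (simp add: bij_is_inj inj_eq)

lemma h_0: "h 0 = top"
proof -
  have "top = h (inv_into UNIV h top)" by simp
  also have "\<dots> \<le> h 0" using h_le_iff[of "inv_into UNIV h top" 0] by simp
  finally show ?thesis using top.extremum_unique by metis
qed

lemma h_eq_top_iff: "h n = top \<longleftrightarrow> n = 0"
  using h_eq_iff[of n 0] by (simp add: h_0)

lemma v_eq_h_iff: "v x = h n \<longleftrightarrow> rk x = int n"
  unfolding rk_def by (metis h_inv inv_h of_nat_eq_iff)

lemma v_eq: "v x = h (nat (rk x))"
  by (simp add: rk_def)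

lemma v_le_h_iff: "v x \<le> h n \<longleftrightarrow> int n \<le> rk x"
  using h_le_iff[of "inv_into UNIV h (v x)" n] by (simp add: rk_def)

lemma h_le_v_iff: "h n \<le> v x \<longleftrightarrow> rk x \<le> int n"
  using h_le_iff[of n "inv_into UNIV h (v x)"] by (simp add: rk_def)

lemma ex_rk: "\<exists>x. rk x = int n"
  using v_surj by (metis surjD v_eq_h_iff)

lemma ex_h: "\<exists>n. \<gamma> = h n"
  by (metis h_inv)

sublocale ranked_group rk
proof
  show "0 \<le> rk x" for x by (simp add: rk_def)
  show "rk x = 0 \<longleftrightarrow> x = 0" for x using v_eq_h_iff[of x 0] by (simp add: h_0 v_eq_top_iff)
  fix x y
  define m where "m = max (rk x) (rk y)"
  have m: "int (nat m) = m" by (simp add: m_def rk_def)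
  have "h (nat m) \<le> v x" "h (nat m) \<le> v y" unfolding h_le_v_iff m by (simp_all add: m_def)
  then have "h (nat m) \<le> min (v x) (v y)" by simp
  then have "h (nat m) \<le> v (x - y)" using v_diff order_trans by blast
  then show "rk (x - y) \<le> max (rk x) (rk y)" unfolding h_le_v_iff m by (simp only: m_def)
next
  fix n
  have "{x. rk x \<le> n} \<subseteq> (\<Union>m\<in>{..nat n}. {x. v x = h m})"
    by (auto simp: v_eq_h_iff rk_def intro!: bexI[of _ "inv_into UNIV h (v _)"])
  then show "finite {x. rk x \<le> n}" using finite_fibre by (meson finite_UN_I finite_atMost finite_subset)
qed

lemma infinite_UNIV: "infinite (UNIV :: 'g set)"
proof
  assume "finite (UNIV :: 'g set)"
  then have "finite (rk ` UNIV)" by simp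
  moreover have "range int \<subseteq> rk ` UNIV" using ex_rk by (auto simp: image_iff eq_commute)
  ultimately have "finite (range int)" by (rule finite_subset[rotated])
  then show False using range_inj_infinite[OF inj_of_nat[where 'a = int]] by (rule notE[rotated])
qed

lemma finite_values_iff: "finite {\<gamma>. P \<gamma>} \<longleftrightarrow> (\<exists>N. \<forall>n\<ge>N. \<not> P (h n))"
proof -
  have "{\<gamma>. P \<gamma>} = h ` {n. P (h n)}"
  proof
    show "{\<gamma>. P \<gamma>} \<subseteq> h ` {n. P (h n)}"
    proof
      fix \<gamma> assume "\<gamma> \<in> {\<gamma>. P \<gamma>}"
      moreover obtain n where "\<gamma> = h n" using ex_h by blast
      ultimately show "\<gamma> \<in> h ` {n. P (h n)}" by simp
    qed
  qed auto
  moreover have "inj_on h {n. P (h n)}" using bij_is_inj[OF bij_h] by (rule inj_on_subset) simp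
  ultimately have "finite {\<gamma>. P \<gamma>} \<longleftrightarrow> finite {n. P (h n)}" by (simp only: finite_image_iff)
  also have "\<dots> \<longleftrightarrow> (\<exists>N. \<forall>n\<ge>N. \<not> P (h n))"
    unfolding finite_nat_set_iff_bounded by (auto simp: not_le[symmetric])
  finally show ?thesis .
qed

text \<open>More than \<open>m\<close> cosets are at least \<open>Suc m\<close> ones. Index 0 is
  that of \<open>top\<close>, where \<open>Rrel\<close> is false by convention.\<close>

lemma Rrel_wide: "Rrel v m (h n) \<longleftrightarrow> n \<noteq> 0 \<and> wide rk (Suc m) (int n)"
  unfolding Rrel_iff wide_def separated_def h_le_v_iff v_le_h_iff h_eq_top_iff by blast

lemma finite_Bcl: "finite (Bcl v (h n))"
  unfolding Bcl_def h_le_v_iff by (rule finite_rk)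

lemma wide_eventuallyI:
  assumes "\<And>m. (\<exists>N. \<forall>n\<ge>N. Rrel v m (h n)) \<or> (\<exists>N. \<forall>n\<ge>N. \<not> Rrel v m (h n))"
  shows "\<exists>N. (\<forall>n\<ge>N. wide rk m n) \<or> (\<forall>n\<ge>N. \<not> wide rk m n)"
proof (cases m)
  case 0
  have "wide rk 0 n" for n unfolding wide_def separated_def by (rule exI[of _ "{}"]) simp
  then show ?thesis using 0 by blast
next
  case (Suc k)
  have *: "wide rk m n \<longleftrightarrow> Rrel v k (h (nat n))" if "n \<ge> int (Suc N)" for n N
    using that by (simp add: Rrel_wide Suc)
  from assms[of k] show ?thesis
  proof
    assume "\<exists>N. \<forall>n\<ge>N. Rrel v k (h n)"
    then obtain N where N: "\<And>n. n \<ge> N \<Longrightarrow> Rrel v k (h n)" by blast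
    have "wide rk m n" if "n \<ge> int (Suc N)" for n using *[OF that] N[of "nat n"] that by simp
    then show ?thesis by blast
  next
    assume "\<exists>N. \<forall>n\<ge>N. \<not> Rrel v k (h n)"
    then obtain N where N: "\<And>n. n \<ge> N \<Longrightarrow> \<not> Rrel v k (h n)" by blast
    have "\<not> wide rk m n" if "n \<ge> int (Suc N)" for n using *[OF that] N[of "nat n"] that by simp
    then show ?thesis by blast
  qed
qed

text \<open>The ball quotients are finite of order a power of \<open>p\<close>, and the only such
  power above p^n0 and at most p^(n0 + 1) is the latter. Hence the quotients eventually have
  constant size.\<close>

lemma Rrel_eventually_small:
  assumes p: "prime p" "primary p (UNIV :: 'g set)"
    and fin: "finite {\<gamma>. \<not> (layer v p n0 \<gamma>)}"
  shows "(\<exists>N. \<forall>n\<ge>N. Rrel v m (h n)) \<or> (\<exists>N. \<forall>n\<ge>N. \<not> Rrel v m (h n))"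
proof -
  obtain N where N: "\<And>n. n \<ge> N \<Longrightarrow> Rrel v (p ^ n0) (h n) \<and> \<not> Rrel v (p ^ (n0 + 1)) (h n)"
    using fin unfolding finite_values_iff by blast
  have "Rrel v m (h n) \<longleftrightarrow> m < p ^ (n0 + 1)" if n: "n \<ge> N" for n
  proof -
    have nt: "h n \<noteq> top" using N[OF n] by (auto simp: Rrel_def)
    have sub: "Bop v (h n) \<subseteq> Bcl v (h n)" by (auto simp: Bop_def Bcl_def)
    have finB: "finite (Bop v (h n))" using finite_subset[OF sub finite_Bcl] .
    have prim: "primary p H" for H :: "'g set" using p(2) by (simp add: primary_def)
    obtain a where a: "card (Bcl v (h n)) = p ^ a"
      using card_primary[OF p(1) additive_set_Bcl finite_Bcl prim] by blast
    let ?q = "card (ball_quotient v (h n))"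
    have "?q dvd p ^ a" using card_ball_quotient[OF nt finite_Bcl] a by (metis dvd_triv_left)
    then obtain b where b: "?q = p ^ b" using p(1) divides_primepow_nat by blast
    have fq: "finite (ball_quotient v (h n))" using finite_Bcl by (simp add: ball_quotient_def)
    have "p ^ n0 < ?q" "?q \<le> p ^ (n0 + 1)" using N[OF n] nt fq by (auto simp: Rrel_def)
    then have "n0 < b" "b \<le> n0 + 1"
      using prime_gt_1_nat[OF p(1)] unfolding b by (metis power_strict_increasing_iff, metis power_increasing_iff)
    then have "?q = p ^ (n0 + 1)" using b by (metis Suc_eq_plus1 le_antisym Suc_leI)
    then show ?thesis using nt fq by (simp add: Rrel_def)
  qed
  then show ?thesis by (cases "m < p ^ (n0 + 1)") auto
qed

text \<open>The quotients outgrow every power of \<open>p\<close>: away from \<open>top\<close> they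
  have more than one element, and only finitely many stop between two consecutive powers.\<close>

lemma Rrel_eventually_large:
  assumes p: "prime p"
    and fin: "\<And>n. finite {\<gamma>. layer v p n \<gamma>}"
  shows "\<exists>N. \<forall>n\<ge>N. Rrel v m (h n)"
proof -
  have "\<exists>N. \<forall>n\<ge>N. Rrel v (p ^ k) (h n)" for k
  proof (induction k)
    case 0
    have "Rrel v (p ^ 0) (h n)" if "n \<ge> 1" for n
      using Rrel_1[of "h n"] that h_eq_top_iff[of n] by simp
    then show ?case by blast
  next
    case (Suc k)
    then obtain N where N: "\<And>n. n \<ge> N \<Longrightarrow> Rrel v (p ^ k) (h n)" by blast
    obtain M where M: "\<And>n. n \<ge> M \<Longrightarrow> \<not> (Rrel v (p ^ k) (h n) \<and> \<not> Rrel v (p ^ (k + 1)) (h n))"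
      using fin[of k] unfolding finite_values_iff by blast
    have "Rrel v (p ^ Suc k) (h n)" if "n \<ge> max N M" for n using N[of n] M[of n] that by simp
    then show ?case by blast
  qed
  then obtain N where N: "\<And>n. n \<ge> N \<Longrightarrow> Rrel v (p ^ m) (h n)" by blast
  have "m \<le> p ^ m" using prime_gt_1_nat[OF p] by (simp add: less_imp_le power_gt_expt)
  then show ?thesis using N Rrel_mono by blast
qed

text \<open>No multiplication raises the rank, and one by a number prime to an exponent of
  \<open>x\<close> is undone by another multiplication.\<close>

lemma rk_nmult_eq:
  assumes "nmult n x = 0" "coprime m n"
  shows "rk (nmult m x) = rk x"
proof -
  obtain u where "nmult u (nmult m x) = x" using coprime_multiple_inverse[OF assms] by blast
  then have "rk x \<le> rk (nmult m x)" by (metis rk_nmult)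
  then show ?thesis using rk_nmult[of m x] by simp
qed

section \<open>Sufficiency in exponent p and for divisible groups\<close>

lemma minimal_if_elementary:
  assumes p: "prime p" "\<And>x :: 'g. nmult p x = 0"
    and wide: "\<And>m. \<exists>N. (\<forall>n\<ge>N. wide rk m n) \<or> (\<forall>n\<ge>N. \<not> wide rk m n)"
    and S: "definable_set v S"
  shows "finite S \<or> finite (- S)"
proof -
  obtain U where U: "ultra U" using ultra_exists by blast
  interpret ranked_ultra rk U by standard (use U wide in auto)
  interpret game rk U v h "\<lambda>_. True"
  proof (standard, goal_cases)
    case (6 R W X X')
    define xx where "xx = (X, X')"
    define T where "T = range (\<lambda>k. imult k xx)"
    have p0: "nmult p z = 0" for z :: "'g elempair"
      using p(2) by (simp add: prod_eq_iff fun_eq_iff)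
    have R: "additive_set R" using 6(1) by (simp add: position_def)
    have "additive_set T" unfolding additive_set_def T_def
      by (auto simp: imult_minus[symmetric] intro: range_eqI[of _ _ 0])
    moreover have "countable T" unfolding T_def by simp
    moreover have "xx \<in> T" unfolding T_def by (intro range_eqI[of _ _ 1]) simp
    moreover have "t + z \<in> R \<or> represented U (candidates rk R W xx) (val rk (t + z))"
      if t: "t \<in> T" and z: "z \<in> R" for t z
    proof -
      obtain k where k: "t = imult k xx" using t by (auto simp: T_def)
      define m where "m = nat (k mod int p)"
      have pp: "int p > 0" using prime_gt_0_nat[OF p(1)] by simp
      have "k = int m + k div int p * int p" using pp by (simp add: m_def)
      then have "t = imult (int m + k div int p * int p) xx" using k by simp
      then have tm: "t = nmult m xx" by (simp only: imult_add imult_nmult imult_of_nat p0 imult_zero add_0_right)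
      have "m < p" using pp unfolding m_def by (simp add: nat_less_iff)
      show ?thesis
      proof (cases "m = 0")
        case True
        then show ?thesis using z tm by simp
      next
        case False
        then have "\<not> p dvd m" using \<open>m < p\<close> by (simp add: nat_dvd_not_less)
        then have cop: "coprime m p" using prime_imp_coprime_nat[OF p(1)] by (subst coprime_commute) blast
        \<comment> \<open>\<open>u\<close> inverts \<open>m\<close> modulo \<open>p\<close>.
          Multiplication by \<open>u\<close> preserves ranks and turns \<open>nmult m xx + z\<close>
          into \<open>xx + nmult u z\<close>, whose rank is listed.\<close>
        obtain u y where uy: "m * u = p * y + gcd m p" using bezout_nat[OF False] by blast
        then have "u * m = y * p + 1" using cop by (simp add: mult.commute)
        then have um: "nmult u (nmult m w) = nmult (y * p + 1) w" for w :: "'g elempair"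
          by (simp only: nmult_mult[symmetric])
        have "nmult u (nmult m w) = w" for w :: "'g elempair"
          unfolding um by (simp only: nmult_add nmult_mult p0 nmult_zero nmult_1 add_0_left)
        then have e: "nmult u (t + z) = xx + nmult u z" by (simp add: tm nmult_plus)
        have "coprime u p"
        proof (rule coprimeI)
          fix c assume "c dvd u" "c dvd p"
          then have "c dvd u * m" "c dvd y * p" by simp_all
          then have "c dvd y * p + 1" "c dvd y * p" using \<open>u * m = y * p + 1\<close> by simp_all
          then show "is_unit c" using dvd_add_right_iff by blast
        qed
        then have "rk (nmult u w) = rk w" for w using rk_nmult_eq[OF p(2)] by blast
        then have "val rk (nmult u q) = val rk q" for q by (simp add: val_def fun_eq_iff)
        from this[of "t + z"] have "val rk (t + z) = val rk (xx + nmult u z)" by (simp only: e)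
        then have "val rk (t + z) \<in> (\<lambda>z. val rk (xx + z)) ` R" using additive_setD(5)[OF R z] by simp
        then show ?thesis by (auto intro: represented_member)
      qed
    qed
    ultimately obtain R' where "R \<subseteq> R'" "xx \<in> R'" "position U rk R' W"
      using extend_position[OF 6(1) 6(4)[folded xx_def], of T] by blast
    then show ?case unfolding xx_def by blast
  qed (use bij_h h_le_iff rk_def in auto)
  show ?thesis using definable_finite_or_cofinite[OF S] .
qed

lemma minimal_if_divisible:
  assumes div: "divisible (UNIV :: 'g set)"
    and shift: "\<And>n. n > 0 \<Longrightarrow> \<exists>N s. \<forall>x. N \<le> rk x \<longrightarrow> rk (nmult n x) = rk x - s"
    and wide: "\<And>m. \<exists>N. (\<forall>n\<ge>N. wide rk m n) \<or> (\<forall>n\<ge>N. \<not> wide rk m n)"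
    and S: "definable_set v S"
  shows "finite S \<or> finite (- S)"
proof -
  obtain U where U: "ultra U" using ultra_exists by blast
  interpret ranked_ultra rk U by standard (use U wide in auto)
  have shift_seq: "\<exists>s. \<forall>y. inf_seq (rk \<circ> y) \<longrightarrow> eventually (\<lambda>i. rk (nmult n (y i)) = rk (y i) - s) U"
    if n: "n > 0" for n
  proof -
    obtain N s where Ns: "\<And>x. N \<le> rk x \<Longrightarrow> rk (nmult n x) = rk x - s" using shift[OF n] by blast
    have "eventually (\<lambda>i. rk (nmult n (y i)) = rk (y i) - s) U" if "inf_seq (rk \<circ> y)" for y
      using that[unfolded inf_seq_def, rule_format, of N] by eventually_elim (simp add: Ns)
    then show ?thesis by blast
  qed
  interpret game rk U v h divisible
  proof (standard, goal_cases)
    case (4)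
    show ?case unfolding divisible_def constants_def
    proof (intro allI impI ballI)
      fix n :: nat and x :: "'g elempair" assume "n > 0" "x \<in> range (\<lambda>g. (\<lambda>_. g, \<lambda>_. g))"
      then obtain g where "x = (\<lambda>_. g, \<lambda>_. g)" by blast
      moreover obtain y where "nmult n y = g" using div \<open>n > 0\<close> by (auto simp: divisible_def)
      ultimately have "nmult n (\<lambda>_. y, \<lambda>_. y) = x" by (simp add: prod_eq_iff fun_eq_iff)
      then show "\<exists>y\<in>range (\<lambda>g. (\<lambda>_. g, \<lambda>_. g)). nmult n y = x" by blast
    qed
  next
    case (5 R)
    show ?case unfolding divisible_def
    proof (intro allI impI ballI)
      fix n :: nat and x assume "n > 0" "x \<in> prod.swap ` R"
      then obtain z where z: "z \<in> R" "x = prod.swap z" by blast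
      then obtain y where "y \<in> R" "nmult n y = z" using 5 \<open>n > 0\<close> unfolding divisible_def by blast
      then have "nmult n (prod.swap y) = x" "prod.swap y \<in> prod.swap ` R"
        using z by (auto simp: prod_eq_iff)
      then show "\<exists>y\<in>prod.swap ` R. nmult n y = x" by blast
    qed
  next
    case (6 R W X X')
    define xx where "xx = (X, X')"
    have "divisible (UNIV :: 'g elempair set)"
      using div by (intro divisible_prod divisible_fun)
    then obtain \<theta> :: "rat \<Rightarrow> 'g elempair"
      where \<theta>: "\<And>r s. \<theta> (r + s) = \<theta> r + \<theta> s" "\<theta> 1 = xx" by (rule divisible_hom_rat[where x = xx]) blast
    note \<theta>' = additive_map[of \<theta>, OF \<theta>(1)]
    define T where "T = range \<theta>"
    define Q where "Q = candidates rk R W xx"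
    have Q: "compat U Q" using 6(4) by (simp add: Q_def xx_def)
    have R: "additive_set R" using 6(1) by (simp add: position_def)
    have cst: "(\<lambda>_. g, \<lambda>_. g) \<in> R" for g using 6(1) by (auto simp: position_def constants_def)
    have "additive_set T" unfolding additive_set_def T_def
      by (auto simp: \<theta>'(3)[symmetric] intro: range_eqI[of _ _ 0] \<theta>'(1)[symmetric])
    moreover have "countable T" unfolding T_def by simp
    moreover have "xx \<in> T" unfolding T_def using \<theta>(2) by (metis rangeI)
    moreover have "t + z \<in> R \<or> represented U Q (val rk (t + z))" if t: "t \<in> T" and z: "z \<in> R" for t z
    proof -
      \<comment> \<open>Write r = A / n'. Since \<open>R\<close> is divisible, there is b in
        \<open>R\<close> with A b = n' z, and then w = \<theta> r + z and u = xx + b satisfy n' w =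
        A u. Multiplication by n' and by A lowers infinite ranks by s and s', so the ranks of w and
        u differ by s - s', in both components alike.\<close>
      have pos: "represented U Q (val rk (\<theta> r + z))" if r: "r > 0" and z: "z \<in> R" for r z
      proof -
        obtain a n where an: "quotient_of r = (a, n)" by (metis surj_pair)
        then have "r = of_int a / of_int n" "n > 0" using quotient_of_div quotient_of_denom_pos by blast+
        moreover have "a > 0" using calculation r by (simp add: zero_less_divide_iff)
        ultimately have r': "of_nat (nat n) * r = of_nat (nat a)" "nat n > 0" "nat a > 0"
          by (simp_all add: of_nat_nat)
        define A n' where "A = nat a" and "n' = nat n"
        obtain b where b: "b \<in> R" "nmult A b = nmult n' z"
          using 6(2) additive_setD(5)[OF R z, of n'] r'(3) unfolding divisible_def A_def by blast
        have "nmult n' (\<theta> r) = \<theta> (nmult n' r)" by (simp add: \<theta>'(4))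
        also have "\<dots> = \<theta> (nmult A 1)" using r'(1) by (simp add: nmult_field A_def n'_def)
        also have "\<dots> = nmult A xx" by (simp add: \<theta>'(4) \<theta>(2))
        finally have e: "nmult n' (\<theta> r + z) = nmult A (xx + b)" by (simp add: nmult_plus b(2))
        define w where "w = \<theta> r + z"
        define u where "u = xx + b"
        have uQ: "(rk \<circ> fst u, rk \<circ> snd u) \<in> Q" using b(1) by (auto simp: Q_def u_def val_def)
        \<comment> \<open>A constant first component of \<open>u\<close> would put \<open>X\<close>
          into the domain.\<close>
        have inf1: "inf_seq (rk \<circ> fst u)"
        proof (rule not_constant_inf_seq)
          fix g
          have "(\<lambda>_. g, \<lambda>_. g) - b \<in> R" using additive_setD(2)[OF R cst b(1)] .
          then have "\<not> eventually (\<lambda>i. X i = fst ((\<lambda>_. g, \<lambda>_. g) - b) i) U" by (rule 6(3))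
          then show "\<not> eventually (\<lambda>i. fst u i = g) U" by (simp add: u_def xx_def eq_diff_eq)
        qed
        have "val rk 0 \<in> Q" using additive_setD(1)[OF R] by (auto simp: Q_def)
        then have inf2: "inf_seq (rk \<circ> snd u)" using inf_seq_transfer[OF Q uQ] inf1 by blast
        obtain s where s: "\<And>y. inf_seq (rk \<circ> y) \<Longrightarrow> eventually (\<lambda>i. rk (nmult n' (y i)) = rk (y i) - s) U"
          using shift_seq[of n'] r'(2) n'_def by auto
        obtain s' where s': "\<And>y. inf_seq (rk \<circ> y) \<Longrightarrow> eventually (\<lambda>i. rk (nmult A (y i)) = rk (y i) - s') U"
          using shift_seq[of A] r'(3) A_def by auto
        have main: "eventually (\<lambda>i. (rk \<circ> y) i = (rk \<circ> x) i + (s - s')) U"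
          if yx: "nmult n' y = nmult A x" and inf: "inf_seq (rk \<circ> x)" for x y :: "nat \<Rightarrow> 'g"
        proof -
          have yx': "nmult n' (y i) = nmult A (x i)" for i using yx by (metis nmult_apply)
          have "inf_seq (rk \<circ> y)" unfolding inf_seq_def
          proof
            fix N
            have "eventually (\<lambda>i. N + s' < (rk \<circ> x) i) U" using inf by (simp add: inf_seq_def)
            then show "eventually (\<lambda>i. N < (rk \<circ> y) i) U" using s'[OF inf]
            proof eventually_elim
              case (elim i)
              then show ?case using rk_nmult[of n' "y i"] yx'[of i] by simp
            qed
          qed
          then show ?thesis using s[of y] s'[OF inf]
            by (auto elim: eventually_elim2 simp: yx')
        qed
        have "nmult n' (fst w) = nmult A (fst u)" "nmult n' (snd w) = nmult A (snd u)"
          using e unfolding w_def u_def by (metis nmult_fst_snd)+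
        from main[OF this(1) inf1] main[OF this(2) inf2]
        show ?thesis unfolding represented_def val_def w_def[symmetric] using uQ by blast
      qed
      obtain r where r: "t = \<theta> r" using t by (auto simp: T_def)
      consider "r = 0" | "r > 0" | "r < 0" by linarith
      then show ?thesis
      proof cases
        case 1
        then show ?thesis using z r \<theta>'(1) by simp
      next
        case 2
        then show ?thesis using pos[OF 2 z] r by blast
      next
        case 3
        then have "represented U Q (val rk (\<theta> (- r) + - z))" using additive_setD(3)[OF R z] by (intro pos) auto
        moreover have "\<theta> (- r) + - z = - (t + z)" using r \<theta>'(2) by simp
        moreover have "val rk (- q) = val rk q" for q by (simp add: val_def fun_eq_iff)
        ultimately have "represented U Q (val rk (t + z))" by (simp only:)
        then show ?thesis by blast
      qed
    qed
    ultimately obtain R' where R': "R' = {t + z | t z. t \<in> T \<and> z \<in> R}" "R \<subseteq> R'" "xx \<in> R'" "position U rk R' W"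
      using extend_position[OF 6(1) 6(4)[folded xx_def], of T] unfolding Q_def by blast
    have "divisible R'" unfolding divisible_def
    proof (intro allI impI ballI)
      fix n :: nat and x assume n: "n > 0" "x \<in> R'"
      then obtain r z where x: "x = \<theta> r + z" "z \<in> R" unfolding R'(1) T_def by blast
      obtain y where y: "y \<in> R" "nmult n y = z" using 6(2) n(1) x(2) unfolding divisible_def by blast
      have "nmult n (\<theta> (r / of_nat n)) = \<theta> r" using n(1) \<theta>'(4)[of n "r / of_nat n"] by (simp add: nmult_field)
      then have "nmult n (\<theta> (r / of_nat n) + y) = x" using x y by (simp add: nmult_plus)
      moreover have "\<theta> (r / of_nat n) + y \<in> R'" unfolding R'(1) T_def using y by blast
      ultimately show "\<exists>y\<in>R'. nmult n y = x" by blast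
    qed
    then show ?case using R' unfolding xx_def by blast
  qed (use bij_h h_le_iff rk_def in auto)
  show ?thesis using definable_finite_or_cofinite[OF S] .
qed

end

lemma nmult_ffun:
  assumes "f_well_defined v n (v x)"
  shows "ffun v n (v x) = v (nmult n x)"
proof -
  have "(THE \<delta>. \<forall>y. v y = v x \<longrightarrow> v (nmult n y) = \<delta>) = v (nmult n x)"
  proof (rule the_equality)
    show "\<forall>y. v y = v x \<longrightarrow> v (nmult n y) = v (nmult n x)"
      using assms unfolding f_well_defined_def by blast
    show "\<delta> = v (nmult n x)" if "\<forall>y. v y = v x \<longrightarrow> v (nmult n y) = \<delta>" for \<delta>
      using that by simp
  qed
  then show ?thesis using assms by (simp add: ffun_def)
qed

text \<open>Write n = m p^a with \<open>m\<close> prime to \<open>p\<close>. Every order is a power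
  of \<open>p\<close>, so \<open>m\<close> acts invertibly on each element, and division by p^a is
  repeated division by \<open>p\<close>.\<close>

lemma divisible_if_prime_divisible:
  fixes p :: nat
  assumes p: "prime p" "primary p (UNIV :: 'g::ab_group_add set)"
    and d: "\<And>x :: 'g. \<exists>y. nmult p y = x"
  shows "divisible (UNIV :: 'g set)"
  unfolding divisible_def
proof (intro allI impI ballI)
  have pow: "\<exists>y. nmult (p ^ a) y = x" for a and x :: 'g
  proof (induction a arbitrary: x)
    case 0
    show ?case by (rule exI[of _ x]) simp
  next
    case (Suc a)
    obtain y where "nmult p y = x" using d by blast
    moreover obtain z where "nmult (p ^ a) z = y" using Suc by blast
    ultimately show ?case by (intro exI[of _ z]) (simp add: nmult_mult)
  qed
  fix n :: nat and x :: 'g assume "n > 0"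
  then obtain a m where am: "\<not> p dvd m" "n = m * p ^ a" using prime_power_canonical[OF p(1)] by blast
  obtain k where k: "nmult (p ^ k) x = 0" using p(2) by (auto simp: primary_def)
  have "coprime m (p ^ k)" using prime_imp_coprime_nat[OF p(1) am(1)] by (simp add: coprime_commute)
  then obtain u where "nmult u (nmult m x) = x" using coprime_multiple_inverse[OF k] by blast
  then have "nmult m (nmult u x) = x" by (simp add: nmult_commute)
  moreover obtain y where "nmult (p ^ a) y = nmult u x" using pow by blast
  ultimately have "nmult n y = x" by (simp add: am(2) nmult_mult)
  then show "\<exists>y\<in>UNIV. nmult n y = x" by blast
qed

lemma root_of_unity_root:
  fixes z :: complex
  assumes "z ^ n = 1" "n > 0" "m > 0"
  obtains w where "w ^ m = z"
proof -
  have "norm z = 1" using power_eq_1_iff[OF assms(1)] assms(2) by simp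
  then have "z = cis (Arg z)" using rcis_cmod_Arg[of z] by (simp add: rcis_def)
  moreover have "cis (Arg z / real m) ^ m = cis (Arg z)" using assms(3) by (simp add: DeMoivre)
  ultimately show thesis using that by metis
qed

text \<open>Both properties are checked by coordinates: finitely many exponents are dominated by
  their sum, and a p-th root of a root of unity of p-power order has p-power order.\<close>

lemma prufer_product_primary_divisible:
  assumes p: "prime p" and G: "finite_prufer_product TYPE('g::ab_group_add) p"
  shows "primary p (UNIV :: 'g set)" "divisible (UNIV :: 'g set)"
proof -
  obtain k and f :: "'g \<Rightarrow> nat \<Rightarrow> complex"
    where f: "f \<in> iso (additive_group TYPE('g)) (product_group {..<k} (\<lambda>_. prufer_group p))"
    using G unfolding finite_prufer_product_def is_iso_def by blast
  let ?P = "PiE {..<k} (\<lambda>_. {z :: complex. \<exists>j. z ^ (p ^ j) = 1})"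
  have bij: "bij_betw f UNIV ?P"
    using f by (simp add: iso_def additive_group_def prufer_group_def product_group_def)
  have add: "f (x + y) = (\<lambda>i\<in>{..<k}. f x i * f y i)" for x y
    using f by (auto simp: iso_def hom_def additive_group_def prufer_group_def product_group_def)
  have inj: "f x = f y \<longleftrightarrow> x = y" for x y using bij by (auto simp: bij_betw_def inj_eq)
  have mem: "f x \<in> ?P" for x using bij_betwE[OF bij] by blast
  have memj: "\<exists>j. f x i ^ (p ^ j) = 1" if "i < k" for x i
    using PiE_mem[OF mem[of x], of i] that by simp
  have 0: "f 0 i = 1" if "i < k" for i
  proof -
    obtain j where j: "f 0 i ^ (p ^ j) = 1" using memj[OF \<open>i < k\<close>] by blast
    have "p ^ j \<noteq> 0" using prime_gt_0_nat[OF p] by simp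
    then have "f 0 i \<noteq> 0" using j by (auto simp: power_0_left)
    moreover have "f 0 i = f 0 i * f 0 i" using fun_cong[OF add[of 0 0], of i] that by simp
    ultimately show ?thesis by simp
  qed
  have mult: "f (nmult n x) i = f x i ^ n" if "i < k" for n x i
    by (induction n) (use that in \<open>simp_all add: 0 nmult_Suc add mult.commute\<close>)
  have eqI: "x = y" if "\<And>i. i < k \<Longrightarrow> f x i = f y i" for x y
  proof -
    have "f x = f y" by (rule PiE_ext[OF mem mem]) (use that in simp)
    then show ?thesis using inj by blast
  qed
  show prim: "primary p (UNIV :: 'g set)" unfolding primary_def
  proof
    fix x :: 'g
    have "\<forall>i\<in>{..<k}. \<exists>j. f x i ^ (p ^ j) = 1" using memj by simp
    then obtain j where "\<forall>i\<in>{..<k}. f x i ^ (p ^ j i) = 1" using bchoice by metis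
    then have j: "f x i ^ (p ^ j i) = 1" if "i < k" for i using that by simp
    have "nmult (p ^ (\<Sum>i<k. j i)) x = 0"
    proof (rule eqI)
      fix i assume i: "i < k"
      have "(\<Sum>i<k. j i) = j i + (\<Sum>i\<in>{..<k} - {i}. j i)" using i by (simp add: sum.remove)
      then have "f x i ^ (p ^ (\<Sum>i<k. j i)) = (f x i ^ (p ^ j i)) ^ (p ^ (\<Sum>i\<in>{..<k} - {i}. j i))"
        by (simp add: power_add power_mult)
      then show "f (nmult (p ^ (\<Sum>i<k. j i)) x) i = f 0 i" using i by (simp add: mult 0 j)
    qed
    then show "\<exists>k. nmult (p ^ k) x = 0" by blast
  qed
  have "\<exists>y. nmult p y = x" for x :: 'g
  proof -
    have "\<exists>w. w ^ p = f x i \<and> (\<exists>j. w ^ (p ^ j) = 1)" if "i < k" for i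
    proof -
      obtain j where j: "f x i ^ (p ^ j) = 1" using memj[OF \<open>i < k\<close>] by blast
      obtain w where w: "w ^ p = f x i"
        using root_of_unity_root[OF j] prime_gt_0_nat[OF p] by auto
      then have "w ^ (p ^ Suc j) = 1" using j by (simp add: power_mult)
      then show ?thesis using w by blast
    qed
    then have "\<exists>w. \<forall>i. i < k \<longrightarrow> w i ^ p = f x i \<and> (\<exists>j. w i ^ (p ^ j) = 1)" by (intro choice) blast
    then obtain w where w: "\<And>i. i < k \<Longrightarrow> w i ^ p = f x i \<and> (\<exists>j. w i ^ (p ^ j) = 1)" by blast
    then have "restrict w {..<k} \<in> ?P" by auto
    then obtain y where y: "f y = restrict w {..<k}"
      using bij_betw_imp_surj_on[OF bij] by (metis (no_types, lifting) imageE)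
    have "nmult p y = x" by (rule eqI) (simp add: mult y w)
    then show ?thesis by blast
  qed
  then show "divisible (UNIV :: 'g set)" by (rule divisible_if_prime_divisible[OF p prim])
qed

section \<open>Eventual shifts in terms of ranks\<close>

context omega_valued
begin

text \<open>\<open>h\<close> reverses the order, so that passing to the successor lowers the
  index.\<close>

lemma is_successor_h: "is_successor (h n) (h m) \<longleftrightarrow> n = Suc m"
proof -
  have "is_successor (h n) (h m) \<longleftrightarrow> m < n \<and> \<not> (\<exists>j. j < n \<and> m < j)"
    unfolding is_successor_def by (metis ex_h h_less_iff)
  also have "\<dots> \<longleftrightarrow> n = Suc m"
  proof
    assume *: "m < n \<and> \<not> (\<exists>j. j < n \<and> m < j)"
    then have "\<not> Suc m < n" by blast
    then show "n = Suc m" using * by simp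
  qed auto
  finally show ?thesis .
qed

lemma successor_pow_h: "(is_successor ^^ l) (h n) (h m) \<longleftrightarrow> n = m + l"
proof (induction l arbitrary: m)
  case 0
  then show ?case by (simp add: h_eq_iff)
next
  case (Suc l)
  show ?case
  proof
    assume "(is_successor ^^ Suc l) (h n) (h m)"
    then obtain \<gamma> where \<gamma>: "(is_successor ^^ l) (h n) \<gamma>" "is_successor \<gamma> (h m)" by (rule relpowp_Suc_E)
    obtain j where "\<gamma> = h j" using ex_h by blast
    then show "n = m + Suc l" using \<gamma> Suc[of j] is_successor_h[of j m] by simp
  next
    assume "n = m + Suc l"
    then have "(is_successor ^^ l) (h n) (h (Suc m))" using Suc[of "Suc m"] by simp
    moreover have "is_successor (h (Suc m)) (h m)" by (simp add: is_successor_h)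
    ultimately show "(is_successor ^^ Suc l) (h n) (h m)" by (rule relpowp_Suc_I)
  qed
qed

lemma eventual_shift:
  assumes "eventually_right_shift v p"
  obtains N l where "\<And>x. int N \<le> rk x \<Longrightarrow> rk (nmult p x) = rk x - int l"
proof -
  obtain I l where I0: "finite (- I)" "\<forall>\<gamma>\<in>I. f_well_defined v p \<gamma>"
    "\<forall>\<gamma>\<in>I. (is_successor ^^ l) \<gamma> (ffun v p \<gamma>)"
    using assms unfolding eventually_right_shift_def by (elim exE conjE)
  note I = I0(1) bspec[OF I0(2)] bspec[OF I0(3)]
  have "finite {\<gamma>. \<gamma> \<notin> I}" using I(1) by (simp add: Compl_eq)
  then obtain N where N: "\<And>n. n \<ge> N \<Longrightarrow> h n \<in> I" unfolding finite_values_iff by blast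
  have "rk (nmult p x) = rk x - int l" if x: "int N \<le> rk x" for x
  proof -
    have v: "v x = h (nat (rk x))" by (rule v_eq)
    have m: "v x \<in> I" using N[of "nat (rk x)"] x v by simp
    have "(is_successor ^^ l) (h (nat (rk x))) (h (nat (rk (nmult p x))))"
      using I(3)[OF m] nmult_ffun[OF I(2)[OF m]] v v_eq[of "nmult p x"] by simp
    then have "nat (rk x) = nat (rk (nmult p x)) + l" by (simp only: successor_pow_h)
    then show ?thesis using rk_nonneg[of x] rk_nonneg[of "nmult p x"] by linarith
  qed
  then show thesis using that by blast
qed

text \<open>The margin a * l keeps the intermediate multiples at rank at least \<open>N\<close>,
  where each factor \<open>p\<close> acts as the shift.\<close>

lemma shift_prime_power:
  assumes "\<And>x. int N \<le> rk x \<Longrightarrow> rk (nmult p x) = rk x - int l" "int (N + a * l) \<le> rk x"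
  shows "rk (nmult (p ^ a) x) = rk x - int (a * l)"
  using assms(2)
proof (induction a)
  case (Suc a)
  then have "rk (nmult (p ^ a) x) = rk x - int (a * l)" by simp
  moreover have "rk (nmult p (nmult (p ^ a) x)) = rk (nmult (p ^ a) x) - int l"
    using Suc.prems calculation by (intro assms(1)) simp
  ultimately show ?case by (simp add: nmult_mult)
qed simp

lemma rk_nmult_coprime:
  assumes "prime p" "primary p (UNIV :: 'g set)" "\<not> p dvd m"
  shows "rk (nmult m x) = rk x"
proof -
  obtain k where k: "nmult (p ^ k) x = 0" using assms(2) by (auto simp: primary_def)
  have "coprime m (p ^ k)" using prime_imp_coprime_nat[OF assms(1,3)] by (simp add: coprime_commute)
  then show ?thesis by (rule rk_nmult_eq[OF k])
qed

lemma minimal_if: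
  assumes p: "prime p"
    and cases: "(elementary_abelian TYPE('g) p \<and>
        ((\<exists>n0. finite {\<gamma>. \<not> (layer v p n0 \<gamma>)}) \<or>
         (\<forall>n. finite {\<gamma>. layer v p n \<gamma>})))
       \<or>
       (finite_prufer_product TYPE('g) p \<and>
        eventually_right_shift v p \<and>
        (\<exists>n0. finite {\<gamma>. \<not> (layer v p n0 \<gamma>)}))"
  shows "minimal_valued_group v"
  unfolding minimal_valued_group_def
proof (intro conjI allI impI infinite_UNIV)
  fix S assume S: "definable_set v S"
  from cases show "finite S \<or> finite (- S)"
  proof (elim disjE[where P = "_ \<and> _"] conjE)
    assume el: "elementary_abelian TYPE('g) p"
      and R: "(\<exists>n0. finite {\<gamma>. \<not> (layer v p n0 \<gamma>)}) \<or>
         (\<forall>n. finite {\<gamma>. layer v p n \<gamma>})"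
    have p0: "nmult p x = 0" for x :: 'g using el by (simp add: elementary_abelian_def)
    have prim: "primary p (UNIV :: 'g set)" unfolding primary_def using p0 by (metis power_one_right)
    from R have "(\<exists>N. \<forall>n\<ge>N. Rrel v m (h n)) \<or> (\<exists>N. \<forall>n\<ge>N. \<not> Rrel v m (h n))" for m
    proof
      assume "\<exists>n0. finite {\<gamma>. \<not> (layer v p n0 \<gamma>)}"
      then show ?thesis using Rrel_eventually_small[OF p prim] by blast
    next
      assume "\<forall>n. finite {\<gamma>. layer v p n \<gamma>}"
      then show ?thesis using Rrel_eventually_large[OF p] by blast
    qed
    from minimal_if_elementary[OF p p0 wide_eventuallyI[OF this] S] show ?thesis .
  next
    assume pr: "finite_prufer_product TYPE('g) p" and rs: "eventually_right_shift v p"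
      and R: "\<exists>n0. finite {\<gamma>. \<not> (layer v p n0 \<gamma>)}"
    note prim = prufer_product_primary_divisible(1)[OF p pr]
    have "(\<exists>N. \<forall>n\<ge>N. Rrel v m (h n)) \<or> (\<exists>N. \<forall>n\<ge>N. \<not> Rrel v m (h n))" for m
      using R Rrel_eventually_small[OF p prim] by blast
    note wide = wide_eventuallyI[OF this]
    obtain N l where Nl: "\<And>x. int N \<le> rk x \<Longrightarrow> rk (nmult p x) = rk x - int l"
      using eventual_shift[OF rs] by blast
    have "\<exists>N s. \<forall>x. N \<le> rk x \<longrightarrow> rk (nmult n x) = rk x - s" if n: "n > 0" for n
    proof -
      obtain a m where am: "\<not> p dvd m" "n = m * p ^ a" using prime_power_canonical[OF p n] by blast
      have "rk (nmult n x) = rk x - int (a * l)" if "int (N + a * l) \<le> rk x" for x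
        using shift_prime_power[OF Nl that] rk_nmult_coprime[OF p prim am(1)] by (simp add: am(2) nmult_mult)
      then show ?thesis by blast
    qed
    from minimal_if_divisible[OF prufer_product_primary_divisible(2)[OF p pr] this wide S] show ?thesis .
  qed
qed

end

section \<open>Definable sets\<close>

primrec gmult :: "nat \<Rightarrow> gterm \<Rightarrow> gterm" where
  "gmult 0 t = GZero"
| "gmult (Suc n) t = GAdd (gmult n t) t"

lemma gval_gmult [simp]: "gval e (gmult n t) = nmult n (gval e t)"
  by (induction n) (simp_all add: nmult_Suc)

primrec conjs :: "form list \<Rightarrow> form" where
  "conjs [] = VLe VInf VInf"
| "conjs (\<phi> # \<phi>s) = Conj \<phi> (conjs \<phi>s)"

lemma sat_conjs [simp]: "sat v e w (conjs \<phi>s) \<longleftrightarrow> (\<forall>\<phi>\<in>set \<phi>s. sat v e w \<phi>)"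
  by (induction \<phi>s) simp_all

text \<open>Variable 0 is spared because \<open>definable_set\<close> reserves it for the element
  described.\<close>

primrec gexs :: "nat \<Rightarrow> form \<Rightarrow> form" where
  "gexs 0 \<phi> = \<phi>"
| "gexs (Suc n) \<phi> = GEx (Suc n) (gexs n \<phi>)"

lemma sat_gexs: "sat v e w (gexs n \<phi>) \<longleftrightarrow> (\<exists>f. sat v (\<lambda>k. if 1 \<le> k \<and> k \<le> n then f k else e k) w \<phi>)"
proof (induction n arbitrary: e)
  case 0
  have "(\<lambda>k. if 1 \<le> k \<and> k \<le> 0 then f k else e k) = e" for f by (auto simp: fun_eq_iff)
  then show ?case by simp
next
  case (Suc n)
  have eq: "(\<lambda>k. if 1 \<le> k \<and> k \<le> n then f k else (e(Suc n := x)) k) =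
      (\<lambda>k. if 1 \<le> k \<and> k \<le> Suc n then (f(Suc n := x)) k else e k)" for f x
    by (auto simp: fun_eq_iff le_Suc_eq)
  have "sat v e w (gexs (Suc n) \<phi>) \<longleftrightarrow>
      (\<exists>x f. sat v (\<lambda>k. if 1 \<le> k \<and> k \<le> Suc n then (f(Suc n := x)) k else e k) w \<phi>)"
    by (simp only: gexs.simps sat.simps Suc eq)
  also have "\<dots> \<longleftrightarrow> (\<exists>f. sat v (\<lambda>k. if 1 \<le> k \<and> k \<le> Suc n then f k else e k) w \<phi>)"
  proof
    assume "\<exists>f. sat v (\<lambda>k. if 1 \<le> k \<and> k \<le> Suc n then f k else e k) w \<phi>"
    then obtain f where "sat v (\<lambda>k. if 1 \<le> k \<and> k \<le> Suc n then (f(Suc n := f (Suc n))) k else e k) w \<phi>"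
      unfolding fun_upd_triv by (elim exE)
    then show "\<exists>x f. sat v (\<lambda>k. if 1 \<le> k \<and> k \<le> Suc n then (f(Suc n := x)) k else e k) w \<phi>"
      by (intro exI)
  qed (elim exE, rule exI)
  finally show ?case .
qed

lemma definable_Bcl: "definable_set v (Bcl v \<gamma>)"
  unfolding definable_set_def
  by (rule exI[of _ "VLe (VVar 0) (VVal (GVar 0))"], rule exI, rule exI[of _ "\<lambda>_. \<gamma>"]) (simp add: Bcl_def)

lemma definable_Bop: "definable_set v (Bop v \<gamma>)"
  unfolding definable_set_def
  by (rule exI[of _ "Neg (VLe (VVal (GVar 0)) (VVar 0))"], rule exI, rule exI[of _ "\<lambda>_. \<gamma>"])
    (simp add: Bop_def not_le)

lemma definable_kernel: "definable_set v {x. nmult n x = 0}"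
  unfolding definable_set_def
  by (rule exI[of _ "GEq (gmult n (GVar 0)) GZero"]) simp

lemma definable_range: "definable_set v (range (nmult n))"
  unfolding definable_set_def
  by (rule exI[of _ "GEx 1 (GEq (gmult n (GVar 1)) (GVar 0))"]) (auto simp: image_def)

lemma definable_fixed: "definable_set v {x. v (nmult n x) = v x}"
  unfolding definable_set_def
  by (rule exI[of _ "VEq (VVal (gmult n (GVar 0))) (VVal (GVar 0))"]) simp

text \<open>Once values are numbered by ranks, a chain of \<open>l\<close> ascending steps from the
  value of x up to at most that of n x says that multiplication by \<open>n\<close> lowers the rank
  of x by at least \<open>l\<close>. Ranks are not in the language, hence the chain of
  witnesses.\<close>

lemma definable_chain:
  fixes v :: "'g::ab_group_add \<Rightarrow> 'c::{linorder, order_top}"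
  shows "definable_set v {x. \<exists>f. f 0 = x \<and> (\<forall>i<l. v (f i) < v (f (Suc i))) \<and> v (f l) \<le> v (nmult n x)}"
proof -
  define \<phi> where "\<phi> = gexs l (Conj (VLe (VVal (GVar l)) (VVal (gmult n (GVar 0))))
    (conjs (map (\<lambda>i. Neg (VLe (VVal (GVar (Suc i))) (VVal (GVar i)))) [0..<l])))"
  have "sat v (e(0 := x)) w \<phi> \<longleftrightarrow>
      (\<exists>f. f 0 = x \<and> (\<forall>i<l. v (f i) < v (f (Suc i))) \<and> v (f l) \<le> v (nmult n x))"
    (is "?L \<longleftrightarrow> ?R") for e w and x :: 'g
  proof
    assume ?L
    then obtain f where f: "sat v (\<lambda>k. if 1 \<le> k \<and> k \<le> l then f k else (e(0 := x)) k) w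
      (Conj (VLe (VVal (GVar l)) (VVal (gmult n (GVar 0))))
      (conjs (map (\<lambda>i. Neg (VLe (VVal (GVar (Suc i))) (VVal (GVar i)))) [0..<l])))"
      unfolding \<phi>_def sat_gexs by blast
    show ?R
      by (rule exI[of _ "\<lambda>k. if 1 \<le> k \<and> k \<le> l then f k else (e(0 := x)) k"])
        (use f in \<open>auto simp: not_le\<close>)
  next
    assume ?R
    then obtain f where f: "f 0 = x" "\<And>i. i < l \<Longrightarrow> v (f i) < v (f (Suc i))" "v (f l) \<le> v (nmult n x)"
      by blast
    have eq: "(if 1 \<le> k \<and> k \<le> l then f k else (e(0 := x)) k) = f k" if "k \<le> l" for k
      using that f(1) by (cases k) simp_all
    show ?L unfolding \<phi>_def sat_gexs
      by (rule exI[of _ f]) (use f in \<open>auto simp: eq not_le\<close>)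
  qed
  then show ?thesis unfolding definable_set_def by blast
qed

context valued_abelian_group
begin

text \<open>Numbered representatives in place of a set, so that each one can be bound by its own
  quantifier.\<close>

lemma Rrel_iff_sequence:
  "Rrel v m \<gamma> \<longleftrightarrow> \<gamma> \<noteq> top \<and> (\<exists>f. (\<forall>i\<le>m. \<gamma> \<le> v (f i)) \<and> (\<forall>i\<le>m. \<forall>j<i. v (f i - f j) \<le> \<gamma>))"
proof (cases "\<gamma> = top")
  case False
  have "(\<exists>S. finite S \<and> card S = Suc m \<and> (\<forall>x\<in>S. \<gamma> \<le> v x) \<and> (\<forall>x\<in>S. \<forall>y\<in>S. x \<noteq> y \<longrightarrow> v (x - y) \<le> \<gamma>)) \<longleftrightarrow>
     (\<exists>f. (\<forall>i\<le>m. \<gamma> \<le> v (f i)) \<and> (\<forall>i\<le>m. \<forall>j<i. v (f i - f j) \<le> \<gamma>))" (is "?L \<longleftrightarrow> ?R")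
  proof
    assume ?L
    then obtain S where S: "finite S" "card S = Suc m" "\<forall>x\<in>S. \<gamma> \<le> v x"
      "\<forall>x\<in>S. \<forall>y\<in>S. x \<noteq> y \<longrightarrow> v (x - y) \<le> \<gamma>" by blast
    obtain f where f: "bij_betw f {..<Suc m} S"
      using S(1,2) by (metis bij_betw_from_nat_into_finite)
    have mem: "f i \<in> S" if "i \<le> m" for i using bij_betwE[OF f] that by auto
    have "f i \<noteq> f j" if "i \<le> m" "j < i" for i j
      using bij_betw_imp_inj_on[OF f] that by (auto dest: inj_onD)
    then have "v (f i - f j) \<le> \<gamma>" if "i \<le> m" "j < i" for i j
      using S(4) mem[of i] mem[of j] that by simp
    then show ?R using mem S(3) by (intro exI[of _ f]) blast
  next
    assume ?R
    then obtain f where f: "\<And>i. i \<le> m \<Longrightarrow> \<gamma> \<le> v (f i)" "\<And>i j. i \<le> m \<Longrightarrow> j < i \<Longrightarrow> v (f i - f j) \<le> \<gamma>"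
      by blast
    have d: "v (f i - f j) \<le> \<gamma>" if "i \<le> m" "j \<le> m" "i \<noteq> j" for i j
    proof (cases "j < i")
      case True then show ?thesis using f(2) that by blast
    next
      case False
      then have "v (f j - f i) \<le> \<gamma>" using f(2)[of j i] that by simp
      then show ?thesis by (simp add: v_minus_commute)
    qed
    have "inj_on f {..m}"
    proof (rule inj_onI, rule ccontr)
      fix i j assume *: "i \<in> {..m}" "j \<in> {..m}" "f i = f j" "i \<noteq> j"
      then have "v 0 \<le> \<gamma>" using d[of i j] by simp
      then show False using False by (simp add: v_0 top_unique)
    qed
    then have "card (f ` {..m}) = Suc m" by (simp add: card_image)
    moreover have "\<forall>x\<in>f ` {..m}. \<forall>y\<in>f ` {..m}. x \<noteq> y \<longrightarrow> v (x - y) \<le> \<gamma>" using d by auto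
    ultimately show ?L using f(1) by (intro exI[of _ "f ` {..m}"]) auto
  qed
  then show ?thesis unfolding Rrel_iff by blast
qed (simp add: Rrel_iff)

lemma definable_Rrel: "definable_set v {x. Rrel v m (v x)}"
proof -
  \<comment> \<open>The language has no subtraction, so the fresh variable m + 2 names the
    difference of two representatives. Variable 0 holds the element and the variables 1 to m + 1
    hold the representatives.\<close>
  define \<delta> where "\<delta> i j = GEx (Suc (Suc m)) (Conj (GEq (GAdd (GVar (Suc (Suc m))) (GVar (Suc j))) (GVar (Suc i)))
    (VLe (VVal (GVar (Suc (Suc m)))) (VVal (GVar 0))))" for i j
  define \<psi> where "\<psi> = Conj (conjs (map (\<lambda>i. VLe (VVal (GVar 0)) (VVal (GVar (Suc i)))) [0..<Suc m]))
    (conjs (map (\<lambda>i. conjs (map (\<lambda>j. \<delta> i j) [0..<i])) [0..<Suc m]))"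
  define \<phi> where "\<phi> = Conj (Neg (VEq (VVal (GVar 0)) VInf)) (gexs (Suc m) \<psi>)"
  have \<delta>: "sat v e w (\<delta> i j) \<longleftrightarrow> v (e (Suc i) - e (Suc j)) \<le> v (e 0)" if "i \<le> m" "j \<le> m" for e w i j
  proof -
    have "z + e (Suc j) = e (Suc i) \<longleftrightarrow> z = e (Suc i) - e (Suc j)" for z by (auto simp: algebra_simps)
    then show ?thesis using that by (simp add: \<delta>_def)
  qed
  have \<psi>: "sat v e w \<psi> \<longleftrightarrow> (\<forall>i\<le>m. v (e 0) \<le> v (e (Suc i))) \<and>
      (\<forall>i\<le>m. \<forall>j<i. v (e (Suc i) - e (Suc j)) \<le> v (e 0))" for e w
    using \<delta> by (auto simp: \<psi>_def less_Suc_eq_le simp del: upt_Suc)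
  have "sat v (e(0 := x)) w \<phi> \<longleftrightarrow> Rrel v m (v x)" for e w x
  proof -
    have "sat v (e(0 := x)) w (gexs (Suc m) \<psi>) \<longleftrightarrow>
      (\<exists>f. (\<forall>i\<le>m. v x \<le> v (f (Suc i))) \<and> (\<forall>i\<le>m. \<forall>j<i. v (f (Suc i) - f (Suc j)) \<le> v x))"
      unfolding sat_gexs \<psi> by (intro ex_cong1) auto
    also have "\<dots> \<longleftrightarrow> (\<exists>f. (\<forall>i\<le>m. v x \<le> v (f i)) \<and> (\<forall>i\<le>m. \<forall>j<i. v (f i - f j) \<le> v x))" (is "?L \<longleftrightarrow> ?R")
    proof
      assume ?L
      then obtain f where "(\<forall>i\<le>m. v x \<le> v (f (Suc i))) \<and> (\<forall>i\<le>m. \<forall>j<i. v (f (Suc i) - f (Suc j)) \<le> v x)" by blast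
      then show ?R by (intro exI[of _ "\<lambda>i. f (Suc i)"])
    next
      assume ?R
      then obtain f where "(\<forall>i\<le>m. v x \<le> v (f i)) \<and> (\<forall>i\<le>m. \<forall>j<i. v (f i - f j) \<le> v x)" by blast
      then show ?L by (intro exI[of _ "\<lambda>i. f (i - 1)"]) simp
    qed
    finally show ?thesis by (simp add: \<phi>_def Rrel_iff_sequence)
  qed
  then show ?thesis unfolding definable_set_def by blast
qed

end

section \<open>Consequences of minimality\<close>

text \<open>The complement of a proper subgroup contains a coset of it. If the complement is finite,
  so are the subgroup and the whole group.\<close>

lemma cofinite_additive_set:
  fixes H :: "'g::ab_group_add set"
  assumes "additive_set H" "finite (- H)" "infinite (UNIV :: 'g set)"
  shows "H = UNIV"
proof (rule ccontr)
  assume "H \<noteq> UNIV"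
  then obtain y where y: "y \<notin> H" by blast
  have "(+) y ` H \<subseteq> - H"
  proof
    fix z assume "z \<in> (+) y ` H"
    then obtain a where a: "a \<in> H" "z = y + a" by blast
    show "z \<in> - H"
    proof
      assume "z \<in> H"
      then have "z - a \<in> H" using additive_setD(2)[OF assms(1)] a(1) by blast
      then show False using a(2) y by simp
    qed
  qed
  then have "finite ((+) y ` H)" using assms(2) finite_subset by blast
  then have "finite H" by (rule finite_imageD) simp
  then show False using assms(2,3) by (metis Compl_partition finite_UnI)
qed

text \<open>Number each element by how many elements lie above it. This is injective and starts at 0
  at the maximum. There is no least element, since the set above it would be everything; so below
  each element there is a non-empty finite interval, whose maximum gets the next number.\<close>

lemma order_type_if_finite_up_sets:
  fixes a :: "'c::linorder"
  assumes fin: "\<And>\<gamma> :: 'c. finite {\<delta>. \<gamma> \<le> \<delta>}" and inf: "infinite (UNIV :: 'c set)"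
  obtains h :: "nat \<Rightarrow> 'c" where "bij h" "\<And>i j. h j \<le> h i \<longleftrightarrow> i \<le> j"
proof -
  define r where "r \<gamma> = card {\<delta>. \<gamma> < \<delta>}" for \<gamma> :: 'c
  have fin': "finite {\<delta>. \<gamma> < \<delta>}" for \<gamma> :: 'c
    by (rule finite_subset[OF _ fin[of \<gamma>]]) auto
  have less: "r \<delta> < r \<gamma>" if "\<gamma> < \<delta>" for \<gamma> \<delta>
    unfolding r_def by (rule psubset_card_mono[OF fin']) (use that in auto)
  have "inj r"
  proof (rule injI)
    fix \<gamma> \<delta> assume "r \<gamma> = r \<delta>"
    then show "\<gamma> = \<delta>" using less[of \<gamma> \<delta>] less[of \<delta> \<gamma>] by (cases \<gamma> \<delta> rule: linorder_cases) simp_all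
  qed
  have below: "\<exists>\<delta>. \<delta> < \<gamma>" for \<gamma> :: 'c
  proof (rule ccontr)
    assume "\<not> ?thesis"
    then have "(UNIV :: 'c set) = {\<delta>. \<gamma> \<le> \<delta>}" by (auto simp: not_less)
    then show False using inf fin[of \<gamma>] by simp
  qed
  have Suc: "\<exists>\<delta>. r \<delta> = Suc (r \<gamma>)" for \<gamma>
  proof -
    obtain \<delta> where \<delta>: "\<delta> < \<gamma>" using below by blast
    define A where "A = {\<epsilon>. \<delta> \<le> \<epsilon> \<and> \<epsilon> < \<gamma>}"
    have A: "finite A" "A \<noteq> {}" using \<delta> finite_subset[OF _ fin[of \<delta>], of A] by (auto simp: A_def)
    define \<mu> where "\<mu> = Max A"
    have \<mu>: "\<mu> < \<gamma>" "\<delta> \<le> \<mu>" using Max_in[OF A] by (auto simp: \<mu>_def A_def)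
    have "{\<epsilon>. \<mu> < \<epsilon>} = insert \<gamma> {\<epsilon>. \<gamma> < \<epsilon>}"
    proof (rule subset_antisym; rule subsetI)
      fix \<epsilon> assume \<epsilon>: "\<epsilon> \<in> {\<epsilon>. \<mu> < \<epsilon>}"
      have "\<not> \<epsilon> < \<gamma>"
      proof
        assume "\<epsilon> < \<gamma>"
        then have "\<epsilon> \<in> A" using \<epsilon> \<mu>(2) by (simp add: A_def)
        then have "\<epsilon> \<le> \<mu>" using A(1) by (simp add: \<mu>_def)
        then show False using \<epsilon> by simp
      qed
      then show "\<epsilon> \<in> insert \<gamma> {\<epsilon>. \<gamma> < \<epsilon>}" by auto
    qed (use \<mu>(1) in auto)
    then have "r \<mu> = Suc (r \<gamma>)" using fin'[of \<gamma>] by (simp add: r_def)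
    then show ?thesis by blast
  qed
  obtain \<gamma>0 :: 'c where True by blast
  have "finite {\<delta>. \<gamma>0 \<le> \<delta>}" "{\<delta>. \<gamma>0 \<le> \<delta>} \<noteq> {}" using fin by auto
  then have mx: "Max {\<delta>. \<gamma>0 \<le> \<delta>} \<in> {\<delta>. \<gamma>0 \<le> \<delta>}" by (rule Max_in)
  have "{\<delta>. Max {\<delta>. \<gamma>0 \<le> \<delta>} < \<delta>} = {}"
  proof (rule ccontr)
    assume "\<not> ?thesis"
    then obtain \<delta> where \<delta>: "Max {\<delta>. \<gamma>0 \<le> \<delta>} < \<delta>" by blast
    then have "\<delta> \<in> {\<delta>. \<gamma>0 \<le> \<delta>}" using mx by auto
    then have "\<delta> \<le> Max {\<delta>. \<gamma>0 \<le> \<delta>}" using fin by (rule Max_ge[rotated])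
    then show False using \<delta> by simp
  qed
  then have zero: "r (Max {\<delta>. \<gamma>0 \<le> \<delta>}) = 0" by (simp add: r_def)
  have "\<exists>\<gamma>. r \<gamma> = n" for n
  proof (induction n)
    case 0
    show ?case using zero by blast
  next
    case (Suc n)
    then show ?case using \<open>\<And>\<gamma>. \<exists>\<delta>. r \<delta> = Suc (r \<gamma>)\<close> by metis
  qed
  then have "surj r" unfolding surj_def by metis
  then have "bij r" using \<open>inj r\<close> by (simp add: bij_def)
  define h where "h = inv_into UNIV r"
  have rh: "r (h n) = n" for n unfolding h_def by (rule surj_f_inv_f[OF \<open>surj r\<close>])
  have "bij h" unfolding h_def by (rule bij_imp_bij_inv[OF \<open>bij r\<close>])
  moreover have "h j \<le> h i \<longleftrightarrow> i \<le> j" for i j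
  proof -
    have lt: "h a < h b \<Longrightarrow> b < a" for a b using less[of "h a" "h b"] rh by simp
    show ?thesis
    proof
      assume "h j \<le> h i"
      then consider "h j < h i" | "h j = h i" unfolding le_less by (elim disjE)
      then show "i \<le> j"
      proof cases
        case 1 then show ?thesis using lt by (simp add: less_imp_le)
      next
        case 2
        then have "r (h j) = r (h i)" by (rule arg_cong)
        then show ?thesis by (simp add: rh)
      qed
    next
      assume "i \<le> j"
      then have "\<not> h i < h j" using lt[of i j] by linarith
      then show "h j \<le> h i" by (simp only: not_less)
    qed
  qed
  ultimately show thesis by (rule that)
qed

text \<open>Open balls are proper definable subgroups and hence finite. An infinite closed ball
  would be the whole group, and then every value would be \<gamma> itself or one of the finitely
  many values on the open ball, against the infinity of the value set.\<close>

lemma omega_valued_if_minimal: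
  fixes v :: "'g::ab_group_add \<Rightarrow> 'c::{linorder, order_top}"
  assumes v: "valued_abelian_group v" and inf: "infinite (UNIV :: 'c set)"
    and min: "minimal_valued_group v"
  obtains h where "omega_valued v h"
proof -
  interpret valued_abelian_group v by (rule v)
  have infG: "infinite (UNIV :: 'g set)" and dich: "\<And>S. definable_set v S \<Longrightarrow> finite S \<or> finite (- S)"
    using min by (auto simp: minimal_valued_group_def)
  have fin: "finite (Bcl v \<gamma>)" for \<gamma>
  proof (cases "\<gamma> = top")
    case True
    have "Bcl v \<gamma> = {0}" by (auto simp: Bcl_def True top_unique v_eq_top_iff)
    then show ?thesis by simp
  next
    case False
    obtain x where x: "v x = \<gamma>" using v_surj by (metis surjD)
    have "Bop v \<gamma> \<noteq> UNIV" using x by (auto simp: Bop_def)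
    then have "finite (Bop v \<gamma>)"
      using dich[OF definable_Bop] cofinite_additive_set[OF additive_set_Bop[OF False] _ infG] by blast
    then have "finite (insert \<gamma> (v ` Bop v \<gamma>))" by simp
    show ?thesis
    proof (rule ccontr)
      assume "infinite (Bcl v \<gamma>)"
      then have "finite (- Bcl v \<gamma>)" using dich[OF definable_Bcl] by blast
      then have all: "Bcl v \<gamma> = UNIV" by (rule cofinite_additive_set[OF additive_set_Bcl _ infG])
      have "UNIV \<subseteq> insert \<gamma> (v ` Bop v \<gamma>)"
      proof
        fix \<delta> :: 'c
        obtain y where y: "v y = \<delta>" using v_surj by (metis surjD)
        have "y \<in> Bcl v \<gamma>" using all by simp
        then show "\<delta> \<in> insert \<gamma> (v ` Bop v \<gamma>)" using y by (auto simp: Bcl_def Bop_def le_less)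
      qed
      then show False using \<open>finite (insert \<gamma> (v ` Bop v \<gamma>))\<close> inf finite_subset by blast
    qed
  qed
  have up: "finite {\<delta>. \<gamma> \<le> \<delta>}" for \<gamma> :: 'c
  proof -
    have "{\<delta>. \<gamma> \<le> \<delta>} \<subseteq> v ` Bcl v \<gamma>"
    proof
      fix \<delta> assume "\<delta> \<in> {\<delta>. \<gamma> \<le> \<delta>}"
      moreover obtain y where "\<delta> = v y" using v_surj by (metis surjD)
      ultimately show "\<delta> \<in> v ` Bcl v \<gamma>" by (auto simp: Bcl_def)
    qed
    then show ?thesis using fin finite_subset by blast
  qed
  obtain h :: "nat \<Rightarrow> 'c" where h: "bij h" "\<forall>i j. h j \<le> h i \<longleftrightarrow> i \<le> j"
    by (rule order_type_if_finite_up_sets[OF up inf]) blast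
  have "finite {x. v x = \<gamma>}" for \<gamma> by (rule finite_subset[OF _ fin[of \<gamma>]]) (auto simp: Bcl_def)
  then have "omega_valued v h" using h by unfold_locales blast+
  then show thesis by (rule that)
qed

text \<open>If m is the order of \<open>x\<close> and \<open>p\<close> a prime divisor of m, then (m
  / p) x has order \<open>p\<close>.\<close>

lemma torsion_prime:
  fixes x :: "'g::ab_group_add"
  assumes "n > 0" "nmult n x = 0" "x \<noteq> 0"
  obtains p y where "prime p" "p dvd n" "y \<noteq> (0 :: 'g)" "nmult p y = 0"
proof -
  define m where "m = (LEAST m. m > 0 \<and> nmult m x = 0)"
  have "m > 0 \<and> nmult m x = 0"
    unfolding m_def by (rule LeastI[where k = n]) (use assms in simp)
  then have m: "m > 0" "nmult m x = 0" by blast+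
  have least: "k = 0" if "k < m" "nmult k x = 0" for k
    using not_less_Least[of k "\<lambda>m. m > 0 \<and> nmult m x = 0"] that unfolding m_def by simp
  have "nmult (n mod m) x = 0"
  proof -
    have "nmult (n div m * m + n mod m) x = 0" using assms(2) by simp
    then show ?thesis by (simp only: nmult_add nmult_mult m(2) nmult_zero add_0_left)
  qed
  then have "n mod m = 0" using least[OF mod_less_divisor[OF m(1)]] by blast
  then have "m dvd n" by (simp only: dvd_eq_mod_eq_0)
  have "m \<noteq> 1"
  proof
    assume "m = 1"
    then show False using m(2) assms(3) by simp
  qed
  from prime_factor_nat[OF this] obtain p where p: "prime p" "p dvd m" by (elim exE conjE)
  obtain k where k: "m = p * k" using p(2) by (rule dvdE)
  have "k \<noteq> 0" using k m(1) by (cases k) simp_all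
  then have "k < m" using k prime_gt_1_nat[OF p(1)] by simp
  then have "nmult k x \<noteq> 0" using least[of k] \<open>k \<noteq> 0\<close> by blast
  moreover have "nmult p (nmult k x) = 0" using m(2) by (simp add: k nmult_mult)
  moreover have "p dvd n" using p(2) \<open>m dvd n\<close> by (rule dvd_trans)
  ultimately show thesis using that p(1) by blast
qed

text \<open>Dividing \<open>y\<close> by \<open>p\<close> again and again yields elements of orders
  p, p^2, p^3, ..., hence pairwise distinct ones.\<close>

lemma divisible_chain:
  fixes y :: "'g::ab_group_add"
  assumes d: "\<And>x :: 'g. \<exists>z. nmult p z = x" and y: "y \<noteq> 0" "nmult p y = 0"
  obtains c :: "nat \<Rightarrow> 'g" where "c 0 = y" "\<And>n. nmult p (c (Suc n)) = c n" "\<And>n. nmult (p ^ Suc n) (c n) = 0" "inj c"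
proof -
  have "\<exists>c :: nat \<Rightarrow> 'g. \<forall>n. (n = 0 \<longrightarrow> c n = y) \<and> nmult p (c (Suc n)) = c n"
  proof (rule dependent_nat_choice)
    show "\<exists>z. 0 = (0 :: nat) \<longrightarrow> z = y" by blast
    show "\<exists>z. (Suc n = 0 \<longrightarrow> z = y) \<and> nmult p z = x" for x n using d by simp
  qed
  then obtain c :: "nat \<Rightarrow> 'g" where c0: "c 0 = y" and cS: "\<And>n. nmult p (c (Suc n)) = c n" by auto
  have down: "nmult (p ^ k) (c (n + k)) = c n" for n k
  proof (induction k)
    case (Suc k)
    have "nmult (p ^ k) (nmult p (c (Suc (n + k)))) = c n" using Suc cS by simp
    then show ?case by (simp add: nmult_mult[symmetric] mult.commute)
  qed simp
  have ord: "nmult (p ^ Suc n) (c n) = 0" for n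
    using down[of n 0] y(2) c0 by (simp add: nmult_mult)
  \<comment> \<open>Multiplication by p^(n + k + 1) kills \<open>c n\<close> but sends
    \<open>c (n + Suc k)\<close> to \<open>y\<close>.\<close>
  have ne: "c n \<noteq> c (n + Suc k)" for n k
  proof
    assume eq: "c n = c (n + Suc k)"
    have e: "p ^ (n + Suc k) = p ^ k * p ^ Suc n" by (simp add: power_add)
    have "nmult (p ^ (n + Suc k)) (c n) = 0" by (simp only: e nmult_mult[of _ "p ^ Suc n"] ord nmult_zero)
    then have "nmult (p ^ (n + Suc k)) (c (n + Suc k)) = 0" by (subst eq[symmetric])
    then have "y = 0" using down[of "n + Suc k" 0] c0 by (simp only: add_0_left)
    then show False using y(1) by simp
  qed
  have "inj c"
  proof (rule injI, rule ccontr)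
    fix i j assume *: "c i = c j" "i \<noteq> j"
    then consider k where "j = i + Suc k" | k where "i = j + Suc k"
      by (metis less_imp_Suc_add linorder_neqE_nat add_Suc_right)
    then show False using ne * by cases metis+
  qed
  then show thesis using that c0 cS ord by blast
qed

section \<open>Torsion, divisibility and the prime of a minimal group\<close>

locale minimal_omega_valued = omega_valued v h
  for v :: "'g::ab_group_add \<Rightarrow> 'c::{linorder, order_top}" and h +
  assumes dichotomy: "definable_set v S \<Longrightarrow> finite S \<or> finite (- S)"
begin

text \<open>The multiples of \<open>x\<close> stay in one finite ball, so two of them
  coincide.\<close>

lemma torsion: "\<exists>n>0. nmult n (x :: 'g) = 0"
proof -
  have "range (\<lambda>n. nmult n x) \<subseteq> {y. rk y \<le> rk x}" using rk_nmult by auto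
  then have "finite (range (\<lambda>n. nmult n x))" using finite_rk finite_subset by blast
  then have "\<not> inj (\<lambda>n. nmult n x)" using range_inj_infinite by blast
  then obtain i j where ij: "i < j" "nmult i x = nmult j x"
    by (metis (mono_tags, lifting) injI linorder_neqE_nat)
  have "nmult j x = nmult (j - i) x + nmult i x" using ij(1) nmult_add[of "j - i" i x] by simp
  then have "nmult (j - i) x = 0" using ij(2) by simp
  then show ?thesis using ij(1) by (intro exI[of _ "j - i"]) simp
qed

lemma bounded_rk:
  assumes "finite S"
  obtains N where "\<And>x. x \<in> S \<Longrightarrow> rk x \<le> int N"
proof
  have "finite (rk ` S)" using assms by simp
  then show "rk x \<le> int (nat (Max (insert 0 (rk ` S))))" if "x \<in> S" for x
    using that by (simp add: max_def)
qed

lemma Rrel_dichotomy: "finite {\<gamma>. Rrel v m \<gamma>} \<or> finite {\<gamma>. \<not> Rrel v m \<gamma>}"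
proof -
  have img: "{\<gamma>. P \<gamma>} \<subseteq> v ` {x. P (v x)}" for P
  proof
    fix \<gamma> assume "\<gamma> \<in> {\<gamma>. P \<gamma>}"
    moreover obtain x where "\<gamma> = v x" using v_surj by (metis surjD)
    ultimately show "\<gamma> \<in> v ` {x. P (v x)}" by simp
  qed
  have "finite {x. Rrel v m (v x)} \<or> finite {x. \<not> Rrel v m (v x)}"
    using dichotomy[OF definable_Rrel[of m]] by (simp add: Collect_neg_eq)
  then show ?thesis using img[of "Rrel v m"] img[of "\<lambda>\<gamma>. \<not> Rrel v m \<gamma>"] finite_surj by blast
qed

text \<open>Each of the two relations that delimit a layer holds finitely or co-finitely often;
  hence a layer that occurs infinitely often occurs co-finitely.\<close>

lemma elementary_layers:
  "(\<exists>n0. finite {\<gamma>. \<not> (layer v p n0 \<gamma>)}) \<or>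
   (\<forall>n. finite {\<gamma>. layer v p n \<gamma>})"
  for p :: nat
proof (rule ccontr, unfold de_Morgan_disj, elim conjE)
  assume "\<not> (\<forall>n. finite {\<gamma>. layer v p n \<gamma>})"
    and no: "\<nexists>n0. finite {\<gamma>. \<not> (layer v p n0 \<gamma>)}"
  then obtain n where n: "infinite {\<gamma>. layer v p n \<gamma>}" by blast
  have "infinite {\<gamma>. Rrel v (p ^ n) \<gamma>}" "infinite {\<gamma>. \<not> Rrel v (p ^ (n + 1)) \<gamma>}"
    using n by (auto elim!: contrapos_nn intro: finite_subset[rotated])
  then have "finite ({\<gamma>. \<not> Rrel v (p ^ n) \<gamma>} \<union> {\<gamma>. Rrel v (p ^ (n + 1)) \<gamma>})"
    using Rrel_dichotomy by blast
  then have "finite {\<gamma>. \<not> (layer v p n \<gamma>)}"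
    by (rule finite_subset[rotated]) auto
  then show False using no by blast
qed

lemma kernel_finite_or_UNIV: "finite {x :: 'g. nmult n x = 0} \<or> (\<forall>x :: 'g. nmult n x = 0)"
proof -
  have "\<forall>x :: 'g. nmult n x = 0" if "finite (- {x :: 'g. nmult n x = 0})"
  proof -
    have "{x :: 'g. nmult n x = 0} = UNIV"
      by (rule cofinite_additive_set[OF additive_set_kernel that infinite_UNIV])
    then show ?thesis by (simp add: set_eq_iff)
  qed
  then show ?thesis using dichotomy[OF definable_kernel[of v n]] by blast
qed

text \<open>A finite kernel makes all fibres finite, so the image is infinite; an infinite definable
  subgroup is co-finite and therefore everything.\<close>

lemma divisible_if_finite_kernel:
  assumes "finite {x :: 'g. nmult n x = 0}"
  shows "\<exists>z. nmult n z = (x :: 'g)"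
proof -
  let ?D = "range (nmult n) :: 'g set"
  have "infinite ?D"
  proof
    assume fin: "finite ?D"
    have "finite {x. nmult n x = b}" for b :: 'g
    proof (cases "\<exists>a. nmult n a = b")
      case True
      then obtain a where "nmult n a = b" by blast
      then have "{x. nmult n x = b} \<subseteq> (\<lambda>x. x + a) ` {x. nmult n x = 0}"
        by (auto simp: nmult_minus intro!: image_eqI[of _ _ "_ - a"])
      then show ?thesis using assms finite_subset by blast
    qed auto
    then have "finite (\<Union>b\<in>?D. {x. nmult n x = b})" using fin by blast
    moreover have "(\<Union>b\<in>?D. {x. nmult n x = b}) = UNIV" by auto
    ultimately show False using infinite_UNIV by simp
  qed
  then have "finite (- ?D)" using dichotomy[OF definable_range] by blast
  moreover have "additive_set ?D"
    unfolding additive_set_def by (auto simp: nmult_minus[symmetric] intro: range_eqI[of _ _ 0])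
  ultimately have "?D = UNIV" using cofinite_additive_set infinite_UNIV by blast
  then show ?thesis by (metis rangeE UNIV_I)
qed

lemma finite_fixed:
  assumes d: "\<And>x :: 'g. \<exists>z. nmult p z = x" and y: "y \<noteq> 0" "nmult p y = (0 :: 'g)"
  shows "finite {x. v (nmult p x) = v x}"
proof (rule ccontr)
  let ?T = "{x. v (nmult p x) = v x}"
  assume "infinite ?T"
  then have fin: "finite (- ?T)" using dichotomy[OF definable_fixed] by blast
  obtain c where c: "c 0 = y" "\<And>n. nmult p (c (Suc n)) = c n" "inj c" using divisible_chain[OF d y] by metis
  obtain N where N: "\<And>x. x \<in> insert y (- ?T) \<Longrightarrow> rk x \<le> int N" using bounded_rk[of "insert y (- ?T)"] fin by auto
  \<comment> \<open>A division that ends inside \<open>?T\<close> keeps the rank, and outside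
    \<open>?T\<close> ranks are at most \<open>N\<close>. So the infinite chain would lie in a
    finite ball.\<close>
  have "rk (c n) \<le> int N" for n
  proof (induction n)
    case 0
    show ?case using N[of y] c(1) by simp
  next
    case (Suc n)
    show ?case
    proof (cases "c (Suc n) \<in> ?T")
      case True
      then have "rk (c (Suc n)) = rk (c n)" using c(2) by (simp add: rk_def)
      then show ?thesis using Suc by simp
    next
      case False
      then show ?thesis using N by simp
    qed
  qed
  then have "range c \<subseteq> {x. rk x \<le> int N}" by auto
  then show False using finite_rk finite_subset range_inj_infinite[OF c(3)] by blast
qed

lemma unique_prime:
  assumes d: "\<And>p x. prime p \<Longrightarrow> \<exists>z. nmult p z = (x :: 'g)"
  obtains p where "prime p" "primary p (UNIV :: 'g set)" "finite {x. v (nmult p x) = v x}"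
proof -
  obtain x :: 'g where "x \<noteq> 0" using infinite_UNIV by (metis (full_types) UNIV_eq_I finite.simps insert_iff)
  then obtain p y where p: "prime p" and y: "y \<noteq> (0 :: 'g)" "nmult p y = 0"
    using torsion[of x] torsion_prime by metis
  have T: "finite {x. v (nmult p x) = v x}" by (rule finite_fixed[OF d[OF p] y])
  have only: "q = p" if q: "prime q" "y' \<noteq> 0" "nmult q y' = 0" for q and y' :: 'g
  proof (rule ccontr)
    assume "q \<noteq> p"
    obtain c where c: "\<And>n. nmult (q ^ Suc n) (c n) = (0 :: 'g)" "inj c"
      using divisible_chain[OF d[OF q(1)] q(2,3)] by metis
    have "coprime p (q ^ Suc n)" for n
      using primes_coprime[OF p q(1)] \<open>q \<noteq> p\<close> by (auto simp del: power_Suc)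
    then have "rk (nmult p (c n)) = rk (c n)" for n by (rule rk_nmult_eq[OF c(1)])
    then have "v (nmult p (c n)) = v (c n)" for n using v_eq by metis
    then have "range c \<subseteq> {x. v (nmult p x) = v x}" by auto
    then show False using T finite_subset range_inj_infinite[OF c(2)] by blast
  qed
  have "primary p (UNIV :: 'g set)" unfolding primary_def
  proof
    fix x :: 'g
    obtain n where n: "n > 0" "nmult n x = 0" using torsion by blast
    obtain a m where am: "\<not> p dvd m" "n = m * p ^ a" using prime_power_canonical[OF p n(1)] by blast
    \<comment> \<open>Otherwise this nonzero element, killed by \<open>m\<close>, would give rise to
      torsion for a prime divisor of \<open>m\<close>, which \<open>only\<close> identifies with
      \<open>p\<close>.\<close>
    have "nmult (p ^ a) x = 0"
    proof (rule ccontr)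
      assume ne: "nmult (p ^ a) x \<noteq> 0"
      have "nmult m (nmult (p ^ a) x) = 0" "m > 0" using n am(2) by (auto simp: nmult_mult)
      then obtain q z where "prime q" "q dvd m" "z \<noteq> (0 :: 'g)" "nmult q z = 0"
        using torsion_prime[OF _ _ ne] by metis
      then show False using only am(1) by blast
    qed
    then show "\<exists>k. nmult (p ^ k) x = 0" by blast
  qed
  then show thesis using that p T by blast
qed

end

section \<open>Growth of balls and chains of values\<close>

context omega_valued
begin

definition ball :: "nat \<Rightarrow> 'g set" where
  "ball n = {x. rk x \<le> int n}"

lemma finite_ball: "finite (ball n)"
  unfolding ball_def by (rule finite_rk)

lemma additive_set_ball: "additive_set (ball n)"
  unfolding additive_set_def ball_def
proof (intro conjI ballI)
  show "0 \<in> {x. rk x \<le> int n}" by simp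
  fix x y assume "x \<in> {x. rk x \<le> int n}" "y \<in> {x. rk x \<le> int n}"
  then show "x - y \<in> {x. rk x \<le> int n}" using rk_diff[of x y] by simp
qed

text \<open>Every rank is attained, and the coset of the ball by an element of the next rank is
  disjoint from the ball.\<close>

lemma card_ball_Suc: "2 * card (ball n) \<le> card (ball (Suc n))"
proof -
  obtain y where y: "rk y = int (Suc n)" using ex_rk by blast
  have sub: "ball n \<union> (+) y ` ball n \<subseteq> ball (Suc n)"
  proof
    fix x assume "x \<in> ball n \<union> (+) y ` ball n"
    then consider "x \<in> ball n" | z where "z \<in> ball n" "x = y + z" by (elim UnE imageE)
    then show "x \<in> ball (Suc n)"
    proof cases
      case (2 z)
      then show ?thesis using rk_add[of y z] y by (simp add: ball_def)
    qed (simp add: ball_def)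
  qed
  have disj: "ball n \<inter> (+) y ` ball n = {}"
  proof -
    have "y + z \<notin> ball n" if "z \<in> ball n" for z
      using that y rk_diff[of "y + z" z] by (auto simp: ball_def)
    then show ?thesis by blast
  qed
  have "card ((+) y ` ball n) = card (ball n)" by (simp add: card_image)
  then have "2 * card (ball n) = card (ball n \<union> (+) y ` ball n)"
    using finite_ball disj by (simp add: card_Un_disjoint)
  also have "\<dots> \<le> card (ball (Suc n))" by (rule card_mono[OF finite_ball sub])
  finally show ?thesis .
qed

lemma card_ball_add: "2 ^ m * card (ball n) \<le> card (ball (n + m))"
proof (induction m)
  case (Suc m)
  then show ?case using card_ball_Suc[of "n + m"] by simp
qed simp

lemma card_ball_pos: "0 < card (ball n)"
  using additive_setD(1)[OF additive_set_ball] finite_ball by (auto simp: card_gt_0_iff)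

text \<open>Each step of the chain costs at least one rank; conversely, all ranks in between are
  attained because \<open>v\<close> is surjective.\<close>

lemma chain_iff:
  "(\<exists>f. f 0 = x \<and> (\<forall>i<l. v (f i) < v (f (Suc i))) \<and> v (f l) \<le> v y) \<longleftrightarrow> rk y + int l \<le> rk x"
proof
  have vrk: "v a < v b \<longleftrightarrow> rk b < rk a" and vle: "v a \<le> v b \<longleftrightarrow> rk b \<le> rk a" for a b
    using v_le_h_iff[of b "nat (rk a)"] v_le_h_iff[of a "nat (rk b)"] v_eq[of a] v_eq[of b]
      rk_nonneg[of a] rk_nonneg[of b] by (simp_all add: not_le[symmetric])
  {
    assume "\<exists>f. f 0 = x \<and> (\<forall>i<l. v (f i) < v (f (Suc i))) \<and> v (f l) \<le> v y"
    then obtain f where f: "f 0 = x" "\<And>i. i < l \<Longrightarrow> rk (f (Suc i)) < rk (f i)" "rk y \<le> rk (f l)"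
      unfolding vrk vle by (elim exE conjE) simp
    have "rk (f i) + int i \<le> rk x" if "i \<le> l" for i
      using that
    proof (induction i)
      case 0
      then show ?case by (simp add: f(1))
    next
      case (Suc i)
      then show ?case using f(2)[of i] by simp
    qed
    from this[of l] show "rk y + int l \<le> rk x" using f(3) by simp
  next
    assume le: "rk y + int l \<le> rk x"
    \<comment> \<open>The chain has to start at \<open>x\<close> itself and not just at its rank,
      hence the extra clause for i = 0.\<close>
    have "\<exists>z. rk z = rk x - int i \<and> (i = 0 \<longrightarrow> z = x)" if "i \<le> l" for i
    proof (cases "i = 0")
      case False
      have "int (nat (rk x - int i)) = rk x - int i" using le that rk_nonneg[of y] by simp
      then show ?thesis using ex_rk[of "nat (rk x - int i)"] False by simp
    qed auto
    then have "\<forall>i. \<exists>z. i \<le> l \<longrightarrow> rk z = rk x - int i \<and> (i = 0 \<longrightarrow> z = x)" by blast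
    from choice[OF this] obtain f where f: "\<And>i. i \<le> l \<Longrightarrow> rk (f i) = rk x - int i" "f 0 = x" by blast
    show "\<exists>f. f 0 = x \<and> (\<forall>i<l. v (f i) < v (f (Suc i))) \<and> v (f l) \<le> v y"
      unfolding vrk vle by (rule exI[of _ f]) (use f le in simp)
  }
qed

end

section \<open>Multiplication by p on large ranks\<close>

context minimal_omega_valued
begin

lemma drop_dichotomy:
  "(\<exists>N. \<forall>x. int N \<le> rk x \<longrightarrow> rk (nmult p x) + int l \<le> rk x) \<or>
   (\<exists>N. \<forall>x. int N \<le> rk x \<longrightarrow> rk x < rk (nmult p x) + int l)"
proof -
  define F where "F = {x. rk (nmult p x) + int l \<le> rk x}"
  have "definable_set v F" unfolding F_def using definable_chain[of v l p] by (simp only: chain_iff)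
  then have "finite F \<or> finite (- F)" by (rule dichotomy)
  then show ?thesis
  proof
    assume "finite F"
    then obtain N where N: "\<And>x. x \<in> F \<Longrightarrow> rk x \<le> int N" using bounded_rk by blast
    have "rk x < rk (nmult p x) + int l" if "int (Suc N) \<le> rk x" for x
      using N[of x] that by (force simp: F_def)
    then show ?thesis by blast
  next
    assume "finite (- F)"
    then obtain N where N: "\<And>x. x \<in> - F \<Longrightarrow> rk x \<le> int N" using bounded_rk by blast
    have "rk (nmult p x) + int l \<le> rk x" if "int (Suc N) \<le> rk x" for x
      using N[of x] that by (force simp: F_def)
    then show ?thesis by blast
  qed
qed

text \<open>A drop of more than \<open>log\<^sub>2\<close> of the kernel size is impossible, since the balls at least double
  from one rank to the next while the fibres of multiplication by \<open>p\<close> have bounded size.\<close>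

lemma drop_bounded:
  assumes fin: "finite {x :: 'g. nmult p x = 0}"
  shows "\<exists>l. \<not> (\<exists>N. \<forall>x. int N \<le> rk x \<longrightarrow> rk (nmult p x) + int l \<le> rk x)"
proof (rule ccontr)
  \<comment> \<open>\<open>K\<close> also serves as the supposed drop: the count then gives 2 ^ K
    \<le> K.\<close>
  define K where "K = card {x :: 'g. nmult p x = 0}"
  assume "\<not> ?thesis"
  then obtain N where N: "\<And>x. int N \<le> rk x \<Longrightarrow> rk (nmult p x) + int K \<le> rk x" by blast
  define B where "B = ball (N + K)"
  have "nmult p ` B \<subseteq> ball N"
  proof
    fix y assume "y \<in> nmult p ` B"
    then obtain x where x: "rk x \<le> int (N + K)" "y = nmult p x" by (auto simp: B_def ball_def)
    show "y \<in> ball N"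
    proof (cases "int N \<le> rk x")
      case True
      then show ?thesis using N[of x] x by (simp add: ball_def)
    next
      case False
      then show ?thesis using rk_nmult[of p x] x by (simp add: ball_def)
    qed
  qed
  then have 1: "card (nmult p ` B) \<le> card (ball N)" by (rule card_mono[OF finite_ball])
  have 2: "card {x \<in> B. nmult p x = 0} \<le> K" unfolding K_def by (rule card_mono[OF fin]) auto
  have "2 ^ K * card (ball N) \<le> card B" unfolding B_def by (rule card_ball_add)
  also have "card B = card (nmult p ` B) * card {x \<in> B. nmult p x = 0}"
    unfolding B_def by (rule card_image_times_kernel[OF additive_set_ball finite_ball nmult_minus])
  also have "\<dots> \<le> card (ball N) * K" by (rule mult_le_mono[OF 1 2])
  finally have "2 ^ K \<le> K" using card_ball_pos[of N] by (simp add: mult.commute)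
  then show False using less_exp[of K] by simp
qed

text \<open>Let \<open>l\<close> be the last drop before the first that fails to hold eventually. A
  drop by one more not only fails infinitely often but, by the dichotomy, is eventually never
  reached; so the drop is exactly \<open>l\<close>.\<close>

lemma shift_exists:
  assumes fin: "finite {x :: 'g. nmult p x = 0}"
  obtains N l where "\<And>x. int N \<le> rk x \<Longrightarrow> rk (nmult p x) = rk x - int l"
proof -
  define P where "P l \<longleftrightarrow> (\<exists>N. \<forall>x. int N \<le> rk x \<longrightarrow> rk (nmult p x) + int l \<le> rk x)" for l
  define l1 where "l1 = (LEAST l. \<not> P l)"
  have "\<exists>l. \<not> P l" using drop_bounded[OF fin] by (simp only: P_def)
  then have l1: "\<not> P l1" unfolding l1_def by (rule LeastI_ex)
  have "P 0" unfolding P_def using rk_nmult by simp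
  then have "l1 \<noteq> 0" using l1 by (cases l1) simp_all
  then obtain l where l: "l1 = Suc l" using not0_implies_Suc by blast
  have "P l" using not_less_Least[of l "\<lambda>l. \<not> P l"] l by (simp add: l1_def[symmetric])
  then obtain N where N: "\<And>x. int N \<le> rk x \<Longrightarrow> rk (nmult p x) + int l \<le> rk x" unfolding P_def by blast
  have "\<exists>N. \<forall>x. int N \<le> rk x \<longrightarrow> rk x < rk (nmult p x) + int l1"
    using l1 drop_dichotomy[of p l1] unfolding P_def by blast
  then obtain M where M: "\<And>x. int M \<le> rk x \<Longrightarrow> rk x < rk (nmult p x) + int l1" by blast
  have "rk (nmult p x) = rk x - int l" if "int (N + M) \<le> rk x" for x
    using N[of x] M[of x] that by (simp add: l)
  then show thesis by (rule that)
qed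

text \<open>As \<open>p\<close> maps the closed ball into the open one, the index of the open ball
  is at most that of the image of the closed ball, which is the size of a part of the
  kernel.\<close>

lemma Rrel_bounded:
  assumes fin: "finite {x :: 'g. nmult p x = 0}"
    and N: "\<And>x. int N \<le> rk x \<Longrightarrow> rk (nmult p x) < rk x"
  shows "\<exists>N. \<forall>n\<ge>N. \<not> Rrel v (card {x :: 'g. nmult p x = 0}) (h n)"
proof (intro exI allI impI)
  let ?K = "card {x :: 'g. nmult p x = 0}"
  fix n assume n: "Suc N \<le> n"
  then have nt: "h n \<noteq> top" by (simp add: h_eq_top_iff)
  have cl: "Bcl v (h n) = {x. rk x \<le> int n}" by (simp add: Bcl_def h_le_v_iff)
  have op: "Bop v (h n) = {x. rk x < int n}" by (simp add: Bop_def not_le[symmetric] v_le_h_iff)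
  have img: "nmult p ` Bcl v (h n) \<subseteq> Bop v (h n)"
  proof
    fix y assume "y \<in> nmult p ` Bcl v (h n)"
    then obtain x where x: "rk x \<le> int n" "y = nmult p x" unfolding cl by auto
    show "y \<in> Bop v (h n)"
    proof (cases "rk x = int n")
      case True
      then show ?thesis using N[of x] n x(2) by (simp add: op)
    next
      case False
      then show ?thesis using rk_nmult[of p x] x by (simp add: op)
    qed
  qed
  have finO: "finite (Bop v (h n))"
    by (rule finite_subset[OF _ finite_Bcl[of n]]) (auto simp: cl op)
  have "0 \<in> Bop v (h n)" using additive_setD(1)[OF additive_set_Bop[OF nt]] .
  then have pos: "0 < card (Bop v (h n))" using finO by (auto simp: card_gt_0_iff)
  have 1: "card (nmult p ` Bcl v (h n)) \<le> card (Bop v (h n))" by (rule card_mono[OF finO img])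
  have 2: "card {x \<in> Bcl v (h n). nmult p x = 0} \<le> ?K" by (rule card_mono[OF fin]) auto
  have "card (ball_quotient v (h n)) * card (Bop v (h n)) = card (Bcl v (h n))"
    using card_ball_quotient[OF nt finite_Bcl] by simp
  also have "\<dots> = card (nmult p ` Bcl v (h n)) * card {x \<in> Bcl v (h n). nmult p x = 0}"
    by (rule card_image_times_kernel[OF additive_set_Bcl finite_Bcl nmult_minus])
  also have "\<dots> \<le> card (Bop v (h n)) * ?K" by (rule mult_le_mono[OF 1 2])
  finally have "card (ball_quotient v (h n)) \<le> ?K" using pos by (simp add: mult.commute)
  moreover have "finite (ball_quotient v (h n))" using finite_Bcl by (simp add: ball_quotient_def)
  ultimately show "\<not> Rrel v ?K (h n)" by (simp add: Rrel_def)
qed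

lemma infinite_values: "infinite (UNIV :: 'c set)"
proof -
  have "infinite (range h)" using bij_is_inj[OF bij_h] by (rule range_inj_infinite)
  then show ?thesis by (rule infinite_super[rotated]) simp
qed

text \<open>Take \<open>n0\<close> just below the first exponent whose relation is not co-finite; by
  the dichotomy that relation is then finite. Such an exponent exists because of the bound
  \<open>K\<close>, and it is not 0 because of \<open>Rrel_1\<close>.\<close>

lemma Rrel_stable:
  assumes p: "prime p" and bd: "\<exists>N. \<forall>n\<ge>N. \<not> Rrel v K (h n)"
  shows "\<exists>n0. finite {\<gamma>. \<not> (layer v p n0 \<gamma>)}"
proof -
  define P where "P k \<longleftrightarrow> finite {\<gamma>. \<not> Rrel v (p ^ k) \<gamma>}" for k
  have "\<not> P K"
  proof
    assume "P K"
    moreover have "K \<le> p ^ K" using prime_gt_1_nat[OF p] by (simp add: less_imp_le power_gt_expt)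
    then have "{\<gamma>. Rrel v (p ^ K) \<gamma>} \<subseteq> {\<gamma>. Rrel v K \<gamma>}" using Rrel_mono by blast
    then have "finite {\<gamma>. Rrel v (p ^ K) \<gamma>}"
      using bd finite_values_iff[of "Rrel v K"] finite_subset by blast
    ultimately have "finite ({\<gamma>. Rrel v (p ^ K) \<gamma>} \<union> {\<gamma>. \<not> Rrel v (p ^ K) \<gamma>})" unfolding P_def by simp
    moreover have "{\<gamma>. Rrel v (p ^ K) \<gamma>} \<union> {\<gamma>. \<not> Rrel v (p ^ K) \<gamma>} = UNIV" by blast
    ultimately show False using infinite_values by simp
  qed
  define k where "k = (LEAST k. \<not> P k)"
  have k: "\<not> P k" unfolding k_def by (rule LeastI[where k = K]) fact
  have "{\<gamma>. \<not> Rrel v (p ^ 0) \<gamma>} \<subseteq> {top}" using Rrel_1 by auto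
  then have "P 0" unfolding P_def by (rule finite_subset) simp
  then have "k \<noteq> 0" using k by (cases k) simp_all
  then obtain n0 where n0: "k = Suc n0" using not0_implies_Suc by blast
  have "P n0" using not_less_Least[of n0 "\<lambda>k. \<not> P k"] n0 by (simp add: k_def[symmetric])
  moreover have "finite {\<gamma>. Rrel v (p ^ (n0 + 1)) \<gamma>}"
    using k Rrel_dichotomy[of "p ^ k"] n0 by (simp add: P_def)
  ultimately have "finite ({\<gamma>. \<not> Rrel v (p ^ n0) \<gamma>} \<union> {\<gamma>. Rrel v (p ^ (n0 + 1)) \<gamma>})"
    unfolding P_def by (rule finite_UnI)
  then have "finite {\<gamma>. \<not> (layer v p n0 \<gamma>)}"
    by (rule finite_subset[rotated]) blast
  then show ?thesis by blast
qed

text \<open>An isomorphism on one initial segment has to respect all the relations at once, so the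
  threshold must not depend on \<open>m\<close>. Only the relations with m < K matter, since the
  others are eventually false.\<close>

lemma Rrel_uniform:
  assumes bd: "\<exists>N. \<forall>n\<ge>N. \<not> Rrel v K (h n)"
  shows "\<exists>N. \<forall>m. \<forall>i\<ge>N. \<forall>j\<ge>N. Rrel v m (h i) \<longleftrightarrow> Rrel v m (h j)"
proof -
  have "\<exists>N. \<forall>i\<ge>N. \<forall>j\<ge>N. Rrel v m (h i) \<longleftrightarrow> Rrel v m (h j)" for m
    using Rrel_dichotomy[of m] unfolding finite_values_iff by (elim disjE exE) blast+
  then have "\<forall>m. \<exists>N. \<forall>i\<ge>N. \<forall>j\<ge>N. Rrel v m (h i) \<longleftrightarrow> Rrel v m (h j)" by blast
  from choice[OF this] obtain f
    where f: "\<And>m i j. f m \<le> i \<Longrightarrow> f m \<le> j \<Longrightarrow> Rrel v m (h i) \<longleftrightarrow> Rrel v m (h j)" by blast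
  obtain M where M: "\<And>n. M \<le> n \<Longrightarrow> \<not> Rrel v K (h n)" using bd by blast
  define N where "N = M + (\<Sum>m<K. f m)"
  have "Rrel v m (h i) \<longleftrightarrow> Rrel v m (h j)" if ij: "N \<le> i" "N \<le> j" for m i j
  proof (cases "m < K")
    case True
    then have "f m \<le> (\<Sum>m<K. f m)" by (intro member_le_sum) auto
    then show ?thesis using f[of m i j] ij by (simp add: N_def)
  next
    case False
    have "\<not> Rrel v m (h n)" if "N \<le> n" for n
      using M[of n] Rrel_mono[of m "h n" K] False that by (auto simp: N_def)
    then show ?thesis using ij by blast
  qed
  then show ?thesis by blast
qed

end

section \<open>The right shift as an isomorphism of the value structure\<close>

context omega_valued
begin

text \<open>The factor \<open>m\<close> preserves ranks. Multiplication never raises the rank, so if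
  the result has rank at least \<open>N\<close>, then so have all intermediate multiples, and each
  factor \<open>p\<close> acts as the shift.\<close>

lemma ffun_shift_iff:
  assumes p: "prime p" "primary p (UNIV :: 'g set)" and n: "\<not> p dvd m" "n = m * p ^ a"
    and N: "\<And>x. int N \<le> rk x \<Longrightarrow> rk (nmult p x) = rk x - int l" "0 < N"
    and ij: "N \<le> i" "N \<le> j"
  shows "ffun v n (h j) = h i \<longleftrightarrow> j = i + a * l"
proof -
  have rkn: "rk (nmult n x) = rk (nmult (p ^ a) x)" for x
    unfolding n(2) nmult_mult by (rule rk_nmult_coprime[OF p n(1)])
  obtain x where x: "rk x = int j" using ex_rk by blast
  have vx: "v x = h j" using x v_eq_h_iff by blast
  show ?thesis
  proof
    assume eq: "ffun v n (h j) = h i"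
    have "f_well_defined v n (h j)"
    proof (rule ccontr)
      assume "\<not> ?thesis"
      \<comment> \<open>Where it is not well-defined, \<open>ffun\<close> takes the default
        \<open>top\<close>, whose index 0 lies below \<open>N\<close>.\<close>
      then have "h i = top" using eq by (simp add: ffun_def)
      then show False using h_eq_top_iff N(2) ij by simp
    qed
    then have "v (nmult n x) = h i" using nmult_ffun[of v n x] vx eq by simp
    then have i: "rk (nmult (p ^ a) x) = int i" using v_eq_h_iff rkn by metis
    have "rk (nmult (p ^ b) x) = int j - int (b * l)" if "b \<le> a" for b
      using that
    proof (induction b)
      case 0
      then show ?case by (simp add: x)
    next
      case (Suc b)
      have "p ^ a = p ^ (a - b) * p ^ b" using Suc.prems by (simp add: power_add[symmetric])
      then have "rk (nmult (p ^ a) x) \<le> rk (nmult (p ^ b) x)" by (simp only: nmult_mult rk_nmult)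
      then have "int N \<le> rk (nmult (p ^ b) x)" using i ij by simp
      then show ?case using N(1)[of "nmult (p ^ b) x"] Suc by (simp add: nmult_mult)
    qed
    from this[of a] have "int j = int (i + a * l)" using i by simp
    then show "j = i + a * l" by (simp only: of_nat_eq_iff)
  next
    assume j: "j = i + a * l"
    have val: "v (nmult n y) = h i" if "v y = h j" for y
    proof -
      have "rk y = int j" using that v_eq_h_iff by blast
      then have "rk (nmult (p ^ a) y) = rk y - int (a * l)"
        using ij j by (intro shift_prime_power[OF N(1)]) simp_all
      then have "rk (nmult n y) = int i" using \<open>rk y = int j\<close> j by (simp add: rkn)
      then show ?thesis using v_eq_h_iff by blast
    qed
    then have "f_well_defined v n (v x)" unfolding f_well_defined_def vx by simp
    then show "ffun v n (h j) = h i" using nmult_ffun[of v n x] val[OF vx] vx by simp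
  qed
qed

lemma eventually_right_shiftI:
  assumes p: "prime p" "primary p (UNIV :: 'g set)"
    and shift: "\<And>x. int M \<le> rk x \<Longrightarrow> rk (nmult p x) = rk x - int l"
    and R: "\<And>m i j. M \<le> i \<Longrightarrow> M \<le> j \<Longrightarrow> Rrel v m (h i) \<longleftrightarrow> Rrel v m (h j)"
  shows "eventually_right_shift v p"
proof -
  define N where "N = Suc M"
  have N: "\<And>x. int N \<le> rk x \<Longrightarrow> rk (nmult p x) = rk x - int l" "0 < N"
    using shift by (simp_all add: N_def)
  \<comment> \<open>Starting at N + l keeps the shifted indices at \<open>N\<close> or more, where
    the shift law and the uniformity of the relations still apply.\<close>
  define I where "I = h ` {N + l..}"
  have wd: "f_well_defined v p (h j) \<and> ffun v p (h j) = h (j - l)" if "N + l \<le> j" for j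
  proof -
    have val: "v (nmult p x) = h (j - l)" if "v x = h j" for x
    proof -
      have "rk x = int j" using that v_eq_h_iff by blast
      then have "rk (nmult p x) = int (j - l)" using N(1)[of x] \<open>N + l \<le> j\<close> by (simp add: of_nat_diff)
      then show ?thesis using v_eq_h_iff by blast
    qed
    obtain x where x: "v x = h j" using v_surj by (metis surjD)
    have "f_well_defined v p (h j)" unfolding f_well_defined_def using val by simp
    then show ?thesis using nmult_ffun[of v p x] val[OF x] x by simp
  qed
  have down: "\<delta> \<in> I" if g: "\<gamma> \<in> I" and le: "\<delta> \<le> \<gamma>" for \<gamma> \<delta>
  proof -
    obtain j where j: "\<gamma> = h j" "N + l \<le> j" using g by (auto simp: I_def)
    obtain i where i: "\<delta> = h i" using ex_h by blast
    have "j \<le> i" using le h_le_iff unfolding i j(1) by blast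
    then show ?thesis unfolding I_def i using j(2) by simp
  qed
  have "- I \<subseteq> h ` {..<N + l}"
  proof
    fix \<gamma> assume g: "\<gamma> \<in> - I"
    obtain i where i: "\<gamma> = h i" using ex_h by blast
    then have "\<not> N + l \<le> i" using g by (auto simp: I_def)
    then show "\<gamma> \<in> h ` {..<N + l}" using i by simp
  qed
  then have fin: "finite (- I)" by (rule finite_subset) simp
  have succ: "(is_successor ^^ l) \<gamma> (ffun v p \<gamma>)" if g: "\<gamma> \<in> I" for \<gamma>
  proof -
    obtain j where j: "\<gamma> = h j" "N + l \<le> j" using g by (auto simp: I_def)
    then show ?thesis using wd[OF j(2)] by (simp add: successor_pow_h)
  qed
  have "Lv_isomorphism v I (ffun v p ` I) (ffun v p)"
    unfolding Lv_isomorphism_def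
  proof (intro conjI ballI allI impI)
    have mem: "\<exists>j. \<gamma> = h j \<and> N + l \<le> j" if "\<gamma> \<in> I" for \<gamma> using that by (auto simp: I_def)
    have "inj_on (ffun v p) I"
    proof (rule inj_onI)
      fix \<gamma> \<delta> assume "\<gamma> \<in> I" "\<delta> \<in> I" and eq: "ffun v p \<gamma> = ffun v p \<delta>"
      then obtain i j where ij: "\<gamma> = h i" "N + l \<le> i" "\<delta> = h j" "N + l \<le> j" using mem by meson
      then have "h (i - l) = h (j - l)" using eq wd by simp
      then show "\<gamma> = \<delta>" using ij by (simp add: h_eq_iff)
    qed
    then show "bij_betw (ffun v p) I (ffun v p ` I)" by (rule inj_on_imp_bij_betw)
    fix \<gamma> assume "\<gamma> \<in> I"
    then obtain j where j: "\<gamma> = h j" "N + l \<le> j" using mem by blast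
    show "Rrel v m \<gamma> \<longleftrightarrow> Rrel v m (ffun v p \<gamma>)" for m
    proof -
      have "M \<le> j" "M \<le> j - l" using j(2) by (simp_all add: N_def)
      then show ?thesis using R[of j "j - l" m] wd[OF j(2)] j(1) by simp
    qed
    fix \<delta> assume "\<delta> \<in> I"
    then obtain i where i: "\<delta> = h i" "N + l \<le> i" using mem by blast
    have sub: "N \<le> j - l" "N \<le> i - l" "N \<le> j" "N \<le> i" using i j by simp_all
    show "\<gamma> \<le> \<delta> \<longleftrightarrow> ffun v p \<gamma> \<le> ffun v p \<delta>"
      using wd[OF i(2)] wd[OF j(2)] i j by (simp add: h_le_iff) linarith
    fix n :: nat assume "1 \<le> n"
    then obtain a m where am: "\<not> p dvd m" "n = m * p ^ a" using prime_power_canonical[OF p(1), of n] by auto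
    have 1: "ffun v n (h j) = h i \<longleftrightarrow> j = i + a * l" by (rule ffun_shift_iff[OF p am N sub(4,3)])
    have 2: "ffun v n (h (j - l)) = h (i - l) \<longleftrightarrow> j - l = i - l + a * l"
      by (rule ffun_shift_iff[OF p am N sub(2,1)])
    have 3: "j = i + a * l \<longleftrightarrow> j - l = i - l + a * l" using i(2) j(2) by linarith
    show "ffun v n \<gamma> = \<delta> \<longleftrightarrow> ffun v n (ffun v p \<gamma>) = ffun v p \<delta>"
      using 1 2 3 wd[OF i(2)] wd[OF j(2)] i(1) j(1) by simp
  qed
  then show ?thesis unfolding eventually_right_shift_def using down fin wd succ
    by (intro exI[of _ I] conjI ballI allI impI exI[of _ l]) (auto simp: I_def)
qed

end

section \<open>Divisible primary groups of finite rank\<close>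

lemma additive_of_int:
  fixes f :: "rat \<Rightarrow> 'g::ab_group_add"
  assumes "\<And>r s. f (r + s) = f r + f s"
  shows "f (of_int a) = imult a (f 1)"
proof -
  obtain m n where a: "a = int m - int n" by (rule int_diff_cases)
  have nat: "f (of_nat m) = nmult m (f 1)" for m
    using additive_map(4)[of f m 1, OF assms] by (simp add: nmult_field)
  have "f (of_int a) = f (of_nat m - of_nat n)" by (simp add: a)
  also have "\<dots> = f (of_nat m) - f (of_nat n)" by (rule additive_map(3)[OF assms])
  finally show ?thesis by (simp add: a imult_diff nat)
qed

text \<open>The exponential on the rationals, a homomorphism onto the complex roots of unity with
  kernel the integers.\<close>

definition cis_rat :: "rat \<Rightarrow> complex" where
  "cis_rat r = cis (2 * pi * of_rat r)"

lemma cis_rat_add: "cis_rat (r + s) = cis_rat r * cis_rat s"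
  by (simp add: cis_rat_def cis_mult of_rat_add distrib_left)

lemma cis_rat_power: "cis_rat r ^ n = cis_rat (of_nat n * r)"
  by (simp add: cis_rat_def DeMoivre of_rat_mult mult_ac)

lemma cis_rat_eq_1_iff: "cis_rat r = 1 \<longleftrightarrow> r \<in> \<int>"
proof
  assume "cis_rat r = 1"
  then have "Re (cis_rat r) = 1" by simp
  then have "cos (2 * pi * of_rat r) = 1" by (simp add: cis_rat_def)
  then obtain n :: int where "2 * pi * of_rat r = of_int n * 2 * pi" unfolding cos_one_2pi_int by blast
  then have "(of_rat r :: real) = of_rat (of_int n)" by simp
  then have "r = of_int n" by (simp only: of_rat_eq_iff)
  then show "r \<in> \<int>" by simp
next
  assume "r \<in> \<int>"
  then obtain n where "r = of_int n" by (rule Ints_cases)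
  then show "cis_rat r = 1" by (simp add: cis_rat_def cis_multiple_2pi)
qed

lemma cis_rat_eq_iff: "cis_rat r = cis_rat s \<longleftrightarrow> r - s \<in> \<int>"
proof -
  have "cis_rat s \<noteq> 0" by (simp add: cis_rat_def)
  moreover have "cis_rat r = cis_rat (r - s) * cis_rat s" using cis_rat_add[of "r - s" s] by simp
  ultimately show ?thesis using cis_rat_eq_1_iff[of "r - s"] by simp
qed

lemma root_of_unity_cis_rat:
  assumes "z ^ n = 1" "0 < n"
  obtains j :: nat where "z = cis_rat (of_nat j / of_nat n)"
proof -
  have "z \<in> (\<lambda>k. cis (2 * pi * real k / real n)) ` {..<n}"
    using bij_betw_imp_surj_on[OF bij_betw_roots_unity[OF assms(2)]] assms(1) by simp
  then obtain j where "z = cis (2 * pi * real j / real n)" by blast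
  then show thesis using that[of j] by (simp add: cis_rat_def of_rat_divide)
qed

text \<open>Linear independence in the kernel of \<open>p\<close>, seen as a vector space over the
  field with \<open>p\<close> elements, with natural numbers as scalars.\<close>

definition independent :: "nat \<Rightarrow> nat \<Rightarrow> (nat \<Rightarrow> 'g::ab_group_add) \<Rightarrow> bool" where
  "independent p k b \<longleftrightarrow> (\<forall>i<k. nmult p (b i) = 0) \<and>
     (\<forall>m. (\<Sum>i<k. nmult (m i) (b i)) = 0 \<longrightarrow> (\<forall>i<k. p dvd m i))"

lemma independent_bounded:
  fixes b :: "nat \<Rightarrow> 'g::ab_group_add"
  assumes p: "prime p" and fin: "finite {x :: 'g. nmult p x = 0}" and b: "independent p k b"
  shows "k \<le> card {x :: 'g. nmult p x = 0}"
proof -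
  have "inj_on b {..<k}"
  proof (rule inj_onI, rule ccontr)
    fix i j assume ij: "i \<in> {..<k}" "j \<in> {..<k}" "b i = b j" "i \<noteq> j"
    \<comment> \<open>The relation b i - b j = 0, with p - 1 as the natural coefficient that stands
      for - 1.\<close>
    define m where "m l = (if l = i then 1 else if l = j then p - 1 else 0)" for l
    have "(\<Sum>l<k. nmult (m l) (b l)) = (\<Sum>l\<in>{i, j}. nmult (m l) (b l))"
      using ij by (intro sum.mono_neutral_right) (auto simp: m_def)
    also have "\<dots> = nmult (1 + (p - 1)) (b i)" using ij by (simp add: m_def nmult_Suc add.commute)
    also have "\<dots> = 0" using b ij(1) prime_gt_0_nat[OF p] by (simp add: independent_def)
    finally have "p dvd m i" using b ij(1) by (simp add: independent_def)
    then show False using p by (simp add: m_def)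
  qed
  then have "k = card (b ` {..<k})" by (simp add: card_image)
  also have "\<dots> \<le> card {x :: 'g. nmult p x = 0}"
    using b by (intro card_mono[OF fin]) (auto simp: independent_def)
  finally show ?thesis .
qed

text \<open>An independent family of maximal length spans: in a relation that involves
  \<open>y\<close>, the coefficient of \<open>y\<close> is prime to \<open>p\<close> and can be
  inverted.\<close>

lemma basis_exists:
  assumes p: "prime p" and fin: "finite {x :: 'g::ab_group_add. nmult p x = 0}"
  obtains k and b :: "nat \<Rightarrow> 'g::ab_group_add" where "independent p k b"
    "\<And>y. nmult p y = 0 \<Longrightarrow> \<exists>m. y = (\<Sum>i<k. nmult (m i) (b i))"
proof -
  define P where "P k \<longleftrightarrow> (\<exists>b :: nat \<Rightarrow> 'g. independent p k b)" for k
  define k where "k = (GREATEST k. P k)"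
  have bd: "P j \<Longrightarrow> j \<le> card {x :: 'g. nmult p x = 0}" for j
    unfolding P_def using independent_bounded[OF p fin] by blast
  have "P 0" by (simp add: P_def independent_def)
  then have "P k" unfolding k_def using bd by (intro GreatestI_nat[of P 0])
  then obtain b :: "nat \<Rightarrow> 'g" where b: "independent p k b" unfolding P_def by blast
  have "\<not> P (Suc k)"
  proof
    assume "P (Suc k)"
    then have "Suc k \<le> k" unfolding k_def using bd by (intro Greatest_le_nat[of P])
    then show False by simp
  qed
  have span: "\<exists>m. y = (\<Sum>i<k. nmult (m i) (b i))" if y: "nmult p y = 0" for y
  proof -
    define b' where "b' = b(k := y)"
    have b': "b' i = b i" if "i < k" for i using that by (simp add: b'_def)
    have sum': "(\<Sum>i<Suc k. nmult (m i) (b' i)) = (\<Sum>i<k. nmult (m i) (b i)) + nmult (m k) y" for m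
      by (simp add: b' b'_def)
    have "\<not> independent p (Suc k) b'" using \<open>\<not> P (Suc k)\<close> by (auto simp: P_def)
    moreover have "\<forall>i<Suc k. nmult p (b' i) = 0"
      using b y by (simp add: independent_def b'_def less_Suc_eq)
    ultimately obtain m where m: "(\<Sum>i<k. nmult (m i) (b i)) + nmult (m k) y = 0" "\<not> (\<forall>i<Suc k. p dvd m i)"
      unfolding independent_def sum' by blast
    have "\<not> p dvd m k"
    proof
      assume d: "p dvd m k"
      then obtain c where "m k = c * p" by (metis dvdE mult.commute)
      then have "nmult (m k) y = 0" using y by (simp add: nmult_mult)
      then have "\<forall>i<k. p dvd m i" using b m(1) by (simp add: independent_def)
      then show False using m(2) d by (simp add: less_Suc_eq)
    qed
    then have "coprime (m k) p" using prime_imp_coprime_nat[OF p] by (subst coprime_commute) blast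
    then obtain u where u: "nmult u (nmult (m k) y) = y" using coprime_multiple_inverse[OF y] by blast
    have neg: "nmult (p - 1) z = - z" if "nmult p z = 0" for z :: 'g
      using nmult_add[of "p - 1" 1 z] that prime_gt_0_nat[OF p] by (simp add: eq_neg_iff_add_eq_0)
    have "nmult (m k) y = - (\<Sum>i<k. nmult (m i) (b i))" using m(1) by (simp add: eq_neg_iff_add_eq_0 add.commute)
    also have "\<dots> = nmult (p - 1) (\<Sum>i<k. nmult (m i) (b i))"
    proof (rule neg[symmetric])
      show "nmult p (\<Sum>i<k. nmult (m i) (b i)) = 0"
        using b by (simp add: nmult_sum nmult_commute[of p] independent_def)
    qed
    finally have "y = nmult u (nmult (p - 1) (\<Sum>i<k. nmult (m i) (b i)))" using u by simp
    then have "y = (\<Sum>i<k. nmult (u * ((p - 1) * m i)) (b i))" by (simp add: nmult_sum nmult_mult)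
    then show ?thesis by (rule exI[of _ "\<lambda>i. u * ((p - 1) * m i)"])
  qed
  show thesis by (rule that[OF b span])
qed

text \<open>\<open>\<rho>\<close> below chooses coordinates of an element in \<open>\<rat>\<^sup>k\<close>; they are unique modulo \<open>\<int>\<^sup>k\<close>, so that the
  exponential turns them into the isomorphism.\<close>

lemma finite_prufer_productI:
  assumes p: "prime p" and prim: "primary p (UNIV :: 'g::ab_group_add set)"
    and d: "\<And>x :: 'g. \<exists>z. nmult p z = x" and fin: "finite {x :: 'g. nmult p x = 0}"
  shows "finite_prufer_product TYPE('g) p"
proof -
  have p0: "(of_nat p :: rat) \<noteq> 0" using prime_gt_0_nat[OF p] by simp
  obtain k and b :: "nat \<Rightarrow> 'g" where b: "independent p k b"
    and span: "\<And>y. nmult p y = 0 \<Longrightarrow> \<exists>m. y = (\<Sum>i<k. nmult (m i) (b i))"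
    by (rule basis_exists[OF p fin]) blast
  have "divisible (UNIV :: 'g set)" by (rule divisible_if_prime_divisible[OF p prim d])
  then have "\<exists>\<theta> :: rat \<Rightarrow> 'g. (\<forall>r s. \<theta> (r + s) = \<theta> r + \<theta> s) \<and> \<theta> 1 = b i" for i
    by (rule divisible_hom_rat[where x = "b i"]) blast
  then have "\<forall>i. \<exists>\<theta> :: rat \<Rightarrow> 'g. (\<forall>r s. \<theta> (r + s) = \<theta> r + \<theta> s) \<and> \<theta> 1 = b i" by blast
  from choice[OF this] obtain \<theta> :: "nat \<Rightarrow> rat \<Rightarrow> 'g"
    where \<theta>: "\<And>i r s. \<theta> i (r + s) = \<theta> i r + \<theta> i s" "\<And>i. \<theta> i 1 = b i" by blast
  note \<theta>i = additive_map[of "\<theta> _", OF \<theta>(1)]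
  \<comment> \<open>With the factor \<open>p\<close>, the coordinate 1 / p in place i stands for
    \<open>b i\<close> and the coordinate 1 for 0, so that the kernel inside \<open>D\<close>
    consists of the integer vectors.\<close>
  define \<Psi> where "\<Psi> r = (\<Sum>i<k. \<theta> i (of_nat p * r i))" for r :: "nat \<Rightarrow> rat"
  define D where "D = {r :: nat \<Rightarrow> rat. \<exists>n. \<forall>i<k. of_nat (p ^ n) * r i \<in> \<int>}"
  have \<Psi>_add: "\<Psi> (\<lambda>i. r i + s i) = \<Psi> r + \<Psi> s" for r s
    by (simp add: \<Psi>_def distrib_left \<theta>(1) sum.distrib)
  have \<Psi>_diff: "\<Psi> (\<lambda>i. r i - s i) = \<Psi> r - \<Psi> s" for r s
    by (simp add: \<Psi>_def right_diff_distrib \<theta>i(3) sum_subtractf)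
  have \<Psi>_nmult: "nmult n (\<Psi> r) = \<Psi> (\<lambda>i. of_nat n * r i)" for n r
  proof -
    have "nmult n (\<theta> i q) = \<theta> i (of_nat n * q)" for i q by (simp add: \<theta>i(4)[symmetric] nmult_field)
    then show ?thesis by (simp add: \<Psi>_def nmult_sum mult.left_commute)
  qed
  have \<theta>_int: "\<theta> i (of_int a) = imult a (b i)" for i a
    using additive_of_int[of "\<theta> i" a, OF \<theta>(1)] \<theta>(2) by simp
  have pb: "nmult p (b i) = 0" if "i < k" for i using b that by (simp add: independent_def)
  have \<Psi>_int: "\<Psi> r = 0" if "\<And>i. i < k \<Longrightarrow> r i \<in> \<int>" for r
    unfolding \<Psi>_def
  proof (rule sum.neutral, rule ballI)
    fix i assume i: "i \<in> {..<k}"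
    then have "r i \<in> \<int>" using that by simp
    then obtain a where "r i = of_int a" by (rule Ints_cases)
    then have "of_nat p * r i = of_int (a * int p)" by simp
    then show "\<theta> i (of_nat p * r i) = 0" using i by (simp only: \<theta>_int imult_nmult pb lessThan_iff imult_zero)
  qed
  have D_up: "of_nat (p ^ m) * q \<in> \<int>" if "of_nat (p ^ n) * q \<in> \<int>" "n \<le> m" for q :: rat and n m
  proof -
    have "of_nat (p ^ m) * q = of_nat (p ^ (m - n)) * (of_nat (p ^ n) * q)"
      using that(2) by (simp add: power_add[symmetric] mult.assoc[symmetric])
    then show ?thesis using that(1) by (simp only:) (rule Ints_mult, simp_all)
  qed
  have D_comb: "\<exists>n. \<forall>i<k. of_nat (p ^ n) * r i \<in> \<int> \<and> of_nat (p ^ n) * s i \<in> \<int>" if rs: "r \<in> D" "s \<in> D" for r s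
  proof -
    obtain m n where mn: "\<forall>i<k. of_nat (p ^ m) * r i \<in> \<int>" "\<forall>i<k. of_nat (p ^ n) * s i \<in> \<int>"
      using rs unfolding D_def by blast
    have "of_nat (p ^ (m + n)) * r i \<in> \<int> \<and> of_nat (p ^ (m + n)) * s i \<in> \<int>" if "i < k" for i
      using D_up[of m "r i" "m + n"] D_up[of n "s i" "m + n"] mn that by simp
    then show ?thesis by blast
  qed
  have D_add: "(\<lambda>i. r i + s i) \<in> D" and D_diff: "(\<lambda>i. r i - s i) \<in> D" if rs: "r \<in> D" "s \<in> D" for r s
  proof -
    obtain n where "\<forall>i<k. of_nat (p ^ n) * r i \<in> \<int> \<and> of_nat (p ^ n) * s i \<in> \<int>" using D_comb[OF rs] by blast
    then have "\<forall>i<k. of_nat (p ^ n) * (r i + s i) \<in> \<int>" "\<forall>i<k. of_nat (p ^ n) * (r i - s i) \<in> \<int>"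
      unfolding distrib_left right_diff_distrib by (blast intro: Ints_add Ints_diff)+
    then show "(\<lambda>i. r i + s i) \<in> D" "(\<lambda>i. r i - s i) \<in> D" unfolding D_def by blast+
  qed
  have kernel_step: "\<forall>i<k. r i \<in> \<int>" if "\<forall>i<k. of_nat (p ^ n) * r i \<in> \<int>" "\<Psi> r = 0" for n r
    using that
  proof (induction n)
    case (Suc n)
    have "\<forall>i. \<exists>a. i < k \<longrightarrow> of_nat (p ^ Suc n) * r i = of_int a"
      using Suc.prems(1) by (metis Ints_cases)
    from choice[OF this] obtain a where a: "\<And>i. i < k \<Longrightarrow> of_nat (p ^ Suc n) * r i = of_int (a i)" by blast
    define m where "m i = nat (a i mod int p)" for i
    have pp: "int p > 0" using prime_gt_0_nat[OF p] by simp
    have am: "a i = int (m i) + a i div int p * int p" for i using pp by (simp add: m_def)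
    have "imult (a i) (b i) = nmult (m i) (b i)" if "i < k" for i
      by (subst am) (simp only: imult_add imult_nmult imult_of_nat pb[OF that] imult_zero add_0_right)
    moreover have "0 = nmult (p ^ n) (\<Psi> r)" using Suc.prems(2) by simp
    then have "0 = (\<Sum>i<k. \<theta> i (of_nat p * (of_nat (p ^ n) * r i)))" unfolding \<Psi>_nmult by (simp only: \<Psi>_def)
    moreover have "\<theta> i (of_nat p * (of_nat (p ^ n) * r i)) = imult (a i) (b i)" if "i < k" for i
      using a[OF that] \<theta>_int[of i "a i"] by (simp add: mult.assoc)
    ultimately have "(\<Sum>i<k. nmult (m i) (b i)) = 0" by simp
    then have pm: "p dvd m i" if "i < k" for i using b that by (simp add: independent_def)
    have "of_nat (p ^ n) * r i \<in> \<int>" if i: "i < k" for i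
    proof -
      obtain c where "m i = p * c" using pm[OF i] by (rule dvdE)
      then have "a i = int p * (int c + a i div int p)" using am[of i] by (simp add: algebra_simps)
      then have "of_nat p * (of_nat (p ^ n) * r i) = of_nat p * of_int (int c + a i div int p)"
        using a[OF i] by (metis of_int_mult of_int_of_nat_eq of_nat_mult power_Suc mult.assoc)
      then have "of_nat (p ^ n) * r i = of_int (int c + a i div int p)" using p0 by (simp only: mult_cancel_left) simp
      then show ?thesis by (simp only: Ints_of_int)
    qed
    then show ?case using Suc.IH Suc.prems(2) by blast
  qed simp
  have kernel: "r i \<in> \<int>" if "r \<in> D" "\<Psi> r = 0" "i < k" for r i
    using kernel_step that unfolding D_def by blast
  \<comment> \<open>Divide coordinates of p x, known by induction, by \<open>p\<close>. The error is
    killed by \<open>p\<close>, hence a combination of the \<open>b i\<close>, and is corrected by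
    multiples of 1 / p.\<close>
  have surj: "\<exists>r\<in>D. \<Psi> r = x" if "nmult (p ^ n) x = 0" for n x
    using that
  proof (induction n arbitrary: x)
    case 0
    have "(\<lambda>_. 0) \<in> D" "\<Psi> (\<lambda>_. 0) = 0" unfolding D_def by (simp, rule \<Psi>_int, simp)
    then show ?case using 0 by (intro bexI[of _ "\<lambda>_. 0"]) simp_all
  next
    case (Suc n)
    have "nmult (p ^ n) (nmult p x) = 0" using Suc.prems by (simp add: nmult_mult[symmetric] mult.commute)
    from Suc.IH[OF this] obtain r where r: "r \<in> D" "\<Psi> r = nmult p x" by blast
    define s where "s i = r i / of_nat p" for i
    have ps: "of_nat p * s i = r i" for i using p0 by (simp add: s_def)
    obtain j where j: "\<forall>i<k. of_nat (p ^ j) * r i \<in> \<int>" using r(1) unfolding D_def by blast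
    have e: "of_nat (p ^ Suc j) * s i = of_nat (p ^ j) * r i" for i
      by (simp add: ps[symmetric] mult.assoc mult.left_commute)
    have "s \<in> D" unfolding D_def using j by (intro CollectI exI[of _ "Suc j"]) (simp only: e)
    have "nmult p (x - \<Psi> s) = 0" by (simp add: nmult_minus \<Psi>_nmult ps r(2)[symmetric])
    then obtain m where m: "x - \<Psi> s = (\<Sum>i<k. nmult (m i) (b i))" using span by blast
    define q :: "nat \<Rightarrow> rat" where "q i = of_nat (m i) / of_nat p" for i
    have pq: "of_nat p * q i = of_int (int (m i))" for i using p0 by (simp add: q_def)
    have "q \<in> D" unfolding D_def by (intro CollectI exI[of _ 1]) (simp add: pq)
    moreover have "\<Psi> q = x - \<Psi> s" unfolding m by (simp only: \<Psi>_def pq \<theta>_int imult_of_nat)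
    ultimately have "(\<lambda>i. s i + q i) \<in> D" "\<Psi> (\<lambda>i. s i + q i) = x"
      using D_add[OF \<open>s \<in> D\<close>] by (simp_all add: \<Psi>_add)
    then show ?case by blast
  qed
  have "\<forall>x. \<exists>r. r \<in> D \<and> \<Psi> r = x"
    using prim surj unfolding primary_def by blast
  from choice[OF this] obtain \<rho> where \<rho>: "\<And>x. \<rho> x \<in> D" "\<And>x. \<Psi> (\<rho> x) = x" by blast
  define f where "f x = (\<lambda>i\<in>{..<k}. cis_rat (\<rho> x i))" for x
  \<comment> \<open>All coordinates of \<open>x\<close> in \<open>D\<close> have the same
    exponentials. This makes up for \<rho> being a mere choice, without additivity.\<close>
  have eqf: "cis_rat (\<rho> x i) = cis_rat (r i)" if "r \<in> D" "\<Psi> r = x" "i < k" for x r i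
    unfolding cis_rat_eq_iff
    using kernel[OF D_diff[OF \<rho>(1)[of x] that(1)] _ that(3)] \<Psi>_diff[of "\<rho> x" r] \<rho>(2)[of x] that(2) by simp
  let ?P = "PiE {..<k} (\<lambda>_. {z :: complex. \<exists>j. z ^ (p ^ j) = 1})"
  have mem: "f x \<in> ?P" for x
  proof -
    obtain n where n: "\<forall>i<k. of_nat (p ^ n) * \<rho> x i \<in> \<int>" using \<rho>(1)[of x] unfolding D_def by blast
    have "cis_rat (\<rho> x i) ^ (p ^ n) = 1" if "i < k" for i
      unfolding cis_rat_power cis_rat_eq_1_iff using n that by blast
    then show ?thesis unfolding f_def by (intro restrict_PiE_iff[THEN iffD2] ballI) auto
  qed
  have add: "f (x + y) = (\<lambda>i\<in>{..<k}. f x i * f y i)" for x y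
  proof (rule ext)
    fix i
    show "f (x + y) i = (\<lambda>i\<in>{..<k}. f x i * f y i) i"
    proof (cases "i < k")
      case True
      have "cis_rat (\<rho> (x + y) i) = cis_rat (\<rho> x i + \<rho> y i)"
        by (rule eqf[OF D_add[OF \<rho>(1) \<rho>(1)] _ True]) (simp add: \<Psi>_add \<rho>(2))
      then show ?thesis using True by (simp add: f_def cis_rat_add)
    qed (simp add: f_def)
  qed
  have "inj f"
  proof (rule injI)
    fix x y assume eq: "f x = f y"
    have "\<rho> x i - \<rho> y i \<in> \<int>" if "i < k" for i
      using fun_cong[OF eq, of i] that by (simp add: f_def cis_rat_eq_iff)
    then have "\<Psi> (\<lambda>i. \<rho> x i - \<rho> y i) = 0" by (rule \<Psi>_int)
    then show "x = y" by (simp add: \<Psi>_diff \<rho>(2))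
  qed
  moreover have "z \<in> range f" if z: "z \<in> ?P" for z
  proof -
    have "\<exists>n j :: nat. z i = cis_rat (of_nat j / of_nat (p ^ n))" if "i < k" for i
    proof -
      obtain n where n: "z i ^ (p ^ n) = 1" using PiE_mem[OF z, of i] \<open>i < k\<close> by auto
      have "0 < p ^ n" using prime_gt_0_nat[OF p] by simp
      with n obtain j where "z i = cis_rat (of_nat j / of_nat (p ^ n))" by (rule root_of_unity_cis_rat)
      then show ?thesis by blast
    qed
    then have "\<forall>i. \<exists>nj :: nat \<times> nat. i < k \<longrightarrow> z i = cis_rat (of_nat (snd nj) / of_nat (p ^ fst nj))" by force
    from choice[OF this] obtain g :: "nat \<Rightarrow> nat \<times> nat"
      where g: "\<And>i. i < k \<Longrightarrow> z i = cis_rat (of_nat (snd (g i)) / of_nat (p ^ fst (g i)))" by blast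
    define r :: "nat \<Rightarrow> rat" where "r i = of_nat (snd (g i)) / of_nat (p ^ fst (g i))" for i
    have "of_nat (p ^ (\<Sum>i<k. fst (g i))) * r i \<in> \<int>" if "i < k" for i
    proof (rule D_up)
      show "of_nat (p ^ fst (g i)) * r i \<in> \<int>" using p0 by (simp add: r_def)
      show "fst (g i) \<le> (\<Sum>i<k. fst (g i))" using that by (intro member_le_sum) auto
    qed
    then have "r \<in> D" unfolding D_def by blast
    then have "cis_rat (\<rho> (\<Psi> r) i) = z i" if "i < k" for i
      using eqf[OF _ refl that] g[OF that] by (simp add: r_def)
    then have "f (\<Psi> r) = z" by (intro PiE_ext[OF mem z]) (simp add: f_def)
    then show ?thesis by (metis rangeI)
  qed
  ultimately have bij: "bij_betw f UNIV ?P" using mem unfolding bij_betw_def by blast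
  have "f \<in> iso (additive_group TYPE('g)) (product_group {..<k} (\<lambda>_. prufer_group p))"
    using bij mem add by (simp add: iso_def hom_def additive_group_def prufer_group_def product_group_def)
  then show ?thesis unfolding finite_prufer_product_def is_iso_def by blast
qed

context minimal_omega_valued
begin

lemma classification:
  "\<exists>p. prime p \<and>
      ((elementary_abelian TYPE('g) p \<and>
        ((\<exists>n0. finite {\<gamma>. \<not> (layer v p n0 \<gamma>)}) \<or>
         (\<forall>n. finite {\<gamma>. layer v p n \<gamma>})))
       \<or>
       (finite_prufer_product TYPE('g) p \<and>
        eventually_right_shift v p \<and>
        (\<exists>n0. finite {\<gamma>. \<not> (layer v p n0 \<gamma>)})))"
proof (cases "\<exists>p. prime p \<and> (\<forall>x :: 'g. nmult p x = 0)")
  case True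
  then obtain p where p: "prime p" "\<forall>x :: 'g. nmult p x = 0" by blast
  have "elementary_abelian TYPE('g) p" unfolding elementary_abelian_def by (rule p(2))
  then show ?thesis using p(1) elementary_layers[of p] by blast
next
  case False
  \<comment> \<open>This is needed for every prime, as \<open>unique_prime\<close> compares
    divisions by different primes.\<close>
  have fin: "finite {x :: 'g. nmult q x = 0}" if "prime q" for q
    using False that kernel_finite_or_UNIV[of q] by blast
  have d: "\<exists>z. nmult q z = (x :: 'g)" if "prime q" for q x
    by (rule divisible_if_finite_kernel[OF fin[OF that]])
  obtain p where p: "prime p" "primary p (UNIV :: 'g set)" and fixed: "finite {x. v (nmult p x) = v x}"
    by (rule unique_prime[OF d])
  obtain N l where shift: "\<And>x. int N \<le> rk x \<Longrightarrow> rk (nmult p x) = rk x - int l"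
    by (rule shift_exists[OF fin[OF p(1)]]) blast
  obtain N0 where N0: "\<And>x. x \<in> {x. v (nmult p x) = v x} \<Longrightarrow> rk x \<le> int N0"
    by (rule bounded_rk[OF fixed]) blast
  have "rk (nmult p x) < rk x" if "int (Suc N0) \<le> rk x" for x
  proof -
    have "v (nmult p x) \<noteq> v x" using N0[of x] that by auto
    then have "rk (nmult p x) \<noteq> rk x" using v_eq[of x] v_eq[of "nmult p x"] by metis
    then show ?thesis using rk_nmult[of p x] by simp
  qed
  note bd = Rrel_bounded[OF fin[OF p(1)] this]
  obtain N1 where R: "\<forall>m. \<forall>i\<ge>N1. \<forall>j\<ge>N1. Rrel v m (h i) \<longleftrightarrow> Rrel v m (h j)"
    using Rrel_uniform[OF bd] by blast
  have "eventually_right_shift v p"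
  proof (rule eventually_right_shiftI[OF p])
    show "rk (nmult p x) = rk x - int l" if "int (N + N1) \<le> rk x" for x using shift that by simp
    show "Rrel v m (h i) \<longleftrightarrow> Rrel v m (h j)" if "N + N1 \<le> i" "N + N1 \<le> j" for m i j
      using R[rule_format, of i j m] that by simp
  qed
  moreover have "finite_prufer_product TYPE('g) p"
    by (rule finite_prufer_productI[OF p d[OF p(1)] fin[OF p(1)]])
  moreover note Rrel_stable[OF p(1) bd]
  ultimately show ?thesis using p(1) by blast
qed

end

theorem theorem5:
  fixes v :: "'g::ab_group_add \<Rightarrow> 'c::{linorder, order_top}"
  assumes "valued_abelian_group v"
    and "infinite (UNIV :: 'c set)"
  shows "minimal_valued_group v \<longleftrightarrow>
    order_type_omega_star TYPE('c) \<and>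
    (\<forall>\<gamma>. finite {x. v x = \<gamma>}) \<and>
    (\<exists>p::nat. prime p \<and>
      ((elementary_abelian TYPE('g) p \<and>
        ((\<exists>n0. finite {\<gamma>. \<not> (Rrel v (p ^ n0) \<gamma> \<and> \<not> Rrel v (p ^ (n0 + 1)) \<gamma>)}) \<or>
         (\<forall>n. finite {\<gamma>. Rrel v (p ^ n) \<gamma> \<and> \<not> Rrel v (p ^ (n + 1)) \<gamma>})))
       \<or>
       (finite_prufer_product TYPE('g) p \<and>
        eventually_right_shift v p \<and>
        (\<exists>n0. finite {\<gamma>. \<not> (Rrel v (p ^ n0) \<gamma> \<and> \<not> Rrel v (p ^ (n0 + 1)) \<gamma>)}))))"
proof (rule iffI, goal_cases)
  case 1
  obtain h where "omega_valued v h" by (rule omega_valued_if_minimal[OF assms 1])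
  then interpret omega_valued v h .
  interpret minimal_omega_valued v h
    by unfold_locales (use 1 in \<open>simp add: minimal_valued_group_def\<close>)
  have "order_type_omega_star TYPE('c)"
    unfolding order_type_omega_star_def using bij_h h_le_iff by (intro exI[of _ h]) simp
  then show ?case using finite_fibre classification by (intro conjI allI)
next
  case 2
  obtain h :: "nat \<Rightarrow> 'c" where h: "bij h" "\<forall>i j. i \<le> j \<longleftrightarrow> h j \<le> h i"
    using conjunct1[OF 2] unfolding order_type_omega_star_def by (elim exE conjE)
  have fib: "finite {x. v x = \<gamma>}" for \<gamma>
    using conjunct1[OF conjunct2[OF 2]] by (rule spec)
  interpret valued_abelian_group v by (rule assms(1))
  interpret omega_valued v h
  proof
    show "h j \<le> h i \<longleftrightarrow> i \<le> j" for i j using h(2) by simp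
  qed (fact h(1) fib)+
  from conjunct2[OF conjunct2[OF 2]] show ?case by (elim exE conjE[of "prime _"]) (rule minimal_if)
qed

end
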